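(* For every pair of exponents $1<r<s<\infty$ satisfying $3\bigl(\frac1r-\frac1s\bigr)=2$ and $1<r<\frac32$, there is a constant $C_{r,s}<\infty$ such that for every $\kappa>0$, $$\|u\|_{L^s(\mathbb R^3,dV_{-\kappa})}\le C_{r,s}\bigl\|\bigl(\Delta_{-\kappa}+\kappa+\zeta\bigr)u\bigr\|_{L^r(\mathbb R^3,dV_{-\kappa})}\quad\text{for all }u\in C_0^\infty(\mathbb R^3),\ \zeta\in\mathbb C.$$ In particular, on three-dimensional hyperbolic space, $$\|u\|_{L^s(\mathbb H^3,dV_{\mathbb H^3})}\le C_{r,s}\bigl\|\bigl(\Delta_{\mathbb H^3}+1+\zeta\bigr)u\bigr\|_{L^r(\mathbb H^3,dV_{\mathbb H^3})}\quad\text{for all }u\in C_0^\infty(\mathbb H^3),\ \zeta\in\mathbb C.$$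
   Context: For $\kappa>0$, the simply connected $3$-manifold of constant curvature $-\kappa$ is $\mathbb R^3$ endowed with the metric which in geodesic polar coordinates about any point is $ds^2=dr^2+\bigl(\frac{\sinh\sqrt\kappa r}{\sqrt\kappa}\bigr)^2|d\theta|^2$, $0<r<\infty$, $\theta\in S^{2}$. Its volume element is $dV_{-\kappa}=\bigl(\frac{\sinh\sqrt\kappa r}{\sqrt\kappa}\bigr)^{2}dr\,d\theta$, and $\Delta_{-\kappa}$ is the associated (nonpositive) Laplace–Beltrami operator. For curvature $-1$ this is standard hyperbolic space $\mathbb H^3$, with $dV_{\mathbb H^3}=dV_{-1}$ and $\Delta_{\mathbb H^3}=\Delta_{-1}$. The constant $C_{r,s}$ depends only on $r,s$, not on $u$, $\zeta$ or $\kappa$. *)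

theory Defs
  imports "HOL-Analysis.Analysis"
begin

definition partial :: "'n \<Rightarrow> (real^'n \<Rightarrow> 'b::real_normed_vector) \<Rightarrow> real^'n \<Rightarrow> 'b"
  where "partial i f x = vector_derivative (\<lambda>t. f (x + t *\<^sub>R axis i 1)) (at 0)"

text \<open>Every iterated partial derivative is differentiable at every point; in particular every
  iterated partial derivative is continuous, so this is the usual class of \<open>C\<^sup>\<infinity>\<close> functions.\<close>

definition smooth :: "(real^'n \<Rightarrow> 'b::real_normed_vector) \<Rightarrow> bool"
  where "smooth f \<longleftrightarrow> (\<forall>is x. foldr partial is f differentiable (at x))"

definition test_functions :: "(real^'n \<Rightarrow> complex) set"
  where "test_functions = {u. smooth u \<and> compact (closure {x. u x \<noteq> 0})}"

definition Lp_norm :: "real \<Rightarrow> 'a measure \<Rightarrow> ('a \<Rightarrow> complex) \<Rightarrow> ennreal"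
  where "Lp_norm p M f =
    (let I = (\<integral>\<^sup>+ x. ennreal (norm (f x) powr p) \<partial>M)
     in if I = \<infinity> then \<infinity> else ennreal (enn2real I powr (1 / p)))"

type_synonym 'n metric_field = "real^'n \<Rightarrow> real^'n^'n"  (* matrices in Cartesian coordinates *)

definition riemannian_volume :: "('n::finite) metric_field \<Rightarrow> (real^'n) measure"
  where "riemannian_volume g = density lborel (\<lambda>x. ennreal (sqrt (det (g x))))"

definition laplace_beltrami ::
    "('n::finite) metric_field \<Rightarrow> (real^'n \<Rightarrow> complex) \<Rightarrow> real^'n \<Rightarrow> complex"
  where "laplace_beltrami g u x =
    (1 / sqrt (det (g x))) *\<^sub>R
      (\<Sum>i\<in>UNIV. partial i
         (\<lambda>y. \<Sum>j\<in>UNIV. (sqrt (det (g y)) * matrix_inv (g y) $ i $ j) *\<^sub>R partial j u y) x)"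

text \<open>
  The metric of curvature \<open>-\<kappa>\<close>: with \<open>x = r \<theta>\<close> and \<open>r = norm x\<close>, the radial part of a vector
  has its Euclidean length, and the part orthogonal to \<open>\<theta>\<close>, whose Euclidean squared length is
  \<open>r\<^sup>2 |d\<theta>|\<^sup>2\<close>, is stretched by \<open>sinh (\<surd>\<kappa> r) / (\<surd>\<kappa> r)\<close>.
  At the origin \<open>\<theta>\<close> is 0 and the stretching factor is 1, so the metric is the identity, which is
  its smooth extension.
\<close>

definition stretch :: "real \<Rightarrow> real \<Rightarrow> real"
  where "stretch \<kappa> r = (if r = 0 then 1 else sinh (sqrt \<kappa> * r) / (sqrt \<kappa> * r))"

definition hyp_metric :: "real \<Rightarrow> 3 metric_field"
  where "hyp_metric \<kappa> x =
    (let \<theta> = x /\<^sub>R norm x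
     in \<chi> i j. \<theta> $ i * \<theta> $ j + (stretch \<kappa> (norm x))\<^sup>2 * ((if i = j then 1 else 0) - \<theta> $ i * \<theta> $ j))"

abbreviation hyp_volume :: "real \<Rightarrow> (real^3) measure"  (* dV of curvature -\<kappa> *)
  where "hyp_volume \<kappa> \<equiv> riemannian_volume (hyp_metric \<kappa>)"

abbreviation hyp_laplacian :: "real \<Rightarrow> (real^3 \<Rightarrow> complex) \<Rightarrow> real^3 \<Rightarrow> complex"
  where "hyp_laplacian \<kappa> \<equiv> laplace_beltrami (hyp_metric \<kappa>)"

text \<open>
  In geodesic polar coordinates the metric is
  \<open>dr\<^sup>2 + (sinh (\<surd>\<kappa> r) / \<surd>\<kappa>)\<^sup>2 |d\<theta>|\<^sup>2\<close>: the vector \<open>a \<theta> + r \<eta>\<close> is the velocity of a curve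
  \<open>r(t) \<theta>(t)\<close> with \<open>r' = a\<close> and \<open>\<theta>' = \<eta>\<close>.
\<close>

lemma hyp_metric_polar:
  fixes \<theta> \<eta> :: "real^3"
  assumes "r > 0" "\<kappa> > 0" "norm \<theta> = 1" "\<theta> \<bullet> \<eta> = 0"
  shows "(a *\<^sub>R \<theta> + r *\<^sub>R \<eta>) \<bullet> (hyp_metric \<kappa> (r *\<^sub>R \<theta>) *v (a *\<^sub>R \<theta> + r *\<^sub>R \<eta>))
    = a\<^sup>2 + (sinh (sqrt \<kappa> * r) / sqrt \<kappa>)\<^sup>2 * (norm \<eta>)\<^sup>2"
proof -
  define c where "c = (stretch \<kappa> r)\<^sup>2"
  have n: "norm (r *\<^sub>R \<theta>) = r" and t: "(r *\<^sub>R \<theta>) /\<^sub>R r = \<theta>" using assms by simp_all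
  have tt: "\<theta> \<bullet> \<theta> = 1" using assms by (simp add: norm_eq_1)
  have act: "hyp_metric \<kappa> (r *\<^sub>R \<theta>) *v v = (\<theta> \<bullet> v) *\<^sub>R \<theta> + c *\<^sub>R (v - (\<theta> \<bullet> v) *\<^sub>R \<theta>)" for v
    unfolding hyp_metric_def Let_def n t c_def[symmetric]
    by (simp add: vec_eq_iff matrix_vector_mult_def inner_vec_def sum_3 forall_3 algebra_simps)
  have "(a *\<^sub>R \<theta> + r *\<^sub>R \<eta>) \<bullet> (hyp_metric \<kappa> (r *\<^sub>R \<theta>) *v (a *\<^sub>R \<theta> + r *\<^sub>R \<eta>))
      = a\<^sup>2 + c * r\<^sup>2 * (\<eta> \<bullet> \<eta>)"
    using assms(4) unfolding act
    by (simp add: inner_add_left inner_add_right inner_diff_left inner_diff_right tt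
        inner_commute[of \<eta> \<theta>] power2_eq_square algebra_simps)
  also have "c * r\<^sup>2 = (sinh (sqrt \<kappa> * r) / sqrt \<kappa>)\<^sup>2"
    using assms by (simp add: c_def stretch_def power_divide power_mult_distrib)
  finally show ?thesis by (simp add: power2_norm_eq_inner)
qed

text \<open>
  The volume element is \<open>(sinh (\<surd>\<kappa> r) / \<surd>\<kappa>)\<^sup>2 dr d\<theta>\<close>, since \<open>dx = r\<^sup>2 dr d\<theta>\<close>.
\<close>

lemma sqrt_det_hyp_metric: "sqrt (det (hyp_metric \<kappa> x)) = (stretch \<kappa> (norm x))\<^sup>2"
proof (cases "x = 0")
  case True
  then show ?thesis by (simp add: hyp_metric_def stretch_def det_3)
next
  case False
  define \<theta> where "\<theta> = x /\<^sub>R norm x"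
  define c where "c = (stretch \<kappa> (norm x))\<^sup>2"
  have "norm \<theta> = 1" using False by (simp add: \<theta>_def)
  then have "\<theta> \<bullet> \<theta> = 1" by (simp add: norm_eq_1)
  then have tt: "\<theta>$1 * \<theta>$1 = 1 - \<theta>$2 * \<theta>$2 - \<theta>$3 * \<theta>$3"
    by (simp add: inner_vec_def sum_3)
  have "det (hyp_metric \<kappa> x) =
      c ^ 3 + c\<^sup>2 * (1 - c) * (\<theta>$1 * \<theta>$1 + \<theta>$2 * \<theta>$2 + \<theta>$3 * \<theta>$3)"
    unfolding hyp_metric_def Let_def \<theta>_def[symmetric] c_def[symmetric]
    by (simp add: det_3 power2_eq_square power3_eq_cube algebra_simps)
  also have "\<dots> = c\<^sup>2"
    using tt by (simp add: power2_eq_square power3_eq_cube algebra_simps)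
  finally show ?thesis by (simp only: real_sqrt_abs c_def abs_power2)
qed

lemma hyp_volume_eq:
  "hyp_volume \<kappa> = density lborel (\<lambda>x. ennreal ((stretch \<kappa> (norm x))\<^sup>2))"
  by (simp add: riemannian_volume_def sqrt_det_hyp_metric)

end

theory Submission
  imports Defs
begin

text \<open>
  With \<open>\<zeta> = - \<mu>\<^sup>2\<close> and \<open>Re \<mu> \<ge> 0\<close>, the resolvent kernel of \<open>\<Delta> + 1 + \<zeta>\<close> in curvature \<open>-1\<close> is a
  multiple of \<open>exp (- \<mu> d) / sinh d\<close>, where \<open>d\<close> is the hyperbolic distance. It is dominated by
  \<open>1 / sinh d\<close> uniformly in \<open>\<zeta>\<close>, so \<open>u\<close> is bounded pointwise by the integral of
  \<open>|(\<Delta> + 1 + \<zeta>) u| / sinh d\<close>. Since \<open>1 / sinh d\<close> is of weak type \<open>L\<^sup>3\<close> for the hyperbolic volume, uniformly in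
  the pole, the Hardy--Littlewood--Sobolev argument gives \<open>L\<^sup>r \<rightarrow> L\<^sup>s\<close>. The scaling
  \<open>x \<mapsto> \<surd>\<kappa> x\<close> reduces curvature \<open>-\<kappa>\<close> to curvature \<open>-1\<close>, and \<open>3 (1/r - 1/s) = 2\<close> makes
  the constant independent of \<open>\<kappa>\<close>.

  To obtain the pointwise bound, the singular kernel is replaced by
  \<open>(exp (- \<mu> d) - exp (- m d)) / sinh d\<close>, which is bounded and has an integrable second derivative.
  Applying \<open>\<Delta> + 1 + \<zeta>\<close> to it yields a multiple of \<open>exp (- m d) / sinh d\<close>, which is an approximate
  identity as \<open>m \<rightarrow> \<infinity>\<close>. Radial integrals about an arbitrary pole are reduced to the pole \<open>0\<close> by Lorentz boosts
  in the coordinates \<open>v = sinh |y| y / |y|\<close>, in which the volume is \<open>dv / \<surd>(1 + |v|\<^sup>2)\<close>.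
\<close>

section \<open>A Hardy--Littlewood--Sobolev inequality for weak-type kernels\<close>

text \<open>The spectral shift decides the shape of the kernel. For a function G of the distance d,
  the product f = sinh d * G turns (Laplacian + 1 - \<mu>^2) G = 0 into f'' = \<mu>^2 f: the shift
  cancels the zeroth-order term. Hence the pure exponential, and \<open>0 \<le> Re \<mu>\<close>
  alone bounds it by 1. The kernel 1 / sinh d just fails to be in L^3 near the pole, which forces
  the weak-type argument. \<open>laplace_beltrami\<close> is written in Cartesian coordinates about
  the origin, while the kernel is radial about another point x. The link is q = cosh d(x, .), the
  restriction of a linear function on Minkowski space: its gradient has squared length q^2 - 1 and
  its Laplacian is 3 q, and both facts become polynomial identities. Subtracting exp (- m d) makes
  the kernel bounded, so no ball has to be cut out around the pole and no surface integral appears.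
  The price is a factor 2 in the pointwise bound.\<close>

lemma mult_le_powr_add_powr:
  fixes x y p q :: real
  assumes "0 \<le> x" "0 \<le> y" "1 < p" and q: "q = p / (p - 1)"
  shows "x * y \<le> x powr p + y powr q"
\<comment> \<open>At \<open>y = x powr (p - 1)\<close> the product equals both
  \<open>x powr p\<close> and \<open>y powr q\<close>; on either side of this curve one of the two
  terms already dominates it.\<close>
proof (cases "y \<le> x powr (p - 1)")
  case True
  then have "x * y \<le> x * x powr (p - 1)"
    using assms by (intro mult_left_mono)
  also have "\<dots> = x powr p"
    using assms by (simp add: powr_mult_base)
  finally show ?thesis by (simp add: add_increasing2)
next
  case False
  have "x = (x powr (p - 1)) powr (1 / (p - 1))"
    using assms by (simp add: powr_powr)
  also have "\<dots> \<le> y powr (1 / (p - 1))"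
    using False assms by (intro powr_mono2) auto
  finally have "x * y \<le> y powr (1 / (p - 1)) * y"
    using assms by (intro mult_right_mono)
  also have "\<dots> = y powr q"
  proof -
    have "q = 1 + 1 / (p - 1)" using assms by (simp add: field_simps)
    then show ?thesis using assms by (simp add: powr_mult_base[symmetric] mult.commute)
  qed
  finally show ?thesis by (simp add: add_increasing)
qed

text \<open>\<open>k1\<close> and \<open>k2\<close> are the two consequences of a weak L^3 bound
  that the splitting at a level \<open>l\<close> consumes: the integral of the part of
  \<open>k\<close> above \<open>l\<close>, and the \<open>t'\<close>-th moment of the part below
  it.\<close>

lemma truncated_weak_kernel_bound:
  fixes h k :: "'a \<Rightarrow> real"
  assumes [measurable]: "h \<in> borel_measurable M" "k \<in> borel_measurable M"
    and h0: "\<And>x. 0 \<le> h x" and k0: "\<And>x. 0 \<le> k x"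
    and t: "1 < t" "t' = t / (t - 1)"
    and h1: "(\<integral>\<^sup>+ x. ennreal (h x powr t) \<partial>M) \<le> 1"
    and k1: "\<And>l. 0 < l \<Longrightarrow> (\<integral>\<^sup>+ x. ennreal (k x) * indicator {x. l < k x} x \<partial>M) \<le> ennreal (c / l\<^sup>2)"
    and k2: "\<And>l. 0 < l \<Longrightarrow> (\<integral>\<^sup>+ x. ennreal (k x powr t') * indicator {x. k x \<le> l} x \<partial>M)
      \<le> ennreal (c * l powr (t' - 3))"
    and B: "0 < B" and c: "0 \<le> c"
  shows "(\<integral>\<^sup>+ x. ennreal (h x * k x) * indicator {x. h x \<le> B} x \<partial>M)
    \<le> ennreal ((2 * c + 1) * B powr (1 - 2 * t / 3))"
proof -
  \<comment> \<open>This level balances the bound by \<open>B\<close> where \<open>k\<close> is large and Young's inequality where it is small.\<close>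
  define l where "l = B powr (t / 3)"
  \<comment> \<open>\<open>\<alpha>\<close> equalizes the powers of \<open>l\<close> in the two
    terms of Young's inequality: \<open>\<alpha> * t = - \<alpha> * t' + (t' - 3)\<close>, because
    \<open>t + t' = t * t'\<close>.\<close>
  define \<alpha> where "\<alpha> = (t' - 3) / (t * t')"
  have l: "0 < l" using B by (simp add: l_def)
  have t': "1 < t'" "t' * (t - 1) = t" using t by (simp_all add: less_divide_eq)
  have "(\<integral>\<^sup>+ x. ennreal (h x * k x) * indicator {x. h x \<le> B} x \<partial>M)
    \<le> (\<integral>\<^sup>+ x. ennreal B * (ennreal (k x) * indicator {x. l < k x} x)
        + (ennreal (l powr (\<alpha> * t)) * ennreal (h x powr t)
          + ennreal (l powr (- \<alpha> * t')) * (ennreal (k x powr t') * indicator {x. k x \<le> l} x)) \<partial>M)"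
  proof (rule nn_integral_mono)
    fix x assume "x \<in> space M"
    show "ennreal (h x * k x) * indicator {x. h x \<le> B} x \<le>
        ennreal B * (ennreal (k x) * indicator {x. l < k x} x)
        + (ennreal (l powr (\<alpha> * t)) * ennreal (h x powr t)
          + ennreal (l powr (- \<alpha> * t')) * (ennreal (k x powr t') * indicator {x. k x \<le> l} x))"
    proof (cases "h x \<le> B")
      case hB: True
      show ?thesis
      proof (cases "l < k x")
        case True
        have "ennreal (h x * k x) \<le> ennreal B * ennreal (k x)"
          using hB k0[of x] B by (simp add: ennreal_mult[symmetric] mult_right_mono)
        then show ?thesis using hB True by (simp add: add_increasing2)
      next
        case False
        have "h x * k x = (l powr \<alpha> * h x) * (l powr (- \<alpha>) * k x)"
          using l by (simp add: powr_minus field_simps)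
        also have "\<dots> \<le> (l powr \<alpha> * h x) powr t + (l powr (- \<alpha>) * k x) powr t'"
          using h0[of x] k0[of x] t by (intro mult_le_powr_add_powr) auto
        also have "\<dots> = l powr (\<alpha> * t) * h x powr t + l powr (- \<alpha> * t') * k x powr t'"
          using h0[of x] k0[of x] by (simp add: powr_mult powr_powr)
        finally show ?thesis using hB False by (simp add: ennreal_mult[symmetric] ennreal_plus[symmetric] ennreal_leI del: ennreal_plus)
      qed
    qed auto
  qed
  also have "\<dots> = ennreal B * (\<integral>\<^sup>+ x. ennreal (k x) * indicator {x. l < k x} x \<partial>M)
        + (ennreal (l powr (\<alpha> * t)) * (\<integral>\<^sup>+ x. ennreal (h x powr t) \<partial>M)
          + ennreal (l powr (- \<alpha> * t')) * (\<integral>\<^sup>+ x. ennreal (k x powr t') * indicator {x. k x \<le> l} x \<partial>M))"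
    by (simp add: nn_integral_add nn_integral_cmult)
  also have "\<dots> \<le> ennreal B * ennreal (c / l\<^sup>2) + (ennreal (l powr (\<alpha> * t)) * 1
      + ennreal (l powr (- \<alpha> * t')) * ennreal (c * l powr (t' - 3)))"
    by (intro add_mono mult_left_mono k1 k2 h1 l) auto
  also have "\<dots> = ennreal (B * (c / l\<^sup>2) + (l powr (\<alpha> * t) + l powr (- \<alpha> * t') * (c * l powr (t' - 3))))"
    using B c by (simp add: ennreal_mult[symmetric] ennreal_plus[symmetric] del: ennreal_plus)
  also have "B * (c / l\<^sup>2) = c * B powr (1 - 2 * t / 3)"
  proof -
    have "l\<^sup>2 = B powr (2 * t / 3)"
      using B by (simp add: l_def power2_eq_square powr_add[symmetric])
    then show ?thesis using B by (simp add: powr_diff)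
  qed
  also have "l powr (\<alpha> * t) = B powr (1 - 2 * t / 3)"
  proof -
    have "\<alpha> * t = 1 - 3 / t'" using t t' by (simp add: \<alpha>_def field_simps)
    also have "3 / t' = 3 * (t - 1) / t" using t by simp
    finally have "t / 3 * (\<alpha> * t) = 1 - 2 * t / 3" using t by (simp add: field_simps)
    then show ?thesis unfolding l_def powr_powr by (simp only:)
  qed
  also have "l powr (- \<alpha> * t') * (c * l powr (t' - 3)) = c * l powr (- \<alpha> * t' + (t' - 3))"
    using l by (simp only: powr_add) simp
  also have "- \<alpha> * t' + (t' - 3) = (t' - 3) * (1 - 1 / t)"
    using t t' by (simp add: \<alpha>_def field_simps)
  also have "l powr \<dots> = B powr (1 - 2 * t / 3)"
  proof -
    have "t / 3 * ((t' - 3) * (1 - 1 / t)) = ((t' * (t - 1)) - 3 * (t - 1)) / 3"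
      using t by (simp add: field_simps)
    also have "\<dots> = 1 - 2 * t / 3" unfolding t' by (simp add: field_simps)
    finally show ?thesis unfolding l_def powr_powr by (simp only:)
  qed
  finally show ?thesis by (simp add: algebra_simps)
qed

text \<open>
  Split according to \<open>h(x)\<^sup>t \<le> f(y)\<^sup>p\<close> or not. On the first part integrate in \<open>x\<close> first: the truncated bound with
  \<open>B = f(y)\<^bsup>p/t\<^esup>\<close> turns the factor \<open>f(y)\<close> into exactly \<open>f(y)\<^sup>p\<close>. The other part is symmetric.
\<close>

lemma weak_kernel_bilinear_bound:
  fixes K :: "'a \<Rightarrow> 'a \<Rightarrow> real"
  assumes M: "sigma_finite_measure M"
    and K_meas: "(\<lambda>z. K (fst z) (snd z)) \<in> borel_measurable (M \<Otimes>\<^sub>M M)"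
    and meas[measurable]: "f \<in> borel_measurable M" "h \<in> borel_measurable M"
    and f0: "\<And>x. 0 \<le> f x" and h0: "\<And>x. 0 \<le> h x" and K0: "\<And>x y. 0 \<le> K x y"
    and sym: "\<And>x y. K x y = K y x"
    and pt: "1 < p" "1 < t" "1 / p + 1 / t = 5 / 3"
    and K1: "\<And>x l. 0 < l \<Longrightarrow> (\<integral>\<^sup>+ y. ennreal (K x y) * indicator {y. l < K x y} y \<partial>M) \<le> ennreal (c / l\<^sup>2)"
    and K2: "\<And>x l e. 0 < l \<Longrightarrow> e \<in> {p / (p - 1), t / (t - 1)} \<Longrightarrow>
      (\<integral>\<^sup>+ y. ennreal (K x y powr e) * indicator {y. K x y \<le> l} y \<partial>M) \<le> ennreal (c * l powr (e - 3))"
    and c: "0 \<le> c"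
    and f1: "(\<integral>\<^sup>+ x. ennreal (f x powr p) \<partial>M) \<le> 1"
    and h1: "(\<integral>\<^sup>+ x. ennreal (h x powr t) \<partial>M) \<le> 1"
  shows "(\<integral>\<^sup>+ x. \<integral>\<^sup>+ y. ennreal (h x * K x y * f y) \<partial>M \<partial>M) \<le> ennreal (2 * (2 * c + 1))"
proof -
  interpret sigma_finite_measure M by (rule M)
  interpret pair_sigma_finite M M ..
  have [measurable]: "(\<lambda>y. K x y) \<in> borel_measurable M" if "x \<in> space M" for x
    using measurable_compose[OF measurable_Pair1'[OF that] K_meas] by simp
  have Ks [measurable]: "(\<lambda>x. K x y) \<in> borel_measurable M" if "y \<in> space M" for y
    using measurable_compose[OF measurable_Pair2'[OF that] K_meas] by simp
  note K_meas [measurable]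
  \<comment> \<open>Generic in the functions and exponents, because it is applied twice: the second
    time with \<open>f\<close> and \<open>h\<close>, and \<open>p\<close> and \<open>t\<close>,
    exchanged.\<close>
  have half: "(\<integral>\<^sup>+ y. \<integral>\<^sup>+ x. ennreal (f y) * (ennreal (h x * K y x) * indicator {x. h x \<le> f y powr (p / t)} x) \<partial>M \<partial>M)
      \<le> ennreal (2 * c + 1)"
    if meas[measurable]: "f \<in> borel_measurable M" "h \<in> borel_measurable M"
    and f0: "\<And>x. 0 \<le> f x" and h0: "\<And>x. 0 \<le> h x"
    and pt: "1 < p" "1 < t" "1 / p + 1 / t = 5 / 3"
    and K2: "\<And>x l. 0 < l \<Longrightarrow>
      (\<integral>\<^sup>+ y. ennreal (K x y powr (t / (t - 1))) * indicator {y. K x y \<le> l} y \<partial>M) \<le> ennreal (c * l powr (t / (t - 1) - 3))"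
    and f1: "(\<integral>\<^sup>+ x. ennreal (f x powr p) \<partial>M) \<le> 1"
    and h1: "(\<integral>\<^sup>+ x. ennreal (h x powr t) \<partial>M) \<le> 1"
    for f h :: "'a \<Rightarrow> real" and p t
  proof -
    have "(\<integral>\<^sup>+ x. ennreal (f y) * (ennreal (h x * K y x) * indicator {x. h x \<le> f y powr (p / t)} x) \<partial>M)
        \<le> ennreal (2 * c + 1) * ennreal (f y powr p)" if y: "y \<in> space M" for y
    proof (cases "f y = 0")
      case False
      then have fy: "0 < f y" using f0[of y] by linarith
      have "(\<integral>\<^sup>+ x. ennreal (f y) * (ennreal (h x * K y x) * indicator {x. h x \<le> f y powr (p / t)} x) \<partial>M)
        = ennreal (f y) * (\<integral>\<^sup>+ x. (ennreal (h x * K y x) * indicator {x. h x \<le> f y powr (p / t)} x) \<partial>M)"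
        using y by (intro nn_integral_cmult) measurable
      also have "\<dots> \<le> ennreal (f y) * ennreal ((2 * c + 1) * (f y powr (p / t)) powr (1 - 2 * t / 3))"
        using y fy by (intro mult_left_mono truncated_weak_kernel_bound[OF _ _ h0 K0 pt(2) refl h1 K1 K2 _ c])
            simp_all
      also have "\<dots> = ennreal ((2 * c + 1) * (f y powr 1 * f y powr (p / t * (1 - 2 * t / 3))))"
        using fy c by (simp add: powr_powr ennreal_mult[symmetric] mult.left_commute)
      also have "f y powr 1 * f y powr (p / t * (1 - 2 * t / 3)) = f y powr p"
      proof -
        have "1 + p / t * (1 - 2 * t / 3) = 1 + p * (1 / t) - 2 * p / 3"
          using pt by (simp add: field_simps)
        \<comment> \<open>The relation between the exponents makes the total power of
          \<open>f y\<close> exactly \<open>p\<close>, so that the normalization of \<open>f\<close>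
          applies.\<close>
        also have "1 / t = 5 / 3 - 1 / p" using pt by simp
        finally have "1 + p / t * (1 - 2 * t / 3) = p" using pt by (simp add: field_simps)
        then show ?thesis unfolding powr_add[symmetric] by simp
      qed
      finally show ?thesis using c by (simp add: ennreal_mult)
    qed simp
    then have "(\<integral>\<^sup>+ y. \<integral>\<^sup>+ x. ennreal (f y) * (ennreal (h x * K y x) * indicator {x. h x \<le> f y powr (p / t)} x) \<partial>M \<partial>M)
      \<le> (\<integral>\<^sup>+ y. ennreal (2 * c + 1) * ennreal (f y powr p) \<partial>M)"
      by (rule nn_integral_mono)
    also have "\<dots> = ennreal (2 * c + 1) * (\<integral>\<^sup>+ y. ennreal (f y powr p) \<partial>M)"
      by (intro nn_integral_cmult) measurable
    also have "\<dots> \<le> ennreal (2 * c + 1) * 1" by (intro mult_left_mono f1) simp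
    finally show ?thesis by simp
  qed
  let ?A = "\<lambda>x y. ennreal (f y) * (ennreal (h x * K y x) * indicator {x. h x \<le> f y powr (p / t)} x)"
  let ?B = "\<lambda>x y. ennreal (h x) * (ennreal (f y * K x y) * indicator {y. f y \<le> h x powr (t / p)} y)"
  have [measurable]: "(\<lambda>z. K (snd z) (fst z)) \<in> borel_measurable (M \<Otimes>\<^sub>M M)"
    using K_meas by (simp add: sym[of "snd z" "fst z" for z])
  have [measurable]: "case_prod ?A \<in> borel_measurable (M \<Otimes>\<^sub>M M)"
    unfolding split_beta' by measurable
  have [measurable]: "case_prod ?B \<in> borel_measurable (M \<Otimes>\<^sub>M M)"
    unfolding split_beta' by measurable
  have "(\<integral>\<^sup>+ x. \<integral>\<^sup>+ y. ennreal (h x * K x y * f y) \<partial>M \<partial>M) \<le> (\<integral>\<^sup>+ x. \<integral>\<^sup>+ y. ?A x y + ?B x y \<partial>M \<partial>M)"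
  proof (intro nn_integral_mono)
    fix x y
    show "ennreal (h x * K x y * f y) \<le> ?A x y + ?B x y"
    proof (cases "h x \<le> f y powr (p / t)")
      case True
      then show ?thesis
        by (simp add: sym[of y x] ennreal_mult[symmetric] f0 h0 K0 mult_ac add_increasing2)
    next
      case False
      then have "(f y powr (p / t)) powr (t / p) \<le> h x powr (t / p)"
        using pt by (intro powr_mono2) auto
      then have "f y \<le> h x powr (t / p)"
        using pt f0[of y] by (simp add: powr_powr)
      then show ?thesis
        by (simp add: ennreal_mult[symmetric] f0 h0 K0 mult_ac add_increasing)
    qed
  qed
  also have "\<dots> = (\<integral>\<^sup>+ x. \<integral>\<^sup>+ y. ?A x y \<partial>M \<partial>M) + (\<integral>\<^sup>+ x. \<integral>\<^sup>+ y. ?B x y \<partial>M \<partial>M)"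
  proof -
    have "(\<integral>\<^sup>+ x. \<integral>\<^sup>+ y. ?A x y + ?B x y \<partial>M \<partial>M) = (\<integral>\<^sup>+ x. (\<integral>\<^sup>+ y. ?A x y \<partial>M) + (\<integral>\<^sup>+ y. ?B x y \<partial>M) \<partial>M)"
      by (intro nn_integral_cong nn_integral_add) measurable
    also have "\<dots> = (\<integral>\<^sup>+ x. \<integral>\<^sup>+ y. ?A x y \<partial>M \<partial>M) + (\<integral>\<^sup>+ x. \<integral>\<^sup>+ y. ?B x y \<partial>M \<partial>M)"
      by (intro nn_integral_add) measurable
    finally show ?thesis .
  qed
  also have "(\<integral>\<^sup>+ x. \<integral>\<^sup>+ y. ?A x y \<partial>M \<partial>M) = (\<integral>\<^sup>+ y. \<integral>\<^sup>+ x. ?A x y \<partial>M \<partial>M)"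
    by (intro Fubini'[symmetric]) measurable
  also have "\<dots> + (\<integral>\<^sup>+ x. \<integral>\<^sup>+ y. ?B x y \<partial>M \<partial>M) \<le> ennreal (2 * c + 1) + ennreal (2 * c + 1)"
    using pt K2 by (intro add_mono half f0 h0 f1 h1) (auto simp: add.commute)
  also have "\<dots> = ennreal (2 * (2 * c + 1))"
    using c by (simp flip: ennreal_plus)
  finally show ?thesis .
qed

section \<open>Integrating directional derivatives\<close>

text \<open>
  Averaging \<open>F'\<close> over the segments from \<open>y\<close> to \<open>y + e\<close> gives \<open>F (y + e) - F y\<close>, whose integral vanishes by
  translation invariance. Only almost every line has to avoid the singularities of \<open>F\<close>.
\<close>

lemma integral_directional_derivative_eq_0:
  fixes F F' :: "'a::euclidean_space \<Rightarrow> 'b::euclidean_space"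
  assumes F: "integrable lborel F" and F': "integrable lborel F'"
    and der: "AE y in lborel. \<forall>t\<in>{0..1}. ((\<lambda>t. F (y + t *\<^sub>R e)) has_vector_derivative F' (y + t *\<^sub>R e)) (at t)"
  shows "integral\<^sup>L lborel F' = 0"
proof -
  have trans: "integrable lborel (\<lambda>y. H (y + c))" "(\<integral>y. H (y + c) \<partial>lborel) = integral\<^sup>L lborel H"
    if "integrable lborel H" for H :: "'a \<Rightarrow> 'c::{banach, second_countable_topology}" and c
  proof -
    have [measurable]: "H \<in> borel_measurable borel" using that by auto
    have H: "integrable (distr lborel borel ((+) c)) H" using that by (simp add: lborel_distr_plus)
    show "integrable lborel (\<lambda>y. H (y + c))"
      using H by (subst (asm) integrable_distr_eq) (auto simp: add.commute)
    have "integral\<^sup>L lborel H = integral\<^sup>L (distr lborel borel ((+) c)) H" by (simp add: lborel_distr_plus)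
    also have "\<dots> = (\<integral>y. H (c + y) \<partial>lborel)" by (subst integral_distr) auto
    finally show "(\<integral>y. H (y + c) \<partial>lborel) = integral\<^sup>L lborel H" by (simp add: add.commute)
  qed
  have [measurable]: "F' \<in> borel_measurable borel" using F' by auto
  define g :: "real \<times> 'a \<Rightarrow> 'b" where "g = (\<lambda>(t, y). indicator {0..1} t *\<^sub>R F' (y + t *\<^sub>R e))"
  have g_meas [measurable]: "g \<in> borel_measurable (lborel \<Otimes>\<^sub>M lborel)"
    unfolding g_def by measurable
  have g_int: "integrable (lborel \<Otimes>\<^sub>M lborel) g"
  proof (rule lborel_pair.Fubini_integrable[OF g_meas])
    have "(\<integral>y. norm (g (t, y)) \<partial>lborel) = indicator {0..1} t * (\<integral>y. norm (F' y) \<partial>lborel)" for t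
      using trans(2)[OF integrable_norm[OF F'], of "t *\<^sub>R e"] by (simp add: g_def)
    then show "integrable lborel (\<lambda>t. \<integral>y. norm (g (t, y)) \<partial>lborel)"
      by (simp add: integrable_mult_left)
    show "AE t in lborel. integrable lborel (\<lambda>y. g (t, y))"
      by (rule AE_I2) (auto simp: g_def intro!: trans(1)[OF F'])
  qed
  have g_int': "integrable (lborel \<Otimes>\<^sub>M lborel) (\<lambda>(t, y). g (t, y))"
    using g_int by (simp add: split_beta')
  have "(\<integral>t. \<integral>y. g (t, y) \<partial>lborel \<partial>lborel) = (\<integral>t. indicator {0..1::real} t *\<^sub>R integral\<^sup>L lborel F' \<partial>lborel)"
    by (simp add: g_def trans(2)[OF F'])
  also have "\<dots> = integral\<^sup>L lborel F'" by (subst integral_scaleR_left) auto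
  finally have *: "(\<integral>t. \<integral>y. g (t, y) \<partial>lborel \<partial>lborel) = integral\<^sup>L lborel F'" .
  have "(\<integral>y. \<integral>t. g (t, y) \<partial>lborel \<partial>lborel) = (\<integral>y. F (y + e) - F y \<partial>lborel)"
  proof (rule integral_cong_AE)
    show "AE y in lborel. (\<integral>t. g (t, y) \<partial>lborel) = F (y + e) - F y"
      using der lborel_pair.AE_integrable_snd[OF g_int']
    proof eventually_elim
      case (elim y)
      have "((\<lambda>t. F' (y + t *\<^sub>R e)) has_integral F (y + 1 *\<^sub>R e) - F (y + 0 *\<^sub>R e)) {0..1}"
        using elim(1) by (intro fundamental_theorem_of_calculus) (auto intro: has_vector_derivative_at_within)
      moreover have "set_integrable lborel {0..1} (\<lambda>t. F' (y + t *\<^sub>R e))"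
        using elim(2) by (simp add: set_integrable_def g_def)
      from set_borel_integral_eq_integral(2)[OF this]
      have "(\<integral>t. g (t, y) \<partial>lborel) = integral {0..1} (\<lambda>t. F' (y + t *\<^sub>R e))"
        by (simp add: set_lebesgue_integral_def g_def)
      ultimately show ?case by (simp add: integral_unique)
    qed
    show "(\<lambda>y. F (y + e) - F y) \<in> borel_measurable lborel"
      using F trans(1)[OF F, of e] by auto
  qed (rule lborel.borel_measurable_lebesgue_integral, unfold split_beta', measurable)
  also have "\<dots> = 0"
    using F trans[OF F, of e] by simp
  finally show ?thesis
    using lborel_pair.Fubini_integral[OF g_int'] * by simp
qed

section \<open>Change of variables and radial integrals\<close>

text \<open>The push-forward of the density \<open>J\<close> on \<open>S\<close> gives every box its
  volume, hence is Lebesgue measure. Omitting a negligible part of the target admits maps that are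
  differentiable only off a point; \<open>J\<close> stands for the determinant so that its
  measurability can be assumed separately.\<close>

lemma nn_integral_change_of_variables:
  fixes g :: "real^'n::{finite,wellorder} \<Rightarrow> real^'n::_"
  assumes S: "S \<in> sets borel" and g [measurable]: "g \<in> borel_measurable borel"
    and der: "\<And>x. x \<in> S \<Longrightarrow> (g has_derivative g' x) (at x)"
    and inj: "inj_on g S" and neg: "negligible (- (g ` S))"
    and J [measurable]: "J \<in> borel_measurable borel"
    and J_eq: "\<And>x. x \<in> S \<Longrightarrow> J x = \<bar>det (matrix (g' x))\<bar>"
    and \<phi> [measurable]: "\<phi> \<in> borel_measurable borel"
  shows "(\<integral>\<^sup>+ x. \<phi> (g x) * (ennreal (J x) * indicator S x) \<partial>lborel) = (\<integral>\<^sup>+ y. \<phi> y \<partial>lborel)"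
proof -
  note S [measurable]
  define M where "M = distr (density lborel (\<lambda>x. ennreal (J x) * indicator S x)) borel g"
  have "lborel = M"
  proof (rule lborel_eqI)
    fix l u :: "(real, 'n) vec"
    assume lu: "\<And>b. b \<in> Basis \<Longrightarrow> l \<bullet> b \<le> u \<bullet> b"
    define A where "A = S \<inter> g -` box l u"
    have A [measurable]: "A \<in> sets borel"
      unfolding A_def using measurable_sets[OF g, of "box l u"] S by auto
    have gA: "g ` A = box l u \<inter> g ` S" by (auto simp: A_def)
    have box: "box l u \<in> lmeasurable" "measure lebesgue (box l u) = (\<Prod>b\<in>Basis. (u - l) \<bullet> b)"
      using lu by (auto simp: measure_completion measure_lborel_box)
    have nl: "box l u - g ` A \<in> null_sets lebesgue"
      by (auto simp: gA negligible_iff_null_sets[symmetric] intro!: negligible_subset[OF neg])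
    have gA_m: "g ` A \<in> lmeasurable" "measure lebesgue (g ` A) = (\<Prod>b\<in>Basis. (u - l) \<bullet> b)"
    proof -
      have *: "g ` A = box l u - (box l u - g ` A)" using gA by auto
      show "g ` A \<in> lmeasurable"
        by (subst *, rule fmeasurable.Diff[OF box(1)]) (use nl in \<open>auto intro: fmeasurableI_null_sets\<close>)
      show "measure lebesgue (g ` A) = (\<Prod>b\<in>Basis. (u - l) \<bullet> b)"
        by (subst *, subst measure_Diff_null_set[OF _ nl]) (use box in auto)
    qed
    have "((\<lambda>x. \<bar>det (matrix (g' x))\<bar>) has_integral (\<Prod>b\<in>Basis. (u - l) \<bullet> b)) A"
      using gA_m by (subst has_measure_differentiable_image[symmetric, of A g])
        (auto simp: A_def intro!: has_derivative_at_withinI der inj_on_subset[OF inj])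
    then have "(\<integral>\<^sup>+ x. ennreal \<bar>det (matrix (g' x))\<bar> * indicator A x \<partial>lborel) = ennreal (\<Prod>b\<in>Basis. (u - l) \<bullet> b)"
      by (intro nn_integral_has_integral_lebesgue') auto
    moreover have "emeasure M (box l u) = (\<integral>\<^sup>+ x. ennreal (J x) * indicator S x * indicator (g -` box l u) x \<partial>lborel)"
      unfolding M_def by (subst emeasure_distr, measurable, subst emeasure_density)
        (auto intro!: nn_integral_cong measurable_sets_borel[OF g] split: split_indicator)
    moreover have "\<dots> = (\<integral>\<^sup>+ x. ennreal \<bar>det (matrix (g' x))\<bar> * indicator A x \<partial>lborel)"
      by (intro nn_integral_cong) (auto simp: A_def J_eq split: split_indicator)
    ultimately show "emeasure M (box l u) = ennreal (\<Prod>b\<in>Basis. (u - l) \<bullet> b)" by simp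
  qed (simp add: M_def)
  then have "(\<integral>\<^sup>+ y. \<phi> y \<partial>lborel) = (\<integral>\<^sup>+ y. \<phi> y \<partial>M)" by simp
  also have "\<dots> = (\<integral>\<^sup>+ x. \<phi> (g x) * (ennreal (J x) * indicator S x) \<partial>lborel)"
    unfolding M_def by (subst nn_integral_distr, measurable, subst nn_integral_density, measurable)
      (simp add: mult.commute)
  finally show ?thesis ..
qed

text \<open>Ball volumes determine the distribution of the norm: 4/3 pi u^3 is the integral of 4 pi
  r^2 up to u, and the half-lines \<open>{..u}\<close> generate the Borel sets. No polar coordinates
  are needed.\<close>

lemma nn_integral_radial:
  fixes \<phi> :: "real \<Rightarrow> ennreal"
  assumes [measurable]: "\<phi> \<in> borel_measurable borel"
  shows "(\<integral>\<^sup>+ z. \<phi> (norm (z::real^3)) \<partial>lborel) = (\<integral>\<^sup>+ r. \<phi> r * (ennreal (4 * pi * r\<^sup>2) * indicator {0<..} r) \<partial>lborel)"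
proof -
  let ?M = "distr (lborel :: (real^3) measure) borel norm"
  let ?N = "density lborel (\<lambda>r::real. ennreal (4 * pi * r\<^sup>2) * indicator {0<..} r)"
  have meas: "emeasure ?M {..u} = ennreal (4 / 3 * pi * max 0 u ^ 3)" for u
  proof -
    have "norm -` {..u} = cball (0::real^3) u" by auto
    then have "emeasure ?M {..u} = emeasure lborel (cball (0::real^3) u)"
      by (subst emeasure_distr) auto
    also have "\<dots> = ennreal (4 / 3 * pi * max 0 u ^ 3)"
      by (cases "0 \<le> u") (simp_all add: emeasure_cball unit_ball_vol_3)
    finally show ?thesis .
  qed
  have "?M = ?N"
  proof (rule measure_eqI_generator_eq[where E="range atMost" and \<Omega>=UNIV and A="\<lambda>n::nat. {..real n}"])
    fix X assume "X \<in> range (atMost :: real \<Rightarrow> _)"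
    then obtain u where X: "X = {..u}" by auto
    show "emeasure ?M X = emeasure ?N X"
    proof (cases "0 \<le> u")
      case True
      have "emeasure ?N X = (\<integral>\<^sup>+ r. ennreal (4 * pi * r\<^sup>2) * indicator {0..u} r \<partial>lborel)"
        unfolding X by (subst emeasure_density) (auto intro!: nn_integral_cong simp: indicator_def)
      also have "\<dots> = ennreal (4 / 3 * pi * u ^ 3 - 4 / 3 * pi * 0 ^ 3)"
        using True by (intro nn_integral_FTC_Icc) (auto intro!: derivative_eq_intros)
      finally show ?thesis using True unfolding X meas by simp
    next
      case False
      have "emeasure ?N X = (\<integral>\<^sup>+ r. 0 \<partial>(lborel::real measure))"
        unfolding X using False by (subst emeasure_density) (auto intro!: nn_integral_cong simp: indicator_def simp del: nn_integral_const)
      then show ?thesis using False unfolding X meas by simp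
    qed
  next
    show "sets ?M = sigma_sets UNIV (range atMost)" "sets ?N = sigma_sets UNIV (range atMost)"
      by (simp_all add: borel_eq_atMost)
    show "(\<Union>n. {..real n}) = UNIV"
      using real_arch_simple by auto
  qed (auto simp: Int_stable_def meas)
  have "(\<integral>\<^sup>+ z. \<phi> (norm (z::real^3)) \<partial>lborel) = (\<integral>\<^sup>+ r. \<phi> r \<partial>?M)"
    by (subst nn_integral_distr) auto
  also have "\<dots> = (\<integral>\<^sup>+ r. \<phi> r \<partial>?N)" unfolding \<open>?M = ?N\<close> ..
  also have "\<dots> = (\<integral>\<^sup>+ r. \<phi> r * (ennreal (4 * pi * r\<^sup>2) * indicator {0<..} r) \<partial>lborel)"
    by (subst nn_integral_density) (auto simp: mult.commute)
  finally show ?thesis .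
qed

text \<open>The matrix determinant lemma: the map acts as \<open>a\<close> on the plane orthogonal
  to \<open>c\<close>, and \<open>V\<close> contributes \<open>a + c \<bullet> V\<close>. The
  derivatives of \<open>boost\<close> and of \<open>hyp_embed\<close> both have this form.\<close>

lemma det_scaling_plus_rank_one:
  fixes c V :: "real^3"
  shows "det (matrix (\<lambda>h. a *\<^sub>R h + (c \<bullet> h) *\<^sub>R V)) = a\<^sup>2 * (a + c \<bullet> V)"
  by (simp add: det_3 matrix_def axis_def inner_vec_def sum_3 power2_eq_square algebra_simps)

section \<open>Hyperboloid coordinates and boosts\<close>

text \<open>Space part of the hyperboloid point (cosh |y|, sinh |y| y / |y|); writing it with
  \<open>stretch\<close> covers the origin.\<close>

definition hyp_embed :: "real^3 \<Rightarrow> real^3"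
  where "hyp_embed y = stretch 1 (norm y) *\<^sub>R y"

text \<open>
  \<open>(\<surd>(1 + |v|\<^sup>2), v)\<close> is a point of the unit hyperboloid in Minkowski space. \<open>boost V\<close> is the space part of the
  Lorentz boost that takes \<open>V\<close> to \<open>0\<close>.
\<close>

definition boost :: "real^3 \<Rightarrow> real^3 \<Rightarrow> real^3"
  where "boost V v = v + (V \<bullet> v / (1 + sqrt (1 + V \<bullet> V)) - sqrt (1 + v \<bullet> v)) *\<^sub>R V"

lemma stretch_1: "r \<noteq> 0 \<Longrightarrow> stretch 1 r = sinh r / r"
  by (simp add: stretch_def)

lemma stretch_pos: "0 \<le> r \<Longrightarrow> 0 < stretch 1 r"
  by (cases "r = 0") (simp_all add: stretch_def)

lemma norm_hyp_embed: "norm (hyp_embed y) = sinh (norm y)"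
  by (cases "y = 0") (simp_all add: hyp_embed_def stretch_1)

lemma hyp_embed_inner_self: "hyp_embed y \<bullet> hyp_embed y = (sinh (norm y))\<^sup>2"
  by (simp add: power2_norm_eq_inner[symmetric] norm_hyp_embed)

lemma sqrt_hyp_embed: "sqrt (1 + hyp_embed y \<bullet> hyp_embed y) = cosh (norm y)"
  by (rule real_sqrt_unique) (simp_all add: hyp_embed_inner_self cosh_square_eq)

text \<open>At 0 the quotient is 0 by convention, and the value 0 is the right one.\<close>

definition hyp_unembed :: "real^3 \<Rightarrow> real^3"
  where "hyp_unembed v = (arsinh (norm v) / norm v) *\<^sub>R v"

lemma arsinh_nonneg: "0 \<le> r \<Longrightarrow> 0 \<le> arsinh r" for r :: real
  using arsinh_real_neg_iff[of r] by (simp add: not_less[symmetric] del: arsinh_real_neg_iff)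

lemma norm_hyp_unembed: "norm (hyp_unembed v) = arsinh (norm v)"
  by (cases "v = 0") (simp_all add: hyp_unembed_def arsinh_nonneg)

lemma hyp_embed_unembed: "hyp_embed (hyp_unembed v) = v"
  by (cases "v = 0") (simp_all add: hyp_embed_def norm_hyp_unembed stretch_1, simp_all add: hyp_unembed_def)

lemma hyp_unembed_embed: "hyp_unembed (hyp_embed y) = y"
  by (cases "y = 0") (simp_all add: hyp_unembed_def norm_hyp_embed arsinh_sinh_real, simp_all add: hyp_embed_def stretch_1)

lemma hyp_embed_eq_0_iff [simp]: "hyp_embed y = 0 \<longleftrightarrow> y = 0"
  by (metis hyp_unembed_embed hyp_embed_def scaleR_zero_right)

text \<open>The difference of the two sides is the time component of the boosted point. Its sign
  selects the square root in \<open>sqrt_boost\<close>.\<close>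

lemma boost_gamma_pos: "V \<bullet> v < sqrt (1 + V \<bullet> V) * sqrt (1 + v \<bullet> v)"
proof -
  have "V \<bullet> v \<le> norm V * norm v" by (rule norm_cauchy_schwarz)
  also have "\<dots> < sqrt (1 + V \<bullet> V) * sqrt (1 + v \<bullet> v)"
    by (intro mult_strict_mono) (simp_all add: norm_eq_sqrt_inner add_pos_nonneg)
  finally show ?thesis .
qed

text \<open>A boost preserves the Minkowski form, so its image lies on the hyperboloid again; the
  square on the right is that of the new time component.\<close>

lemma boost_inner_self:
  "1 + boost V v \<bullet> boost V v = (sqrt (1 + V \<bullet> V) * sqrt (1 + v \<bullet> v) - V \<bullet> v)\<^sup>2"
proof -
  define a w s c where "a = sqrt (1 + V \<bullet> V)" "w = sqrt (1 + v \<bullet> v)" "s = V \<bullet> v" "c = s / (1 + a) - w"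
  \<comment> \<open>In this factored form \<open>V \<bullet> V\<close> cancels the denominator
    \<open>1 + a\<close> of \<open>c\<close>; what remains is polynomial in \<open>a\<close>,
    \<open>w\<close>, \<open>s\<close>.\<close>
  have a: "0 < 1 + a" "V \<bullet> V = (a - 1) * (1 + a)" and w: "v \<bullet> v = w\<^sup>2 - 1"
    by (simp_all add: a_w_s_c_def add_pos_nonneg algebra_simps)
  have c: "c * (1 + a) = s - w * (1 + a)" using a by (simp add: a_w_s_c_def(4) field_simps)
  have "boost V v \<bullet> boost V v = v \<bullet> v + 2 * c * s + c\<^sup>2 * (V \<bullet> V)"
    by (simp add: boost_def a_w_s_c_def inner_add_left inner_add_right inner_commute power2_eq_square algebra_simps)
  also have "c\<^sup>2 * (V \<bullet> V) = c * (a - 1) * (c * (1 + a))" by (simp add: a power2_eq_square)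
  also have "\<dots> = c * (a - 1) * (s - w * (1 + a))" by (simp only: c)
  also have "\<dots> = (a - 1) * s * c - w * (a - 1) * (c * (1 + a))" by (simp add: algebra_simps)
  also have "v \<bullet> v + 2 * c * s + \<dots> = v \<bullet> v + s * (c * (1 + a)) - w * (a - 1) * (c * (1 + a))"
    by (simp add: algebra_simps)
  also have "1 + \<dots> = (a * w - s)\<^sup>2" unfolding c w by (simp add: power2_eq_square algebra_simps)
  finally show ?thesis unfolding a_w_s_c_def .
qed

lemma sqrt_boost: "sqrt (1 + boost V v \<bullet> boost V v) = sqrt (1 + V \<bullet> V) * sqrt (1 + v \<bullet> v) - V \<bullet> v"
  using boost_gamma_pos[of V v] by (simp add: boost_inner_self)

text \<open>With the time component \<open>a * w - s\<close> of the first image inserted, the second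
  boost adds the multiple \<open>- c\<close> of \<open>V\<close> and undoes the first.\<close>

lemma boost_minus_boost: "boost (- V) (boost V v) = v"
proof -
  define a w s c where "a = sqrt (1 + V \<bullet> V)" "w = sqrt (1 + v \<bullet> v)" "s = V \<bullet> v" "c = s / (1 + a) - w"
  have a: "0 < 1 + a" "V \<bullet> V = (a - 1) * (1 + a)"
    by (simp_all add: a_w_s_c_def add_pos_nonneg algebra_simps)
  have c: "c * (1 + a) = s - w * (1 + a)" using a by (simp add: a_w_s_c_def(4) field_simps)
  have B: "boost V v = v + c *\<^sub>R V" by (simp add: boost_def a_w_s_c_def)
  have "V \<bullet> boost V v = s + (a - 1) * (c * (1 + a))"
    by (simp add: B inner_add_right a a_w_s_c_def(3)[symmetric])
  also have "\<dots> = (a * c + w) * (1 + a)" using c by (simp add: algebra_simps)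
  finally have "V \<bullet> boost V v / (1 + a) = a * c + w" using a by simp
  moreover have "sqrt (1 + boost V v \<bullet> boost V v) = a * w - s" by (simp add: sqrt_boost a_w_s_c_def)
  moreover have "boost (- V) (boost V v) = boost V v
      + (V \<bullet> boost V v / (1 + a) + sqrt (1 + boost V v \<bullet> boost V v)) *\<^sub>R V"
    unfolding boost_def[of "- V"] by (simp add: a_w_s_c_def(1)[symmetric] scaleR_minus_left[symmetric] del: scaleR_minus_left)
  ultimately have "boost (- V) (boost V v) = boost V v + (a * c + w + (a * w - s)) *\<^sub>R V"
    by (simp only:)
  also have "a * c + w + (a * w - s) = - c" using c by (simp add: algebra_simps)
  finally show ?thesis by (simp add: B)
qed

lemma boost_boost_minus: "boost V (boost (- V) v) = v"
  using boost_minus_boost[of "- V" v] by simp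

lemma continuous_boost: "continuous_on UNIV (boost V)"
  unfolding boost_def by (intro continuous_intros) (auto simp: add_nonneg_eq_0_iff)

lemma measurable_boost [measurable]: "boost V \<in> borel_measurable borel"
  by (intro borel_measurable_continuous_onI continuous_boost)

lemma measurable_cosh_real [measurable]: "(cosh :: real \<Rightarrow> real) \<in> borel_measurable borel"
  by (intro borel_measurable_continuous_onI continuous_intros)

lemma measurable_sinh_real [measurable]: "(sinh :: real \<Rightarrow> real) \<in> borel_measurable borel"
  by (intro borel_measurable_continuous_onI continuous_intros)

lemma measurable_arsinh_real [measurable]: "(arsinh :: real \<Rightarrow> real) \<in> borel_measurable borel"
  unfolding arsinh_real_def by measurable

lemma measurable_stretch [measurable]: "stretch \<kappa> \<in> borel_measurable borel"
  unfolding stretch_def by measurable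

lemma measurable_hyp_embed [measurable]: "hyp_embed \<in> borel_measurable borel"
  unfolding hyp_embed_def by measurable

text \<open>The Jacobian of a boost is the ratio of the new to the old time component, so dividing
  by the time component gives a Lorentz invariant measure.\<close>

lemma nn_integral_boost:
  assumes [measurable]: "\<phi> \<in> borel_measurable borel"
  shows "(\<integral>\<^sup>+ v. \<phi> (boost V v) / ennreal (sqrt (1 + v \<bullet> v)) \<partial>lborel)
    = (\<integral>\<^sup>+ z. \<phi> z / ennreal (sqrt (1 + z \<bullet> z)) \<partial>lborel)"
proof -
  define a where "a = sqrt (1 + V \<bullet> V)"
  have a: "0 < a" "V \<bullet> V = (a - 1) * (1 + a)" "1 + a > 0"
    by (simp_all add: a_def add_pos_nonneg algebra_simps)
  define w :: "real^3 \<Rightarrow> real" where "w = (\<lambda>v. sqrt (1 + v \<bullet> v))"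
  have w: "0 < w v" for v by (simp add: w_def add_pos_nonneg)
  have wB: "w (boost V v) = a * w v - V \<bullet> v" for v by (simp add: w_def a_def sqrt_boost)
  \<comment> \<open>The gradient of the scalar factor of \<open>V\<close> in
    \<open>boost V v\<close>; the derivative of the boost is the identity plus a rank-one
    map.\<close>
  define c where "c v = V /\<^sub>R (1 + a) - v /\<^sub>R w v" for v
  have c_inner: "c v \<bullet> h = V \<bullet> h / (1 + a) - v \<bullet> h / w v" for v h
    by (simp add: c_def inner_diff_left divide_inverse_commute)
  have der: "(boost V has_derivative (\<lambda>h. 1 *\<^sub>R h + (c v \<bullet> h) *\<^sub>R V)) (at v)" for v
  proof -
    have pos: "0 < 1 + v \<bullet> v" by (simp add: add_pos_nonneg)
    have "((\<lambda>v. 1 + v \<bullet> v) has_derivative (\<lambda>h. 2 * (v \<bullet> h))) (at v)"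
      by (auto intro!: derivative_eq_intros simp: inner_commute)
    note DERIV_compose_FDERIV[where f = sqrt and g = "\<lambda>v::real^3. 1 + v \<bullet> v" and x = v, OF DERIV_real_sqrt[OF pos] this]
    then
    have w': "(w has_derivative (\<lambda>h. (v \<bullet> h) / w v)) (at v)"
      using pos by (simp add: w_def field_simps)
    have "((\<lambda>v. V \<bullet> v / (1 + a)) has_derivative (\<lambda>h. V \<bullet> h / (1 + a))) (at v)"
      using a by (auto intro!: derivative_eq_intros)
    then have "((\<lambda>v. V \<bullet> v / (1 + a) - w v) has_derivative (\<lambda>h. c v \<bullet> h)) (at v)"
      unfolding c_inner by (intro has_derivative_diff w')
    from has_derivative_add[OF has_derivative_ident has_derivative_scaleR[OF this has_derivative_const[of V]]]
    show ?thesis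
      by (simp add: boost_def[abs_def] a_def w_def)
  qed
  have "1 + c v \<bullet> V = w (boost V v) / w v" for v
  proof -
    have "V \<bullet> V / (1 + a) = a - 1" using a by simp
    then show ?thesis
      unfolding wB c_inner by (simp add: inner_commute) (use w[of v] in \<open>simp add: field_simps\<close>)
  qed
  then have det: "\<bar>det (matrix (\<lambda>h. 1 *\<^sub>R h + (c v \<bullet> h) *\<^sub>R V))\<bar> = w (boost V v) / w v" for v
    using w[of v] w[of "boost V v"] unfolding det_scaling_plus_rank_one by simp
  have [measurable]: "w \<in> borel_measurable borel" unfolding w_def by measurable
  have "(\<integral>\<^sup>+ v. (\<phi> (boost V v) / ennreal (w (boost V v))) * (ennreal (w (boost V v) / w v) * indicator UNIV v) \<partial>lborel)
    = (\<integral>\<^sup>+ z. \<phi> z / ennreal (w z) \<partial>lborel)"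
  proof (rule nn_integral_change_of_variables[where g = "boost V" and g' = "\<lambda>v h. 1 *\<^sub>R h + (c v \<bullet> h) *\<^sub>R V"])
    show "inj (boost V)" by (metis boost_minus_boost injI)
    have "range (boost V) = UNIV" by (metis boost_boost_minus surjI)
    then show "negligible (- range (boost V))" by simp
  qed (simp_all add: der[simplified] det[simplified])
  moreover have "(\<phi> (boost V v) / ennreal (w (boost V v))) * (ennreal (w (boost V v) / w v) * indicator UNIV v)
      = \<phi> (boost V v) / ennreal (w v)" for v
    using w[of v] w[of "boost V v"]
    by (simp add: divide_ennreal[symmetric] ennreal_divide_times mult_divide_eq_ennreal ennreal_times_divide)
  ultimately show ?thesis by (simp add: w_def)
qed

text \<open>\<open>hyp_embed\<close> stretches the two tangential directions by
  \<open>stretch 1 (norm y)\<close> and the radial one by cosh |y|. The last factor equals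
  \<open>sqrt (1 + v \<bullet> v)\<close> at the image point, so what remains is the hyperbolic
  volume density.\<close>

lemma nn_integral_hyp_embed:
  assumes [measurable]: "\<phi> \<in> borel_measurable borel"
  shows "(\<integral>\<^sup>+ y. \<phi> (hyp_embed y) * ennreal ((stretch 1 (norm y))\<^sup>2) \<partial>lborel)
    = (\<integral>\<^sup>+ v. \<phi> v / ennreal (sqrt (1 + v \<bullet> v)) \<partial>lborel)"
proof -
  define \<sigma> where "\<sigma> y = stretch 1 (norm y)" for y :: "real^3"
  \<comment> \<open>The gradient of \<open>\<sigma>\<close> off the origin. Paired with
    \<open>y\<close> it gives \<open>cosh (norm y) - \<sigma> y\<close>, the excess of the radial
    stretching.\<close>
  define c where "c y = ((cosh (norm y) - \<sigma> y) / (norm y)\<^sup>2) *\<^sub>R y" for y :: "real^3"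
  have der: "(hyp_embed has_derivative (\<lambda>h. \<sigma> y *\<^sub>R h + (c y \<bullet> h) *\<^sub>R y)) (at y)" if y: "y \<in> - {0}" for y
  proof -
    have "((\<lambda>r. sinh r / r) has_real_derivative (cosh (norm y) - \<sigma> y) / norm y) (at (norm y))"
      using y unfolding \<sigma>_def by (auto intro!: derivative_eq_intros simp: stretch_1 field_simps)
    note DERIV_compose_FDERIV[where g = norm and x = y, OF this has_derivative_norm]
    then have "((\<lambda>y. sinh (norm y) / norm y) has_derivative (\<lambda>h. c y \<bullet> h)) (at y)"
      using y by (simp add: c_def sgn_div_norm power2_eq_square divide_simps mult_ac inner_commute)
    from has_derivative_scaleR[OF this has_derivative_ident]
    have "((\<lambda>y. (sinh (norm y) / norm y) *\<^sub>R y) has_derivative (\<lambda>h. \<sigma> y *\<^sub>R h + (c y \<bullet> h) *\<^sub>R y)) (at y)"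
      using y by (simp add: \<sigma>_def stretch_1)
    moreover have "\<forall>\<^sub>F y in at y. (sinh (norm y) / norm y) *\<^sub>R y = hyp_embed y"
      using y by (intro eventually_at_topological[THEN iffD2] exI[of _ "- {0}"]) (auto simp: hyp_embed_def stretch_1)
    ultimately show ?thesis
      using y by (auto simp: hyp_embed_def stretch_1 elim!: has_derivative_transform_eventually)
  qed
  have det: "\<bar>det (matrix (\<lambda>h. \<sigma> y *\<^sub>R h + (c y \<bullet> h) *\<^sub>R y))\<bar> = (\<sigma> y)\<^sup>2 * cosh (norm y)" if "y \<in> - {0}" for y
    using that unfolding det_scaling_plus_rank_one c_def by (simp add: power2_norm_eq_inner[symmetric])
  have neg: "negligible (- hyp_embed ` (- {0}))"
  proof (rule negligible_subset[of "{0}"])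
    show "- hyp_embed ` (- {0}) \<subseteq> {0}"
      by (auto simp: image_iff) (metis hyp_embed_unembed hyp_embed_eq_0_iff ComplI singletonD)
  qed simp
  have [measurable]: "\<sigma> \<in> borel_measurable borel" unfolding \<sigma>_def by measurable
  have "(\<integral>\<^sup>+ y. (\<phi> (hyp_embed y) / ennreal (sqrt (1 + hyp_embed y \<bullet> hyp_embed y))) *
      (ennreal ((\<sigma> y)\<^sup>2 * cosh (norm y)) * indicator (- {0}) y) \<partial>lborel)
    = (\<integral>\<^sup>+ v. \<phi> v / ennreal (sqrt (1 + v \<bullet> v)) \<partial>lborel)"
    by (rule nn_integral_change_of_variables[where g = hyp_embed and g' = "\<lambda>y h. \<sigma> y *\<^sub>R h + (c y \<bullet> h) *\<^sub>R y"])
      (use der det[symmetric] in \<open>auto intro!: neg inj_on_inverseI[where g = hyp_unembed] hyp_unembed_embed\<close>)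
  moreover have "(\<integral>\<^sup>+ y. \<phi> (hyp_embed y) * ennreal ((\<sigma> y)\<^sup>2) \<partial>lborel) =
    (\<integral>\<^sup>+ y. (\<phi> (hyp_embed y) / ennreal (sqrt (1 + hyp_embed y \<bullet> hyp_embed y))) *
      (ennreal ((\<sigma> y)\<^sup>2 * cosh (norm y)) * indicator (- {0}) y) \<partial>lborel)"
    unfolding sqrt_hyp_embed
    by (intro nn_integral_cong_AE AE_I[where N = "{0}"])
      (auto simp: ennreal_mult ennreal_divide_times mult.commute[of "ennreal ((\<sigma> y)\<^sup>2)" for y] mult.assoc[symmetric]
        split: split_indicator_asm)
  ultimately show ?thesis unfolding \<sigma>_def by simp
qed

section \<open>Hyperbolic distance and radial integrals\<close>

text \<open>The boost takes x to the origin, where the norm in hyperboloid coordinates is sinh of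
  the distance. \<open>cosh_dist\<close> is the negative of the Minkowski product of the two points;
  symmetry and derivatives are read off from it.\<close>

definition sinh_dist :: "real^3 \<Rightarrow> real^3 \<Rightarrow> real"
  where "sinh_dist x y = norm (boost (hyp_embed x) (hyp_embed y))"

definition cosh_dist :: "real^3 \<Rightarrow> real^3 \<Rightarrow> real"
  where "cosh_dist x y = cosh (norm x) * cosh (norm y) - hyp_embed x \<bullet> hyp_embed y"

lemma cosh_dist_eq: "cosh_dist x y = sqrt (1 + (sinh_dist x y)\<^sup>2)"
  using sqrt_boost[of "hyp_embed x" "hyp_embed y"]
  by (simp add: cosh_dist_def sinh_dist_def sqrt_hyp_embed power2_norm_eq_inner)

lemma cosh_dist_sym: "cosh_dist x y = cosh_dist y x"
  by (simp add: cosh_dist_def inner_commute mult.commute)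

lemma sinh_dist_nonneg [simp]: "0 \<le> sinh_dist x y"
  by (simp add: sinh_dist_def)

lemma sinh_dist_eq: "(sinh_dist x y)\<^sup>2 = (cosh_dist x y)\<^sup>2 - 1"
  by (simp add: cosh_dist_eq)

lemma sinh_dist_sym: "sinh_dist x y = sinh_dist y x"
  by (rule power2_eq_imp_eq) (simp_all add: sinh_dist_eq cosh_dist_sym[of x y])

lemma measurable_cosh_dist: "(\<lambda>z. cosh_dist (fst z) (snd z)) \<in> borel_measurable (borel \<Otimes>\<^sub>M borel)"
  unfolding cosh_dist_def by measurable

lemma measurable_sinh_dist: "(\<lambda>z. sinh_dist (fst z) (snd z)) \<in> borel_measurable (borel \<Otimes>\<^sub>M borel)"
proof -
  note measurable_cosh_dist [measurable]
  have "sinh_dist x y = sqrt ((cosh_dist x y)\<^sup>2 - 1)" for x y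
    by (simp add: sinh_dist_eq[symmetric])
  then show ?thesis by simp
qed

lemma measurable_sinh_dist_right [measurable]: "sinh_dist x \<in> borel_measurable borel"
  unfolding sinh_dist_def by measurable

text \<open>The variable is r = sinh d, with dr = cosh d dd, so the weight is the familiar 4 pi
  (sinh d)^2 dd. Pole independence comes from the invariance under boosts.\<close>

lemma nn_integral_hyp_radial:
  assumes [measurable]: "\<phi> \<in> borel_measurable borel"
  shows "(\<integral>\<^sup>+ y. \<phi> (sinh_dist x y) \<partial>hyp_volume 1)
    = (\<integral>\<^sup>+ r. \<phi> r * (ennreal (4 * pi * r\<^sup>2 / sqrt (1 + r\<^sup>2)) * indicator {0<..} r) \<partial>lborel)"
proof -
  have "(\<integral>\<^sup>+ y. \<phi> (sinh_dist x y) \<partial>hyp_volume 1)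
      = (\<integral>\<^sup>+ y. \<phi> (norm (boost (hyp_embed x) (hyp_embed y))) * ennreal ((stretch 1 (norm y))\<^sup>2) \<partial>lborel)"
    unfolding hyp_volume_eq sinh_dist_def
    by (subst nn_integral_density) (auto simp: mult.commute)
  also have "\<dots> = (\<integral>\<^sup>+ v. \<phi> (norm (boost (hyp_embed x) v)) / ennreal (sqrt (1 + v \<bullet> v)) \<partial>lborel)"
    by (rule nn_integral_hyp_embed) measurable
  also have "\<dots> = (\<integral>\<^sup>+ z. \<phi> (norm (z::real^3)) / ennreal (sqrt (1 + z \<bullet> z)) \<partial>lborel)"
    by (rule nn_integral_boost[where \<phi> = "\<lambda>z. \<phi> (norm z)"]) measurable
  also have "\<dots> = (\<integral>\<^sup>+ z. \<phi> (norm (z::real^3)) / ennreal (sqrt (1 + (norm z)\<^sup>2)) \<partial>lborel)"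
    by (simp add: power2_norm_eq_inner)
  also have "\<dots> = (\<integral>\<^sup>+ r. \<phi> r / ennreal (sqrt (1 + r\<^sup>2)) * (ennreal (4 * pi * r\<^sup>2) * indicator {0<..} r) \<partial>lborel)"
    by (rule nn_integral_radial) measurable
  also have "\<dots> = (\<integral>\<^sup>+ r. \<phi> r * (ennreal (4 * pi * r\<^sup>2 / sqrt (1 + r\<^sup>2)) * indicator {0<..} r) \<partial>lborel)"
  proof (rule nn_integral_cong)
    fix r :: real
    have "0 < 1 + r\<^sup>2" by (simp add: add_pos_nonneg)
    then have "ennreal (4 * pi * r\<^sup>2 / sqrt (1 + r\<^sup>2)) = ennreal (4 * pi * r\<^sup>2) / ennreal (sqrt (1 + r\<^sup>2))"
      by (subst divide_ennreal) auto
    then show "\<phi> r / ennreal (sqrt (1 + r\<^sup>2)) * (ennreal (4 * pi * r\<^sup>2) * indicator {0<..} r)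
      = \<phi> r * (ennreal (4 * pi * r\<^sup>2 / sqrt (1 + r\<^sup>2)) * indicator {0<..} r)"
      by (simp add: ennreal_divide_times ennreal_times_divide mult.assoc mult.left_commute mult.commute)
  qed
  finally show ?thesis .
qed

text \<open>In the variable sinh d, hyperbolic volume is dominated by Euclidean volume. The bounds
  for the kernel thus reduce to those for 1 / |z| on Euclidean space, uniformly in the pole.\<close>

lemma hyp_radial_weight_le: "0 < r \<Longrightarrow> 4 * pi * r\<^sup>2 / sqrt (1 + r\<^sup>2) \<le> 4 * pi * r\<^sup>2"
  using divide_left_mono[of 1 "sqrt (1 + r\<^sup>2)" "4 * pi * r\<^sup>2"] add_pos_nonneg[of 1 "r\<^sup>2"] by simp

text \<open>The kernel exceeds \<open>l\<close> only where sinh d is below 1 / l, and the integral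
  of 4 pi r up to 1 / l is the right-hand side.\<close>

lemma hyp_kernel_large_part:
  assumes l: "0 < l"
  shows "(\<integral>\<^sup>+ y. ennreal (1 / sinh_dist x y) * indicator {y. l < 1 / sinh_dist x y} y \<partial>hyp_volume 1)
    \<le> ennreal (2 * pi / l\<^sup>2)"
proof -
  have "(\<integral>\<^sup>+ y. ennreal (1 / sinh_dist x y) * indicator {y. l < 1 / sinh_dist x y} y \<partial>hyp_volume 1)
    = (\<integral>\<^sup>+ y. ennreal (1 / sinh_dist x y) * indicator {r. l < 1 / r} (sinh_dist x y) \<partial>hyp_volume 1)"
    by (simp add: indicator_def)
  also have "\<dots> = (\<integral>\<^sup>+ r. (ennreal (1 / r) * indicator {r. l < 1 / r} r) *
      (ennreal (4 * pi * r\<^sup>2 / sqrt (1 + r\<^sup>2)) * indicator {0<..} r) \<partial>lborel)"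
    by (rule nn_integral_hyp_radial) measurable
  also have "\<dots> \<le> (\<integral>\<^sup>+ r. ennreal (4 * pi * r) * indicator {0..1 / l} r \<partial>lborel)"
  proof (rule nn_integral_mono)
    fix r :: real
    show "(ennreal (1 / r) * indicator {r. l < 1 / r} r) *
      (ennreal (4 * pi * r\<^sup>2 / sqrt (1 + r\<^sup>2)) * indicator {0<..} r) \<le> ennreal (4 * pi * r) * indicator {0..1 / l} r"
    proof (cases "0 < r \<and> l < 1 / r")
      case True
      then have r: "0 < r" "r \<le> 1 / l" using l by (auto simp: field_simps)
      have "ennreal (1 / r) * ennreal (4 * pi * r\<^sup>2 / sqrt (1 + r\<^sup>2)) \<le> ennreal (1 / r) * ennreal (4 * pi * r\<^sup>2)"
        using hyp_radial_weight_le[OF r(1)] by (intro mult_left_mono ennreal_leI) auto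
      also have "\<dots> = ennreal (4 * pi * r)"
        using r by (simp add: ennreal_mult[symmetric] power2_eq_square)
      finally show ?thesis using True r by simp
    qed auto
  qed
  also have "\<dots> = ennreal (2 * pi * (1 / l)\<^sup>2 - 2 * pi * 0\<^sup>2)"
    using l by (intro nn_integral_FTC_Icc) (auto intro!: derivative_eq_intros)
  finally show ?thesis by (simp add: power_divide)
qed

text \<open>Here sinh d is at least 1 / l, and \<open>3 < e\<close> makes 4 pi r^(2 - e) integrable
  at infinity.\<close>

lemma hyp_kernel_small_part:
  assumes l: "0 < l" and e: "3 < e"
  shows "(\<integral>\<^sup>+ y. ennreal ((1 / sinh_dist x y) powr e) * indicator {y. 1 / sinh_dist x y \<le> l} y \<partial>hyp_volume 1)
    \<le> ennreal (4 * pi / (e - 3) * l powr (e - 3))"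
proof -
  have "(\<integral>\<^sup>+ y. ennreal ((1 / sinh_dist x y) powr e) * indicator {y. 1 / sinh_dist x y \<le> l} y \<partial>hyp_volume 1)
    = (\<integral>\<^sup>+ y. ennreal ((1 / sinh_dist x y) powr e) * indicator {r. 1 / r \<le> l} (sinh_dist x y) \<partial>hyp_volume 1)"
    by (simp add: indicator_def)
  also have "\<dots> = (\<integral>\<^sup>+ r. (ennreal ((1 / r) powr e) * indicator {r. 1 / r \<le> l} r) *
      (ennreal (4 * pi * r\<^sup>2 / sqrt (1 + r\<^sup>2)) * indicator {0<..} r) \<partial>lborel)"
    by (rule nn_integral_hyp_radial) measurable
  also have "\<dots> \<le> (\<integral>\<^sup>+ r. ennreal (4 * pi * r powr (2 - e)) * indicator {1 / l..} r \<partial>lborel)"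
  proof (rule nn_integral_mono)
    fix r :: real
    show "(ennreal ((1 / r) powr e) * indicator {r. 1 / r \<le> l} r) *
      (ennreal (4 * pi * r\<^sup>2 / sqrt (1 + r\<^sup>2)) * indicator {0<..} r) \<le> ennreal (4 * pi * r powr (2 - e)) * indicator {1 / l..} r"
    proof (cases "0 < r \<and> 1 / r \<le> l")
      case True
      then have r: "0 < r" "1 / l \<le> r" using l by (auto simp: field_simps)
      have "ennreal ((1 / r) powr e) * ennreal (4 * pi * r\<^sup>2 / sqrt (1 + r\<^sup>2)) \<le> ennreal ((1 / r) powr e) * ennreal (4 * pi * r\<^sup>2)"
        using hyp_radial_weight_le[OF r(1)] by (intro mult_left_mono ennreal_leI) auto
      also have "\<dots> = ennreal (4 * pi * r powr (2 - e))"
        using r by (simp add: ennreal_mult[symmetric] powr_diff powr_divide)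
      finally show ?thesis using True r by simp
    qed auto
  qed
  also have "\<dots> = ennreal (0 - (- (4 * pi / (e - 3)) * (1 / l) powr (3 - e)))"
  proof (rule nn_integral_FTC_atLeast)
    fix r assume "1 / l \<le> r"
    then have r: "0 < r" using l by (meson divide_pos_pos less_le_trans zero_less_one)
    have "((\<lambda>r. - (4 * pi / (e - 3)) * r powr (3 - e)) has_real_derivative
        - (4 * pi / (e - 3)) * ((3 - e) * r powr (3 - e - 1))) (at r)"
      by (intro DERIV_cmult has_real_derivative_powr r)
    moreover have "- (4 * pi / (e - 3)) * ((3 - e) * r powr (3 - e - 1)) = 4 * pi * r powr (2 - e)"
      using e by (simp add: field_simps)
    ultimately show "((\<lambda>r. - (4 * pi / (e - 3)) * r powr (3 - e)) has_real_derivative 4 * pi * r powr (2 - e)) (at r)"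
      by simp
    show "0 \<le> 4 * pi * r powr (2 - e)" by simp
  next
    have "((\<lambda>r. r powr (3 - e)) \<longlongrightarrow> 0) at_top"
      using e by (intro tendsto_neg_powr filterlim_ident) auto
    from tendsto_mult_right_zero[OF this]
    show "((\<lambda>r. - (4 * pi / (e - 3)) * r powr (3 - e)) \<longlongrightarrow> 0) at_top" .
  qed measurable
  also have "(1 / l) powr (3 - e) = l powr (e - 3)"
    using l by (simp add: powr_diff powr_divide)
  finally show ?thesis by simp
qed

text \<open>This serves the integration by parts: the derivatives of the regularized kernel times
  \<open>u\<close> are as singular as 1 / (sinh d)^2 at the pole.\<close>

lemma hyp_kernel_square_integrable:
  assumes L: "0 \<le> L"
  shows "(\<integral>\<^sup>+ y. ennreal (1 / (sinh_dist x y)\<^sup>2) * indicator {y. sinh_dist x y \<le> L} y \<partial>hyp_volume 1)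
    \<le> ennreal (4 * pi * L)"
proof -
  have "(\<integral>\<^sup>+ y. ennreal (1 / (sinh_dist x y)\<^sup>2) * indicator {y. sinh_dist x y \<le> L} y \<partial>hyp_volume 1)
    = (\<integral>\<^sup>+ y. ennreal (1 / (sinh_dist x y)\<^sup>2) * indicator {r. r \<le> L} (sinh_dist x y) \<partial>hyp_volume 1)"
    by (simp add: indicator_def)
  also have "\<dots> = (\<integral>\<^sup>+ r. (ennreal (1 / r\<^sup>2) * indicator {r. r \<le> L} r) *
      (ennreal (4 * pi * r\<^sup>2 / sqrt (1 + r\<^sup>2)) * indicator {0<..} r) \<partial>lborel)"
    by (rule nn_integral_hyp_radial) measurable
  also have "\<dots> \<le> (\<integral>\<^sup>+ r. ennreal (4 * pi) * indicator {0..L} r \<partial>lborel)"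
  proof (rule nn_integral_mono)
    fix r :: real
    show "(ennreal (1 / r\<^sup>2) * indicator {r. r \<le> L} r) *
      (ennreal (4 * pi * r\<^sup>2 / sqrt (1 + r\<^sup>2)) * indicator {0<..} r) \<le> ennreal (4 * pi) * indicator {0..L} r"
    proof (cases "0 < r \<and> r \<le> L")
      case True
      then have r: "0 < r" by simp
      have "ennreal (1 / r\<^sup>2) * ennreal (4 * pi * r\<^sup>2 / sqrt (1 + r\<^sup>2)) \<le> ennreal (1 / r\<^sup>2) * ennreal (4 * pi * r\<^sup>2)"
        using hyp_radial_weight_le[OF r(1)] by (intro mult_left_mono ennreal_leI) auto
      also have "\<dots> = ennreal (4 * pi)"
        using r by (simp add: ennreal_mult[symmetric])
      finally show ?thesis using True by simp
    qed auto
  qed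
  also have "\<dots> = ennreal (4 * pi * L)"
    using L by (simp add: nn_integral_cmult ennreal_mult)
  finally show ?thesis .
qed

text \<open>The integral of 4 pi exp (- m d) sinh d over d > 0. The volume grows like exp (2 d), so
  \<open>1 < m\<close> is what makes it finite.\<close>

lemma nn_integral_hyp_exp_kernel:
  assumes m: "1 < m"
  shows "(\<integral>\<^sup>+ y. ennreal (exp (- m * arsinh (sinh_dist x y)) / sinh_dist x y) \<partial>hyp_volume 1)
    = ennreal (4 * pi / (m\<^sup>2 - 1))"
proof -
  \<comment> \<open>The antiderivative in d of 4 pi exp (- m d) sinh d, after expanding sinh d into
    exponentials and putting d = \<open>arsinh r\<close>. It vanishes at infinity.\<close>
  define F where "F r = 4 * pi * (exp (- (m + 1) * arsinh r) / (2 * (m + 1)) - exp (- (m - 1) * arsinh r) / (2 * (m - 1)))" for r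
  have "(\<integral>\<^sup>+ y. ennreal (exp (- m * arsinh (sinh_dist x y)) / sinh_dist x y) \<partial>hyp_volume 1)
    = (\<integral>\<^sup>+ r. ennreal (exp (- m * arsinh r) / r) *
      (ennreal (4 * pi * r\<^sup>2 / sqrt (1 + r\<^sup>2)) * indicator {0<..} r) \<partial>lborel)"
    by (rule nn_integral_hyp_radial) measurable
  also have "\<dots> = (\<integral>\<^sup>+ r. ennreal (4 * pi * exp (- m * arsinh r) * r / sqrt (1 + r\<^sup>2)) * indicator {0..} r \<partial>lborel)"
  proof (rule nn_integral_cong)
    fix r :: real
    show "ennreal (exp (- m * arsinh r) / r) * (ennreal (4 * pi * r\<^sup>2 / sqrt (1 + r\<^sup>2)) * indicator {0<..} r)
      = ennreal (4 * pi * exp (- m * arsinh r) * r / sqrt (1 + r\<^sup>2)) * indicator {0..} r"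
    proof (cases "0 < r")
      case True
      then show ?thesis by (simp add: ennreal_mult[symmetric] power2_eq_square mult_ac)
    next
      case False
      then show ?thesis by (cases "r = 0") (auto simp: indicator_def)
    qed
  qed
  also have "\<dots> = ennreal (0 - F 0)"
  proof (rule nn_integral_FTC_atLeast)
    fix r :: real assume r: "0 \<le> r"
    have "(F has_real_derivative 4 * pi * ((exp (- (m - 1) * arsinh r) - exp (- (m + 1) * arsinh r)) / 2 / sqrt (r\<^sup>2 + 1))) (at r)"
      unfolding F_def using m
      by (auto intro!: derivative_eq_intros simp: divide_simps) (simp add: algebra_simps)?
    moreover have "(exp (- (m - 1) * arsinh r) - exp (- (m + 1) * arsinh r)) / 2 = exp (- m * arsinh r) * sinh (arsinh r)"
      unfolding sinh_field_def by (simp add: exp_add[symmetric] field_simps)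
    ultimately show "(F has_real_derivative 4 * pi * exp (- m * arsinh r) * r / sqrt (1 + r\<^sup>2)) (at r)"
      by (simp add: add.commute mult.assoc)
    show "0 \<le> 4 * pi * exp (- m * arsinh r) * r / sqrt (1 + r\<^sup>2)" using r by simp
  next
    have 1: "((\<lambda>r. exp (- k * arsinh r)) \<longlongrightarrow> 0) at_top" if "0 < k" for k :: real
      using that by (intro filterlim_compose[OF exp_at_bot] filterlim_tendsto_neg_mult_at_bot[OF tendsto_const])
        (auto simp: arsinh_real_at_top)
    have "((\<lambda>r. 4 * pi * (exp (- (m + 1) * arsinh r) / (2 * (m + 1)) - exp (- (m - 1) * arsinh r) / (2 * (m - 1))))
        \<longlongrightarrow> 4 * pi * (0 / (2 * (m + 1)) - 0 / (2 * (m - 1)))) at_top"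
      using m by (intro tendsto_intros 1) auto
    then show "(F \<longlongrightarrow> 0) at_top" unfolding F_def by simp
  qed measurable
  also have "0 - F 0 = 4 * pi / (m\<^sup>2 - 1)"
  proof -
    have "m\<^sup>2 - 1 = (m - 1) * (m + 1)" by (simp add: power2_eq_square algebra_simps)
    then show ?thesis unfolding F_def using m by (simp add: divide_simps) (simp add: algebra_simps)?
  qed
  finally show ?thesis .
qed

section \<open>The Laplacian in exponential coordinates\<close>

text \<open>
  The matrix \<open>\<surd>(det g) g\<^sup>-\<^sup>1\<close> has the entries \<open>hyp_coeff\<close>. With \<open>q = cosh d(x, \<cdot>)\<close> and \<open>A\<close> this matrix, \<open>hyp_dq\<close> is
  \<open>\<partial>\<^sub>i q\<close>, \<open>hyp_B\<close> is \<open>(A \<nabla>q)\<^sub>i\<close>, and \<open>hyp_dB\<close>, \<open>hyp_dcoeff\<close> are the \<open>i\<close>-th partial derivatives of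
  \<open>hyp_B\<close>, \<open>hyp_coeff\<close>. Primed functions are derivatives. All these formulas for derivatives hold away from the
  origin only, which suffices because they are used under integrals.
\<close>

definition stretch' :: "real \<Rightarrow> real" where "stretch' r = (cosh r - stretch 1 r) / r"

definition radial_coeff :: "real \<Rightarrow> real" where "radial_coeff r = ((stretch 1 r)\<^sup>2 - 1) / r\<^sup>2"

definition hyp_coeff :: "3 \<Rightarrow> 3 \<Rightarrow> real^3 \<Rightarrow> real"
  where "hyp_coeff i j y = (if i = j then 1 else 0) + radial_coeff (norm y) * y$i * y$j"

lemma matrix_inv_eqI:
  fixes A B :: "'a::semiring_1^'n^'n"
  assumes "A ** B = mat 1" "B ** A = mat 1"
  shows "matrix_inv A = B"
proof -
  have "A ** matrix_inv A = mat 1 \<and> matrix_inv A ** A = mat 1"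
    unfolding matrix_inv_def by (rule someI[of _ B]) (use assms in auto)
  then have "matrix_inv A = matrix_inv A ** (A ** B)" "matrix_inv A ** A = mat 1"
    using assms by auto
  then show ?thesis by (simp add: matrix_mul_assoc)
qed

text \<open>The metric acts as 1 radially and as the square s of the stretching tangentially. The
  root of its determinant is s, so s times the inverse acts as s radially and as 1
  tangentially.\<close>

lemma hyp_coeff_eq: "sqrt (det (hyp_metric 1 y)) * matrix_inv (hyp_metric 1 y) $ i $ j = hyp_coeff i j y"
proof (cases "y = 0")
  case True
  have "hyp_metric 1 0 = mat 1"
    by (simp add: hyp_metric_def stretch_def mat_def vec_eq_iff)
  moreover from this have "matrix_inv (hyp_metric 1 0) = mat 1"
    by (intro matrix_inv_eqI) simp_all
  moreover have "(mat 1 :: real^3^3) $ i $ j = (if i = j then 1 else 0)"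
    by (simp add: mat_def)
  ultimately show ?thesis using True by (simp add: hyp_coeff_def)
next
  case False
  define \<theta> where "\<theta> = y /\<^sub>R norm y"
  define s where "s = (stretch 1 (norm y))\<^sup>2"
  have s: "s \<noteq> 0" using stretch_pos[of "norm y"] by (simp add: s_def)
  have "norm \<theta> = 1" using False by (simp add: \<theta>_def)
  then have "\<theta> \<bullet> \<theta> = 1" by (simp add: norm_eq_1)
  then have tt: "\<theta>$1 * \<theta>$1 + \<theta>$2 * \<theta>$2 + \<theta>$3 * \<theta>$3 = 1"
    by (simp add: inner_vec_def sum_3)
  \<comment> \<open>\<open>P c\<close> is 1 in the direction \<theta> and c on its orthogonal
    complement, so products of such matrices multiply the parameters.\<close>
  define P where "P c = (\<chi> i j. (1 - c) * (\<theta>$i * \<theta>$j) + c * (if i = j then 1 else 0))" for c :: real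
  have g: "hyp_metric 1 y = P s"
    unfolding hyp_metric_def Let_def \<theta>_def[symmetric] s_def[symmetric]
    by (simp add: P_def vec_eq_iff algebra_simps)
  have PP: "P a ** P b = mat 1" if ab: "a * b = 1" for a b
  proof -
    have "(P a ** P b) $ i $ j = (1 - a) * (1 - b) * (\<theta>$i * \<theta>$j) * (\<theta>$1 * \<theta>$1 + \<theta>$2 * \<theta>$2 + \<theta>$3 * \<theta>$3)
        + ((1 - a) * b + (1 - b) * a) * (\<theta>$i * \<theta>$j) + a * b * (if i = j then 1 else 0)" for i j
      using exhaust_3[of i] exhaust_3[of j]
      by (auto simp: P_def matrix_matrix_mult_def sum_3 algebra_simps)
    also have "\<dots> i j = (1 - a * b) * (\<theta>$i * \<theta>$j) + a * b * (if i = j then 1 else 0)" for i j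
      unfolding tt by (simp add: algebra_simps)
    finally show ?thesis using ab by (simp add: vec_eq_iff mat_def)
  qed
  have "matrix_inv (hyp_metric 1 y) = P (1 / s)"
    unfolding g using s by (intro matrix_inv_eqI PP) auto
  then have "sqrt (det (hyp_metric 1 y)) * matrix_inv (hyp_metric 1 y) $ i $ j
      = s * ((1 - 1 / s) * (\<theta>$i * \<theta>$j) + 1 / s * (if i = j then 1 else 0))"
    by (simp add: sqrt_det_hyp_metric s_def P_def)
  also have "\<dots> = (s - 1) * (\<theta>$i * \<theta>$j) + (if i = j then 1 else 0)"
    using s by (simp add: field_simps)
  also have "\<theta>$i * \<theta>$j = y$i * y$j / (norm y)\<^sup>2"
    by (simp add: \<theta>_def power2_eq_square divide_inverse)
  finally show ?thesis by (simp add: hyp_coeff_def radial_coeff_def s_def)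
qed

lemma DERIV_stretch:
  assumes "r \<noteq> 0" shows "(stretch 1 has_real_derivative stretch' r) (at r)"
proof -
  have "((\<lambda>r. sinh r / r) has_real_derivative stretch' r) (at r)"
    using assms by (auto intro!: derivative_eq_intros simp: stretch'_def stretch_1 field_simps)
  moreover have "\<forall>\<^sub>F x in nhds r. stretch 1 x = sinh x / x"
    using assms by (intro eventually_nhds[THEN iffD2] exI[of _ "- {0}"]) (auto simp: stretch_1)
  ultimately show ?thesis
    by (subst DERIV_cong_ev[OF refl _ refl])
qed

definition hyp_dq :: "real^3 \<Rightarrow> 3 \<Rightarrow> real^3 \<Rightarrow> real"
  where "hyp_dq x i y = (cosh (norm x) * stretch 1 (norm y)
    - stretch' (norm y) * (hyp_embed x \<bullet> y) / norm y) * y$i - stretch 1 (norm y) * hyp_embed x $ i"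

text \<open>The coefficient of (hyp_embed x \<bullet> y) y_i in A \<nabla>q, simplified by hand so
  that \<open>hyp_B\<close> has a closed form that is easy to differentiate.\<close>

definition radial_coeff2 :: "real \<Rightarrow> real"
  where "radial_coeff2 r = (stretch 1 r - (stretch 1 r)\<^sup>2 * cosh r) / r\<^sup>2"

definition hyp_B :: "real^3 \<Rightarrow> 3 \<Rightarrow> real^3 \<Rightarrow> real"
  where "hyp_B x i y = (cosh (norm x) * stretch 1 (norm y) ^ 3
    + radial_coeff2 (norm y) * (hyp_embed x \<bullet> y)) * y$i - stretch 1 (norm y) * hyp_embed x $ i"

definition radial_coeff2' :: "real \<Rightarrow> real"
  where "radial_coeff2' r = (stretch' r - 2 * stretch 1 r * stretch' r * cosh r - stretch 1 r ^ 3 * r) / r\<^sup>2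
    - 2 * (stretch 1 r - (stretch 1 r)\<^sup>2 * cosh r) / r ^ 3"

definition hyp_dB :: "real^3 \<Rightarrow> 3 \<Rightarrow> real^3 \<Rightarrow> real"
  where "hyp_dB x i y = (let r = norm y; \<sigma> = stretch 1 r; \<sigma>' = stretch' r; v = hyp_embed x \<bullet> y in
    (3 * cosh (norm x) * \<sigma>\<^sup>2 * \<sigma>' * (y$i / r) + radial_coeff2' r * (y$i / r) * v + radial_coeff2 r * hyp_embed x $ i) * y$i
    + (cosh (norm x) * \<sigma> ^ 3 + radial_coeff2 r * v) - \<sigma>' * (y$i / r) * hyp_embed x $ i)"

definition radial_coeff' :: "real \<Rightarrow> real"
  where "radial_coeff' r = 2 * stretch 1 r * stretch' r / r\<^sup>2 - 2 * ((stretch 1 r)\<^sup>2 - 1) / r ^ 3"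

definition hyp_dcoeff :: "3 \<Rightarrow> 3 \<Rightarrow> real^3 \<Rightarrow> real"
  where "hyp_dcoeff i j y = radial_coeff' (norm y) * (y$i / norm y) * y$i * y$j
    + radial_coeff (norm y) * (y$j + (if i = j then y$i else 0))"

lemma sinh_eq_stretch: "sinh r = stretch 1 r * r"
  by (cases "r = 0") (simp_all add: stretch_1)

section \<open>Derivatives along coordinate lines\<close>

context
  fixes y :: "real^3" and i :: 3
  assumes y: "y \<noteq> 0"
begin

lemma line_norm: "((\<lambda>t. norm (y + t *\<^sub>R axis i 1)) has_real_derivative y$i / norm y) (at 0)"
proof -
  have "((\<lambda>t. y + t *\<^sub>R axis i 1) has_derivative (\<lambda>h. h *\<^sub>R axis i 1)) (at 0)"
    by (auto intro!: derivative_eq_intros)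
  from has_derivative_compose[OF this, of norm "\<lambda>h. h \<bullet> sgn y"]
  have "((\<lambda>t. norm (y + t *\<^sub>R axis i 1)) has_derivative (\<lambda>h. (h *\<^sub>R axis i 1) \<bullet> sgn y)) (at 0)"
    using y has_derivative_norm[of y] by simp
  moreover have "(h *\<^sub>R axis i 1) \<bullet> sgn y = y$i / norm y * h" for h
    by (simp add: inner_axis' sgn_div_norm divide_inverse)
  ultimately have "((\<lambda>t. norm (y + t *\<^sub>R axis i 1)) has_derivative (\<lambda>h. y$i / norm y * h)) (at 0)"
    by (simp only:)
  then show ?thesis
    unfolding has_field_derivative_def .
qed

lemma line_radial:
  assumes "(f has_real_derivative f') (at (norm y))"
  shows "((\<lambda>t. f (norm (y + t *\<^sub>R axis i 1))) has_real_derivative f' * (y$i / norm y)) (at 0)"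
  by (rule DERIV_chain2[OF _ line_norm]) (use assms in simp)

lemma line_inner: "((\<lambda>t. V \<bullet> (y + t *\<^sub>R axis i 1)) has_real_derivative V$i) (at 0)"
  by (auto intro!: derivative_eq_intros simp: inner_add_right inner_axis)

lemma line_nth: "((\<lambda>t. (y + t *\<^sub>R axis i 1) $ j) has_real_derivative (if i = j then 1 else 0)) (at 0)"
  by (auto intro!: derivative_eq_intros simp: axis_def)

lemma line_cosh_dist:
  "((\<lambda>t. cosh_dist x (y + t *\<^sub>R axis i 1)) has_real_derivative hyp_dq x i y) (at 0)"
proof -
  have "cosh_dist x z = cosh (norm x) * cosh (norm z) - stretch 1 (norm z) * (hyp_embed x \<bullet> z)" for z
    by (simp add: cosh_dist_def hyp_embed_def[of z])
  moreover have "((\<lambda>t. cosh (norm x) * cosh (norm (y + t *\<^sub>R axis i 1))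
      - stretch 1 (norm (y + t *\<^sub>R axis i 1)) * (hyp_embed x \<bullet> (y + t *\<^sub>R axis i 1))) has_real_derivative
      cosh (norm x) * (sinh (norm y) * (y $ i / norm y))
      - (stretch 1 (norm y) * hyp_embed x $ i + stretch' (norm y) * (y $ i / norm y) * (hyp_embed x \<bullet> y))) (at 0)"
    using y DERIV_mult'[OF line_radial[OF DERIV_stretch] line_inner, of "hyp_embed x"]
    by (intro DERIV_diff DERIV_cmult line_radial[where f = cosh and f' = "sinh (norm y)"])
      (auto intro!: derivative_eq_intros)
  moreover have "cosh (norm x) * (sinh (norm y) * (y $ i / norm y))
      - (stretch 1 (norm y) * hyp_embed x $ i + stretch' (norm y) * (y $ i / norm y) * (hyp_embed x \<bullet> y)) = hyp_dq x i y"
    using y by (simp add: hyp_dq_def sinh_eq_stretch algebra_simps)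
  ultimately show ?thesis by simp
qed

lemma line_hyp_B: "((\<lambda>t. hyp_B x i (y + t *\<^sub>R axis i 1)) has_real_derivative hyp_dB x i y) (at 0)"
proof -
  have "(radial_coeff2 has_real_derivative radial_coeff2' (norm y)) (at (norm y))"
    unfolding radial_coeff2_def[abs_def] radial_coeff2'_def using y
    apply (auto intro!: derivative_eq_intros DERIV_stretch simp: sinh_eq_stretch)
    apply (simp add: field_simps eval_nat_numeral)
    done
  note c = line_radial[OF this]
  show ?thesis
    unfolding hyp_B_def hyp_dB_def Let_def using y
    by (auto intro!: derivative_eq_intros c line_radial[OF DERIV_stretch] line_inner line_nth)
qed

lemma line_hyp_coeff: "((\<lambda>t. hyp_coeff i j (y + t *\<^sub>R axis i 1)) has_real_derivative hyp_dcoeff i j y) (at 0)"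
proof -
  have "(radial_coeff has_real_derivative radial_coeff' (norm y)) (at (norm y))"
    unfolding radial_coeff_def[abs_def] radial_coeff'_def using y
    apply (auto intro!: derivative_eq_intros DERIV_stretch)
    apply (simp add: field_simps eval_nat_numeral)
    done
  note c = line_radial[OF this]
  from DERIV_add[OF DERIV_const[of "if i = j then 1 else 0"] DERIV_mult'[OF DERIV_mult'[OF c line_nth[of i]] line_nth[of j]]]
  show ?thesis
    unfolding hyp_coeff_def hyp_dcoeff_def
    by (rule DERIV_cong) (simp add: algebra_simps)
qed

end

text \<open>This ties the closed form \<open>hyp_B\<close> to its meaning, the matrix
  \<open>hyp_coeff\<close> applied to the gradient of q, with that matrix written as identity plus a
  multiple of y y^T.\<close>

lemma hyp_B_eq_hyp_dq:
  assumes y: "y \<noteq> 0"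
  shows "hyp_B x i y = hyp_dq x i y + radial_coeff (norm y) * y$i * (\<Sum>j\<in>UNIV. y$j * hyp_dq x j y)"
proof -
  define V v where "V = hyp_embed x" "v = V \<bullet> y"
  define r \<sigma> C where "r = norm y" "\<sigma> = stretch 1 r" "C = cosh r"
  have r: "r \<noteq> 0" using y by (simp add: r_\<sigma>_C_def)
  have r2: "(\<Sum>j\<in>UNIV. y$j * y$j) = r\<^sup>2"
    unfolding r_\<sigma>_C_def power2_norm_eq_inner by (simp add: inner_vec_def)
  have v2: "(\<Sum>j\<in>UNIV. y$j * V$j) = v" by (simp add: V_v_def inner_vec_def mult.commute)
  define \<alpha> where "\<alpha> = cosh (norm x) * \<sigma> - (C - \<sigma>) / r * v / r"
  have dq: "hyp_dq x j y = \<alpha> * y$j - \<sigma> * V$j" for j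
    by (simp add: hyp_dq_def \<alpha>_def V_v_def r_\<sigma>_C_def stretch'_def)
  have "(\<Sum>j\<in>UNIV. y$j * hyp_dq x j y) = \<alpha> * (\<Sum>j\<in>UNIV. y$j * y$j) - \<sigma> * (\<Sum>j\<in>UNIV. y$j * V$j)"
    unfolding dq sum_distrib_left sum_subtractf[symmetric] by (intro sum.cong) (auto simp: algebra_simps)
  also have "\<dots> = \<alpha> * r\<^sup>2 - \<sigma> * v" by (simp add: r2 v2)
  finally show ?thesis
    unfolding dq using r
    by (simp add: hyp_B_def radial_coeff_def radial_coeff2_def V_v_def[symmetric] r_\<sigma>_C_def[symmetric] \<alpha>_def)
      (simp add: field_simps power2_eq_square power3_eq_cube)
qed

text \<open>The distance has gradient of length 1, so the gradient of cosh d has squared length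
  (sinh d)^2; the other factor is the volume density contained in A.\<close>

lemma sum_hyp_dq_hyp_B:
  assumes y: "y \<noteq> 0"
  shows "(\<Sum>i\<in>UNIV. hyp_dq x i y * hyp_B x i y) = (stretch 1 (norm y))\<^sup>2 * (sinh_dist x y)\<^sup>2"
proof -
  define V v where "V = hyp_embed x" "v = V \<bullet> y"
  define r \<sigma> C a where "r = norm y" "\<sigma> = stretch 1 r" "C = cosh r" "a = cosh (norm x)"
  have r: "r \<noteq> 0" using y by (simp add: r_\<sigma>_C_a_def)
  have C2: "C\<^sup>2 = 1 + \<sigma>\<^sup>2 * r\<^sup>2"
    using cosh_square_eq[of r] by (simp add: r_\<sigma>_C_a_def sinh_eq_stretch power_mult_distrib)
  have r2: "(\<Sum>j\<in>UNIV. y$j * y$j) = r\<^sup>2"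
    unfolding r_\<sigma>_C_a_def power2_norm_eq_inner by (simp add: inner_vec_def)
  have v2: "(\<Sum>j\<in>UNIV. V$j * y$j) = v" by (simp add: V_v_def inner_vec_def)
  have V2: "(\<Sum>j\<in>UNIV. V$j * V$j) = a\<^sup>2 - 1"
    using hyp_embed_inner_self[of x] by (simp add: V_v_def inner_vec_def r_\<sigma>_C_a_def cosh_square_eq)
  have q: "cosh_dist x y = a * C - \<sigma> * v"
    by (simp add: cosh_dist_def hyp_embed_def[of y] V_v_def r_\<sigma>_C_a_def)
  define \<alpha> \<gamma> where "\<alpha> = a * \<sigma> - (C - \<sigma>) / r * v / r" "\<gamma> = a * \<sigma> ^ 3 + (\<sigma> - \<sigma>\<^sup>2 * C) / r\<^sup>2 * v"
  have dq: "hyp_dq x j y = \<alpha> * y$j - \<sigma> * V$j" for j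
    by (simp add: hyp_dq_def \<alpha>_\<gamma>_def V_v_def r_\<sigma>_C_a_def stretch'_def)
  have B: "hyp_B x j y = \<gamma> * y$j - \<sigma> * V$j" for j
    by (simp add: hyp_B_def \<alpha>_\<gamma>_def V_v_def r_\<sigma>_C_a_def radial_coeff2_def)
  have "(\<Sum>i\<in>UNIV. hyp_dq x i y * hyp_B x i y) = \<alpha> * \<gamma> * (\<Sum>j\<in>UNIV. y$j * y$j)
      - \<sigma> * (\<alpha> + \<gamma>) * (\<Sum>j\<in>UNIV. V$j * y$j) + \<sigma>\<^sup>2 * (\<Sum>j\<in>UNIV. V$j * V$j)"
    unfolding dq B sum_distrib_left sum_subtractf[symmetric] sum.distrib[symmetric]
    by (intro sum.cong) (auto simp: algebra_simps power2_eq_square)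
  \<comment> \<open>Multiplied by \<open>r\<^sup>2\<close>, both \<alpha> and \<gamma> become
    polynomials, and the claim is a polynomial identity modulo cosh^2 - sinh^2 = 1.\<close>
  also have "\<dots> = (\<alpha> * r\<^sup>2) * (\<gamma> * r\<^sup>2) / r\<^sup>2 - \<sigma> * (\<alpha> * r\<^sup>2 + \<gamma> * r\<^sup>2) / r\<^sup>2 * v + \<sigma>\<^sup>2 * (a\<^sup>2 - 1)"
    unfolding r2 v2 V2 using r by (simp add: field_simps)
  also have "\<alpha> * r\<^sup>2 = a * \<sigma> * r\<^sup>2 - (C - \<sigma>) * v"
    using r by (simp add: \<alpha>_\<gamma>_def field_simps power2_eq_square)
  also have "\<gamma> * r\<^sup>2 = a * \<sigma> ^ 3 * r\<^sup>2 + (\<sigma> - \<sigma>\<^sup>2 * C) * v"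
    using r by (simp add: \<alpha>_\<gamma>_def field_simps)
  also have "(a * \<sigma> * r\<^sup>2 - (C - \<sigma>) * v) * (a * \<sigma> ^ 3 * r\<^sup>2 + (\<sigma> - \<sigma>\<^sup>2 * C) * v) / r\<^sup>2
      - \<sigma> * (a * \<sigma> * r\<^sup>2 - (C - \<sigma>) * v + (a * \<sigma> ^ 3 * r\<^sup>2 + (\<sigma> - \<sigma>\<^sup>2 * C) * v)) / r\<^sup>2 * v + \<sigma>\<^sup>2 * (a\<^sup>2 - 1)
    = \<sigma>\<^sup>2 * ((a * C - \<sigma> * v)\<^sup>2 - 1)"
  proof -
    have "(a * \<sigma> * r\<^sup>2 - (C - \<sigma>) * v) * (a * \<sigma> ^ 3 * r\<^sup>2 + (\<sigma> - \<sigma>\<^sup>2 * C) * v)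
      - \<sigma> * (a * \<sigma> * r\<^sup>2 - (C - \<sigma>) * v + (a * \<sigma> ^ 3 * r\<^sup>2 + (\<sigma> - \<sigma>\<^sup>2 * C) * v)) * v + \<sigma>\<^sup>2 * (a\<^sup>2 - 1) * r\<^sup>2
      = \<sigma>\<^sup>2 * ((a * C - \<sigma> * v)\<^sup>2 - 1) * r\<^sup>2"
      using C2 by algebra
    moreover have "X / r\<^sup>2 - Y / r\<^sup>2 * v + Z = W" if "X - Y * v + Z * r\<^sup>2 = W * r\<^sup>2" for X Y Z W
      using that r by (auto simp: field_simps)
    ultimately show ?thesis by blast
  qed
  finally show ?thesis by (simp add: sinh_dist_eq q r_\<sigma>_C_a_def)
qed

text \<open>On hyperbolic 3-space, cosh d is an eigenfunction of the Laplacian with eigenvalue 3;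
  the square is again the volume density.\<close>

lemma sum_hyp_dB:
  assumes y: "y \<noteq> 0"
  shows "(\<Sum>i\<in>UNIV. hyp_dB x i y) = 3 * (stretch 1 (norm y))\<^sup>2 * cosh_dist x y"
proof -
  define V v where "V = hyp_embed x" "v = V \<bullet> y"
  define r \<sigma> C a where "r = norm y" "\<sigma> = stretch 1 r" "C = cosh r" "a = cosh (norm x)"
  have r: "r \<noteq> 0" using y by (simp add: r_\<sigma>_C_a_def)
  have C2: "C\<^sup>2 = 1 + \<sigma>\<^sup>2 * r\<^sup>2"
    using cosh_square_eq[of r] by (simp add: r_\<sigma>_C_a_def sinh_eq_stretch power_mult_distrib)
  have r2: "(\<Sum>j\<in>UNIV. y$j * y$j) = r\<^sup>2"
    unfolding r_\<sigma>_C_a_def power2_norm_eq_inner by (simp add: inner_vec_def)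
  have v2: "(\<Sum>j\<in>UNIV. V$j * y$j) = v" by (simp add: V_v_def inner_vec_def)
  have q: "cosh_dist x y = a * C - \<sigma> * v"
    by (simp add: cosh_dist_def hyp_embed_def[of y] V_v_def r_\<sigma>_C_a_def)
  define Q' Q s where "Q' = radial_coeff2' r" "Q = radial_coeff2 r" "s = stretch' r"
  define \<gamma> where "\<gamma> = a * \<sigma> ^ 3 + Q * v"
  have s: "s * r = C - \<sigma>" using r by (simp add: Q'_Q_s_def stretch'_def r_\<sigma>_C_a_def)
  have Q: "Q * r\<^sup>2 = \<sigma> - \<sigma>\<^sup>2 * C" using r by (simp add: Q'_Q_s_def radial_coeff2_def r_\<sigma>_C_a_def)
  have "Q' * r ^ 3 = (s - 2 * \<sigma> * s * C - \<sigma> ^ 3 * r) * r - 2 * (\<sigma> - \<sigma>\<^sup>2 * C)"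
  proof -
    have "(A / r\<^sup>2 - 2 * B / r ^ 3) * r ^ 3 = A * r - 2 * B" for A B
      using r by (simp add: field_simps eval_nat_numeral)
    then show ?thesis
      unfolding Q'_Q_s_def radial_coeff2'_def r_\<sigma>_C_a_def[symmetric] .
  qed
  also have "\<dots> = s * r - 2 * \<sigma> * (s * r) * C - \<sigma> ^ 3 * r\<^sup>2 - 2 * (\<sigma> - \<sigma>\<^sup>2 * C)"
    by (simp add: algebra_simps power2_eq_square)
  finally have Q': "Q' * r ^ 3 = (C - \<sigma>) - 2 * \<sigma> * (C - \<sigma>) * C - \<sigma> ^ 3 * r\<^sup>2 - 2 * (\<sigma> - \<sigma>\<^sup>2 * C)"
    unfolding s .
  have dB: "hyp_dB x j y = (3 * a * \<sigma>\<^sup>2 * s + Q' * v) / r * (y$j * y$j) + (Q - s / r) * (V$j * y$j) + \<gamma>" for j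
    using r by (simp add: hyp_dB_def Let_def \<gamma>_def V_v_def[symmetric] r_\<sigma>_C_a_def[symmetric] Q'_Q_s_def[symmetric] field_simps)
  have "(\<Sum>i\<in>UNIV. hyp_dB x i y) = (3 * a * \<sigma>\<^sup>2 * s + Q' * v) / r * (\<Sum>j\<in>UNIV. y$j * y$j)
      + (Q - s / r) * (\<Sum>j\<in>UNIV. V$j * y$j) + 3 * \<gamma>"
    unfolding dB sum.distrib sum_distrib_left by simp
  also have "\<dots> = (3 * a * \<sigma>\<^sup>2 * (s * r) * r\<^sup>2 + (Q' * r ^ 3) * v + (4 * (Q * r\<^sup>2) - s * r) * v + 3 * a * \<sigma> ^ 3 * r\<^sup>2) / r\<^sup>2"
    unfolding r2 v2 \<gamma>_def using r by (simp add: field_simps eval_nat_numeral)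
  also have "3 * a * \<sigma>\<^sup>2 * (s * r) * r\<^sup>2 + (Q' * r ^ 3) * v + (4 * (Q * r\<^sup>2) - s * r) * v + 3 * a * \<sigma> ^ 3 * r\<^sup>2
    = (3 * \<sigma>\<^sup>2 * (a * C - \<sigma> * v)) * r\<^sup>2"
    unfolding s Q Q' using C2 by algebra
  finally show ?thesis using r by (simp add: q r_\<sigma>_C_a_def)
qed

section \<open>Radial functions of the distance\<close>

definition exp_diff :: "complex \<Rightarrow> complex \<Rightarrow> real \<Rightarrow> complex"
  where "exp_diff \<mu> \<nu> d = exp (- (\<mu> * of_real d)) - exp (- (\<nu> * of_real d))"

definition exp_diff' :: "complex \<Rightarrow> complex \<Rightarrow> real \<Rightarrow> complex"
  where "exp_diff' \<mu> \<nu> d = \<nu> * exp (- (\<nu> * of_real d)) - \<mu> * exp (- (\<mu> * of_real d))"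

definition exp_diff'' :: "complex \<Rightarrow> complex \<Rightarrow> real \<Rightarrow> complex"
  where "exp_diff'' \<mu> \<nu> d = \<mu>\<^sup>2 * exp (- (\<mu> * of_real d)) - \<nu>\<^sup>2 * exp (- (\<nu> * of_real d))"

lemma exp_diff_deriv: "(exp_diff \<mu> \<nu> has_vector_derivative exp_diff' \<mu> \<nu> d) (at d)"
proof -
  have "((\<lambda>z. exp (- (\<mu> * z)) - exp (- (\<nu> * z))) has_field_derivative exp_diff' \<mu> \<nu> d) (at (of_real d))"
    unfolding exp_diff'_def by (auto intro!: derivative_eq_intros)
  from has_vector_derivative_real_field[OF this] show ?thesis
    by (simp add: exp_diff_def[abs_def])
qed

lemma exp_diff'_deriv: "(exp_diff' \<mu> \<nu> has_vector_derivative exp_diff'' \<mu> \<nu> d) (at d)"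
proof -
  have "((\<lambda>z. \<nu> * exp (- (\<nu> * z)) - \<mu> * exp (- (\<mu> * z))) has_field_derivative exp_diff'' \<mu> \<nu> d) (at (of_real d))"
    unfolding exp_diff''_def by (auto intro!: derivative_eq_intros simp: power2_eq_square)
  from has_vector_derivative_real_field[OF this] show ?thesis
    by (simp add: exp_diff'_def[abs_def])
qed

lemma norm_exp_minus_le: "0 \<le> Re \<mu> \<Longrightarrow> 0 \<le> d \<Longrightarrow> norm (exp (- (\<mu> * of_real d))) \<le> 1"
  by (simp add: norm_exp_eq_Re)

lemma norm_exp_diff'_le:
  assumes "0 \<le> Re \<mu>" "0 \<le> Re \<nu>" "0 \<le> d"
  shows "norm (exp_diff' \<mu> \<nu> d) \<le> norm \<mu> + norm \<nu>"
proof -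
  have "norm (exp_diff' \<mu> \<nu> d) \<le> norm \<nu> * norm (exp (- (\<nu> * of_real d))) + norm \<mu> * norm (exp (- (\<mu> * of_real d)))"
    unfolding exp_diff'_def by (rule order_trans[OF norm_triangle_ineq4]) (simp add: norm_mult)
  also have "\<dots> \<le> norm \<nu> * 1 + norm \<mu> * 1"
    by (intro add_mono mult_left_mono norm_exp_minus_le assms) auto
  finally show ?thesis by simp
qed

lemma norm_exp_diff_le_2:
  assumes "0 \<le> Re \<mu>" "0 \<le> Re \<nu>" "0 \<le> d"
  shows "norm (exp_diff \<mu> \<nu> d) \<le> 2"
  unfolding exp_diff_def
  by (rule order_trans[OF norm_triangle_ineq4])
    (use norm_exp_minus_le[OF assms(1,3)] norm_exp_minus_le[OF assms(2,3)] in linarith)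

lemma norm_exp_diff''_le:
  assumes "0 \<le> Re \<mu>" "0 \<le> Re \<nu>" "0 \<le> d"
  shows "norm (exp_diff'' \<mu> \<nu> d - exp_diff \<mu> \<nu> d) \<le> (norm \<mu>)\<^sup>2 + (norm \<nu>)\<^sup>2 + 2"
proof -
  have "norm (exp_diff'' \<mu> \<nu> d) \<le> (norm \<mu>)\<^sup>2 * norm (exp (- (\<mu> * of_real d))) + (norm \<nu>)\<^sup>2 * norm (exp (- (\<nu> * of_real d)))"
    unfolding exp_diff''_def by (rule order_trans[OF norm_triangle_ineq4]) (simp add: norm_mult norm_power)
  also have "\<dots> \<le> (norm \<mu>)\<^sup>2 * 1 + (norm \<nu>)\<^sup>2 * 1"
    by (intro add_mono mult_left_mono norm_exp_minus_le assms) auto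
  finally show ?thesis
    using norm_exp_diff_le_2[OF assms] norm_triangle_ineq4[of "exp_diff'' \<mu> \<nu> d" "exp_diff \<mu> \<nu> d"] by simp
qed

text \<open>The two exponentials agree at d = 0, and this zero cancels the singularity of 1 / sinh
  d: hence the regularized kernel is bounded.\<close>

lemma norm_exp_diff_le:
  assumes "0 \<le> Re \<mu>" "0 \<le> Re \<nu>" "0 \<le> d"
  shows "norm (exp_diff \<mu> \<nu> d) \<le> (norm \<mu> + norm \<nu>) * d"
proof (cases "d = 0")
  case False
  then have "norm (exp_diff \<mu> \<nu> d - exp_diff \<mu> \<nu> 0) \<le> (norm \<mu> + norm \<nu>) * d - (norm \<mu> + norm \<nu>) * 0"
    using assms
    by (intro differentiable_bound_general[where f' = "exp_diff' \<mu> \<nu>" and \<phi>' = "\<lambda>_. norm \<mu> + norm \<nu>"]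
        continuous_at_imp_continuous_on ballI has_vector_derivative_continuous[OF exp_diff_deriv]
        exp_diff_deriv norm_exp_diff'_le)
      (auto intro!: continuous_intros derivative_eq_intros)
  then show ?thesis by (simp add: exp_diff_def)
qed (simp add: exp_diff_def)

text \<open>The numerator left when \<open>exp_diff\<close> / sinh is differentiated with respect to
  cosh d; the denominator is (sinh d)^3.\<close>

definition exp_diff_num :: "complex \<Rightarrow> complex \<Rightarrow> real \<Rightarrow> complex"
  where "exp_diff_num \<mu> \<nu> d = sinh d *\<^sub>R exp_diff' \<mu> \<nu> d - cosh d *\<^sub>R exp_diff \<mu> \<nu> d"

lemma exp_diff_num_deriv:
  "(exp_diff_num \<mu> \<nu> has_vector_derivative sinh d *\<^sub>R (exp_diff'' \<mu> \<nu> d - exp_diff \<mu> \<nu> d)) (at d)"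
  unfolding exp_diff_num_def[abs_def]
  by (rule derivative_eq_intros exp_diff_deriv exp_diff'_deriv has_vector_derivative_scaleR refl | simp)+
    (simp add: scaleR_diff_right)

text \<open>Terms without a factor sinh d cancel in the derivative of the numerator, so it vanishes
  to second order. Comparison with a multiple of cosh d and cosh d - 1 \<le> (sinh d)^2 / 2 give the
  bound.\<close>

lemma norm_exp_diff_num_le:
  assumes "0 \<le> Re \<mu>" "0 \<le> Re \<nu>" "0 \<le> d"
  shows "norm (exp_diff_num \<mu> \<nu> d) \<le> ((norm \<mu>)\<^sup>2 + (norm \<nu>)\<^sup>2 + 2) * (sinh d)\<^sup>2 / 2"
proof (cases "d = 0")
  case False
  define M where "M = (norm \<mu>)\<^sup>2 + (norm \<nu>)\<^sup>2 + 2"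
  have "norm (exp_diff_num \<mu> \<nu> d - exp_diff_num \<mu> \<nu> 0) \<le> M * cosh d - M * cosh 0"
  proof (rule differentiable_bound_general[where f' = "\<lambda>d. sinh d *\<^sub>R (exp_diff'' \<mu> \<nu> d - exp_diff \<mu> \<nu> d)" and \<phi>' = "\<lambda>d. M * sinh d"])
    fix x assume x: "0 < x" "x < d"
    show "norm (sinh x *\<^sub>R (exp_diff'' \<mu> \<nu> x - exp_diff \<mu> \<nu> x)) \<le> M * sinh x"
      using norm_exp_diff''_le[OF assms(1,2), of x] x unfolding M_def by (simp add: mult.commute mult_right_mono)
    show "((\<lambda>d. M * cosh d) has_vector_derivative M * sinh x) (at x)"
      unfolding has_real_derivative_iff_has_vector_derivative[symmetric] by (auto intro!: derivative_eq_intros)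
  qed (use False assms in \<open>auto intro!: continuous_intros continuous_at_imp_continuous_on has_vector_derivative_continuous[OF exp_diff_num_deriv] exp_diff_num_deriv\<close>)
  also have "\<dots> = M * (cosh d - 1)" by (simp add: algebra_simps)
  also have "cosh d - 1 \<le> (sinh d)\<^sup>2 / 2"
  proof -
    have "(cosh d - 1) * 2 \<le> (cosh d - 1) * (cosh d + 1)"
      using cosh_real_ge_1[of d] by (intro mult_left_mono) auto
    also have "\<dots> = (sinh d)\<^sup>2" using sinh_square_eq[of d] by (simp add: power2_eq_square algebra_simps)
    finally show ?thesis by simp
  qed
  finally show ?thesis by (simp add: exp_diff_num_def exp_diff_def exp_diff'_def M_def mult_left_mono)
qed (simp add: exp_diff_num_def exp_diff_def)

abbreviation hyp_dist :: "real^3 \<Rightarrow> real^3 \<Rightarrow> real"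
  where "hyp_dist x y \<equiv> arsinh (sinh_dist x y)"

lemma cosh_arsinh: "cosh (arsinh r) = sqrt (1 + r\<^sup>2)" for r :: real
  using cosh_square_eq[of "arsinh r"] by (intro real_sqrt_unique[symmetric]) (auto simp: add.commute)

lemma cosh_hyp_dist: "cosh (hyp_dist x y) = cosh_dist x y"
  by (simp add: cosh_arsinh cosh_dist_eq)

lemma hyp_dist_nonneg: "0 \<le> hyp_dist x y"
  by (simp add: arsinh_nonneg)

lemma sinh_dist_eq_0_iff: "sinh_dist x y = 0 \<longleftrightarrow> x = y"
proof
  assume "sinh_dist x y = 0"
  then have "boost (hyp_embed x) (hyp_embed y) = 0" by (simp add: sinh_dist_def)
  then have "hyp_embed y = boost (- hyp_embed x) 0" by (metis boost_minus_boost)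
  then have "hyp_embed y = hyp_embed x" by (simp add: boost_def)
  then show "x = y" by (metis hyp_unembed_embed)
next
  assume "x = y"
  then have "(sinh_dist x y)\<^sup>2 = 0"
    by (simp add: sinh_dist_eq cosh_dist_def hyp_embed_inner_self)
      (use cosh_square_eq[of "norm y"] in \<open>simp add: power2_eq_square\<close>)
  then show "sinh_dist x y = 0" by simp
qed

text \<open>
  \<open>hyp_green'\<close> and \<open>hyp_green''\<close> are the derivatives of \<open>hyp_green\<close> with respect to \<open>cosh d\<close>, not \<open>d\<close>.
\<close>

definition hyp_green :: "complex \<Rightarrow> complex \<Rightarrow> real^3 \<Rightarrow> real^3 \<Rightarrow> complex"
  where "hyp_green \<mu> \<nu> x y = (1 / sinh_dist x y) *\<^sub>R exp_diff \<mu> \<nu> (hyp_dist x y)"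

definition hyp_green' :: "complex \<Rightarrow> complex \<Rightarrow> real^3 \<Rightarrow> real^3 \<Rightarrow> complex"
  where "hyp_green' \<mu> \<nu> x y = (1 / sinh_dist x y ^ 3) *\<^sub>R exp_diff_num \<mu> \<nu> (hyp_dist x y)"

definition hyp_green'' :: "complex \<Rightarrow> complex \<Rightarrow> real^3 \<Rightarrow> real^3 \<Rightarrow> complex"
  where "hyp_green'' \<mu> \<nu> x y =
    (1 / sinh_dist x y ^ 3) *\<^sub>R (exp_diff'' \<mu> \<nu> (hyp_dist x y) - exp_diff \<mu> \<nu> (hyp_dist x y))
    - (3 * cosh_dist x y / sinh_dist x y ^ 5) *\<^sub>R exp_diff_num \<mu> \<nu> (hyp_dist x y)"

context
  fixes x y :: "real^3" and i :: 3
  assumes y: "y \<noteq> 0" and xy: "y \<noteq> x"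
begin

lemma sinh_dist_pos: "0 < sinh_dist x y"
  using xy sinh_dist_eq_0_iff[of x y] sinh_dist_nonneg[of x y] by (metis less_le)

lemma line_sinh_dist: "((\<lambda>t. sinh_dist x (y + t *\<^sub>R axis i 1)) has_real_derivative
    cosh_dist x y / sinh_dist x y * hyp_dq x i y) (at 0)"
proof -
  have s: "sinh_dist x z = sqrt ((cosh_dist x z)\<^sup>2 - 1)" for z
    by (simp add: sinh_dist_eq[symmetric])
  have "((\<lambda>t. (cosh_dist x (y + t *\<^sub>R axis i 1))\<^sup>2 - 1) has_real_derivative
      2 * cosh_dist x y * hyp_dq x i y) (at 0)"
    using y by (auto intro!: derivative_eq_intros line_cosh_dist)
  note DERIV_chain2[OF _ this, of sqrt "inverse (sqrt ((cosh_dist x y)\<^sup>2 - 1)) / 2"]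
  moreover have "DERIV sqrt ((cosh_dist x y)\<^sup>2 - 1) :> inverse (sqrt ((cosh_dist x y)\<^sup>2 - 1)) / 2"
    using sinh_dist_pos by (intro DERIV_real_sqrt) (simp add: sinh_dist_eq[symmetric])
  ultimately show ?thesis
    unfolding s by (simp add: inverse_eq_divide)
qed

lemma line_dist: "((\<lambda>t. hyp_dist x (y + t *\<^sub>R axis i 1)) has_real_derivative
    hyp_dq x i y / sinh_dist x y) (at 0)"
proof -
  have "0 < cosh_dist x y" by (simp add: cosh_dist_eq add_pos_nonneg)
  moreover have "sqrt ((sinh_dist x y)\<^sup>2 + 1) = cosh_dist x y"
    by (simp add: cosh_dist_eq add.commute)
  ultimately show ?thesis
    using DERIV_chain2[OF arsinh_real_has_field_derivative[of "sinh_dist x (y + 0 *\<^sub>R axis i 1)" UNIV] line_sinh_dist]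
    by simp
qed

lemma line_comp_dist:
  assumes "(f has_vector_derivative f') (at (hyp_dist x y))"
  shows "((\<lambda>t. f (hyp_dist x (y + t *\<^sub>R axis i 1))) has_vector_derivative
    (hyp_dq x i y / sinh_dist x y) *\<^sub>R f') (at 0)"
  using vector_diff_chain_at[OF line_dist[unfolded has_real_derivative_iff_has_vector_derivative], of f f'] assms
  by (simp add: o_def)

lemma line_green: "((\<lambda>t. hyp_green \<mu> \<nu> x (y + t *\<^sub>R axis i 1)) has_vector_derivative
    hyp_dq x i y *\<^sub>R hyp_green' \<mu> \<nu> x y) (at 0)"
proof -
  define r where "r = sinh_dist x y"
  have r: "0 < r" using sinh_dist_pos by (simp add: r_def)
  have "((\<lambda>t. 1 / sinh_dist x (y + t *\<^sub>R axis i 1)) has_real_derivative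
      - (cosh_dist x y / r * hyp_dq x i y) / r\<^sup>2) (at 0)"
    using r by (auto intro!: derivative_eq_intros line_sinh_dist simp: r_def power2_eq_square)
  from has_vector_derivative_scaleR[OF this line_comp_dist[OF exp_diff_deriv]]
  show ?thesis
    unfolding hyp_green_def hyp_green'_def exp_diff_num_def cosh_hyp_dist
    by (rule has_vector_derivative_eq_rhs)
      (use r in \<open>simp add: r_def[symmetric] scaleR_diff_right eval_nat_numeral field_simps\<close>)
qed

lemma line_green': "((\<lambda>t. hyp_green' \<mu> \<nu> x (y + t *\<^sub>R axis i 1)) has_vector_derivative
    hyp_dq x i y *\<^sub>R hyp_green'' \<mu> \<nu> x y) (at 0)"
proof -
  define r where "r = sinh_dist x y"
  have r: "0 < r" using sinh_dist_pos by (simp add: r_def)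
  have "((\<lambda>t. 1 / sinh_dist x (y + t *\<^sub>R axis i 1) ^ 3) has_real_derivative
      - 3 * (cosh_dist x y / r * hyp_dq x i y) / r ^ 4) (at 0)"
    using r by (auto intro!: derivative_eq_intros line_sinh_dist simp: r_def) (simp add: eval_nat_numeral field_simps)
  from has_vector_derivative_scaleR[OF this line_comp_dist[OF exp_diff_num_deriv]]
  show ?thesis
    unfolding hyp_green'_def hyp_green''_def
    by (rule has_vector_derivative_eq_rhs)
      (use r in \<open>simp add: r_def[symmetric] scaleR_diff_right eval_nat_numeral field_simps\<close>)
qed

end

section \<open>Green's identity\<close>

lemma smooth_differentiable: "smooth u \<Longrightarrow> u differentiable (at y)"
  unfolding smooth_def by (metis foldr.simps(1) id_apply)

lemma smooth_partial: "smooth u \<Longrightarrow> smooth (partial j u)"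
proof -
  assume u: "smooth u"
  have "foldr partial is (partial j u) = foldr partial (is @ [j]) u" for "is" by simp
  then show ?thesis using u unfolding smooth_def by metis
qed

lemma smooth_continuous: "smooth u \<Longrightarrow> continuous_on S u"
  using smooth_differentiable differentiable_imp_continuous_within
  by (metis continuous_at_imp_continuous_on)

lemma smooth_measurable: "smooth u \<Longrightarrow> (u :: real^'n \<Rightarrow> 'b::euclidean_space) \<in> borel_measurable borel"
  by (intro borel_measurable_continuous_onI smooth_continuous)

lemma line_differentiable:
  assumes "u differentiable (at y)"
  shows "((\<lambda>t. u (y + t *\<^sub>R axis i 1)) has_vector_derivative partial i u y) (at 0)"
proof -
  have "(\<lambda>t. y + t *\<^sub>R axis i 1) differentiable (at (0::real))"
    by (auto intro!: derivative_intros)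
  then have "(u \<circ> (\<lambda>t. y + t *\<^sub>R axis i 1)) differentiable (at (0::real))"
    using assms by (intro differentiable_chain_at) simp_all
  then show ?thesis
    unfolding partial_def o_def by (simp add: vector_derivative_works)
qed

definition hyp_flux :: "(real^3 \<Rightarrow> complex) \<Rightarrow> 3 \<Rightarrow> real^3 \<Rightarrow> complex"
  where "hyp_flux u i y = (\<Sum>j\<in>UNIV. hyp_coeff i j y *\<^sub>R partial j u y)"

definition hyp_dflux :: "(real^3 \<Rightarrow> complex) \<Rightarrow> 3 \<Rightarrow> real^3 \<Rightarrow> complex"
  where "hyp_dflux u i y = (\<Sum>j\<in>UNIV. hyp_coeff i j y *\<^sub>R partial i (partial j u) y + hyp_dcoeff i j y *\<^sub>R partial j u y)"

lemma line_flux: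
  assumes "smooth u" "y \<noteq> 0"
  shows "((\<lambda>t. hyp_flux u i (y + t *\<^sub>R axis i 1)) has_vector_derivative hyp_dflux u i y) (at 0)"
  unfolding hyp_flux_def hyp_dflux_def
proof (rule has_vector_derivative_sum)
  fix j
  show "((\<lambda>t. hyp_coeff i j (y + t *\<^sub>R axis i 1) *\<^sub>R partial j u (y + t *\<^sub>R axis i 1)) has_vector_derivative
      hyp_coeff i j y *\<^sub>R partial i (partial j u) y + hyp_dcoeff i j y *\<^sub>R partial j u y) (at 0)"
    using has_vector_derivative_scaleR[OF line_hyp_coeff[OF assms(2)]
        line_differentiable[OF smooth_differentiable[OF smooth_partial[OF assms(1)]]]]
    by simp
qed

lemma hyp_laplacian_eq:
  assumes "smooth u" "y \<noteq> 0"
  shows "(stretch 1 (norm y))\<^sup>2 *\<^sub>R hyp_laplacian 1 u y = (\<Sum>i\<in>UNIV. hyp_dflux u i y)"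
proof -
  have "partial i (hyp_flux u i) y = hyp_dflux u i y" for i
    unfolding partial_def by (rule vector_derivative_at line_flux[OF assms])+
  moreover have "(\<lambda>y. \<Sum>j\<in>UNIV. (sqrt (det (hyp_metric 1 y)) * matrix_inv (hyp_metric 1 y) $ i $ j) *\<^sub>R partial j u y)
      = hyp_flux u i" for i
    unfolding hyp_coeff_eq by (simp add: hyp_flux_def fun_eq_iff)
  ultimately show ?thesis
    using stretch_pos[of "norm y"] by (simp add: laplace_beltrami_def sqrt_det_hyp_metric)
qed

text \<open>The field \<open>G A \<nabla>u - u A \<nabla>G\<close> of Green's identity, with \<open>G\<close> the regularized kernel.\<close>

definition green_field :: "complex \<Rightarrow> complex \<Rightarrow> real^3 \<Rightarrow> (real^3 \<Rightarrow> complex) \<Rightarrow> 3 \<Rightarrow> real^3 \<Rightarrow> complex"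
  where "green_field \<mu> \<nu> x u i y = hyp_green \<mu> \<nu> x y * hyp_flux u i y
    - u y * (hyp_B x i y *\<^sub>R hyp_green' \<mu> \<nu> x y)"

definition green_dfield :: "complex \<Rightarrow> complex \<Rightarrow> real^3 \<Rightarrow> (real^3 \<Rightarrow> complex) \<Rightarrow> 3 \<Rightarrow> real^3 \<Rightarrow> complex"
  where "green_dfield \<mu> \<nu> x u i y =
    hyp_green \<mu> \<nu> x y * hyp_dflux u i y + (hyp_dq x i y *\<^sub>R hyp_green' \<mu> \<nu> x y) * hyp_flux u i y
    - (u y * (hyp_B x i y *\<^sub>R (hyp_dq x i y *\<^sub>R hyp_green'' \<mu> \<nu> x y) + hyp_dB x i y *\<^sub>R hyp_green' \<mu> \<nu> x y)
      + partial i u y * (hyp_B x i y *\<^sub>R hyp_green' \<mu> \<nu> x y))"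

lemma line_green_field:
  assumes "smooth u" "y \<noteq> 0" "y \<noteq> x"
  shows "((\<lambda>t. green_field \<mu> \<nu> x u i (y + t *\<^sub>R axis i 1)) has_vector_derivative green_dfield \<mu> \<nu> x u i y) (at 0)"
proof -
  note * = has_vector_derivative_diff[OF
      has_vector_derivative_mult[OF line_green[OF assms(2,3)] line_flux[OF assms(1,2)]]
      has_vector_derivative_mult[OF line_differentiable[OF smooth_differentiable[OF assms(1)]]
        has_vector_derivative_scaleR[OF line_hyp_B[OF assms(2)] line_green'[OF assms(2,3)]]]]
  show ?thesis
    unfolding green_field_def green_dfield_def
    by (rule has_vector_derivative_eq_rhs[OF *]) simp
qed

text \<open>Symmetry of the coefficient matrix: the products of the gradients of \<open>u\<close>
  and of the kernel cancel in Green's identity.\<close>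

lemma sum_hyp_dq_hyp_flux:
  assumes y: "y \<noteq> 0"
  shows "(\<Sum>i\<in>UNIV. hyp_dq x i y *\<^sub>R hyp_flux u i y) = (\<Sum>j\<in>UNIV. hyp_B x j y *\<^sub>R partial j u y)"
proof -
  have B: "hyp_B x j y = (\<Sum>i\<in>UNIV. hyp_dq x i y * hyp_coeff i j y)" for j
    unfolding hyp_B_eq_hyp_dq[OF y] hyp_coeff_def
    by (simp add: distrib_left sum.distrib sum_distrib_left mult_ac if_distrib[of "\<lambda>x. _ * x"] cong: if_cong)
  have "(\<Sum>i\<in>UNIV. hyp_dq x i y *\<^sub>R hyp_flux u i y)
      = (\<Sum>i\<in>UNIV. \<Sum>j\<in>UNIV. (hyp_dq x i y * hyp_coeff i j y) *\<^sub>R partial j u y)"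
    by (simp add: hyp_flux_def scaleR_sum_right)
  also have "\<dots> = (\<Sum>j\<in>UNIV. \<Sum>i\<in>UNIV. (hyp_dq x i y * hyp_coeff i j y) *\<^sub>R partial j u y)"
    by (rule sum.swap)
  finally show ?thesis by (simp add: B scaleR_sum_left)
qed

text \<open>A function G of q has Laplacian (sinh d)^2 G'' + 3 cosh d G', and for G = E / sinh d
  this is (E'' - E) / sinh d. Adding (1 - \<mu>^2) G leaves (E'' - \<mu>^2 E) / sinh d, in which the
  \<mu>-exponential drops out of E = \<open>exp_diff\<close>.\<close>

lemma sum_green_dfield:
  assumes u: "smooth u" and y: "y \<noteq> 0" "y \<noteq> x"
  shows "(\<Sum>i\<in>UNIV. green_dfield \<mu> \<nu> x u i y) = (stretch 1 (norm y))\<^sup>2 *\<^sub>R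
    (hyp_green \<mu> \<nu> x y * (hyp_laplacian 1 u y + (1 - \<mu>\<^sup>2) * u y)
      + u y * ((1 / sinh_dist x y) *\<^sub>R ((\<nu>\<^sup>2 - \<mu>\<^sup>2) * exp (- (\<nu> * of_real (hyp_dist x y))))))"
proof -
  define r \<sigma> q where "r = sinh_dist x y" "\<sigma> = stretch 1 (norm y)" "q = cosh_dist x y"
  have r: "0 < r" using sinh_dist_pos[OF y] by (simp add: r_\<sigma>_q_def)
  define E N E'' where "E = exp_diff \<mu> \<nu> (hyp_dist x y)" "N = exp_diff_num \<mu> \<nu> (hyp_dist x y)" "E'' = exp_diff'' \<mu> \<nu> (hyp_dist x y)"
  define G G' G'' where "G = hyp_green \<mu> \<nu> x y" "G' = hyp_green' \<mu> \<nu> x y" "G'' = hyp_green'' \<mu> \<nu> x y"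
  have "(\<Sum>i\<in>UNIV. green_dfield \<mu> \<nu> x u i y) =
      G * (\<Sum>i\<in>UNIV. hyp_dflux u i y) + G' * (\<Sum>i\<in>UNIV. hyp_dq x i y *\<^sub>R hyp_flux u i y)
      - (u y * ((\<Sum>i\<in>UNIV. hyp_dq x i y * hyp_B x i y) *\<^sub>R G'' + (\<Sum>i\<in>UNIV. hyp_dB x i y) *\<^sub>R G')
        + G' * (\<Sum>i\<in>UNIV. hyp_B x i y *\<^sub>R partial i u y))"
    unfolding green_dfield_def G_G'_G''_def[symmetric] scaleR_sum_left sum_distrib_left sum.distrib[symmetric] sum_subtractf[symmetric]
    by (intro sum.cong refl) (simp add: mult_ac)
  also have "\<dots> = G * (\<sigma>\<^sup>2 *\<^sub>R hyp_laplacian 1 u y) - u y * ((\<sigma>\<^sup>2 * r\<^sup>2) *\<^sub>R G'' + (3 * \<sigma>\<^sup>2 * q) *\<^sub>R G')"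
    unfolding sum_hyp_dq_hyp_flux[OF y(1)] sum_hyp_dq_hyp_B[OF y(1)] sum_hyp_dB[OF y(1)] hyp_laplacian_eq[OF u y(1), symmetric]
      r_\<sigma>_q_def[symmetric] by simp
  also have "(\<sigma>\<^sup>2 * r\<^sup>2) *\<^sub>R G'' + (3 * \<sigma>\<^sup>2 * q) *\<^sub>R G' = \<sigma>\<^sup>2 *\<^sub>R ((1 / r) *\<^sub>R (E'' - E))"
  proof -
    have "G'' = (1 / r ^ 3) *\<^sub>R (E'' - E) - (3 * q / r ^ 5) *\<^sub>R N" "G' = (1 / r ^ 3) *\<^sub>R N"
      by (simp_all add: G_G'_G''_def hyp_green''_def hyp_green'_def r_\<sigma>_q_def E_N_E''_def)
    moreover have "\<sigma>\<^sup>2 * r\<^sup>2 * (1 / r ^ 3) = \<sigma>\<^sup>2 * (1 / r)" "\<sigma>\<^sup>2 * r\<^sup>2 * (3 * q / r ^ 5) = 3 * \<sigma>\<^sup>2 * q * (1 / r ^ 3)"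
      using r by (simp_all add: field_simps eval_nat_numeral)
    ultimately show ?thesis by (simp only: scaleR_diff_right scaleR_scaleR) simp
  qed
  also have "G * (\<sigma>\<^sup>2 *\<^sub>R hyp_laplacian 1 u y) - u y * (\<sigma>\<^sup>2 *\<^sub>R ((1 / r) *\<^sub>R (E'' - E)))
    = \<sigma>\<^sup>2 *\<^sub>R (G * (hyp_laplacian 1 u y + (1 - \<mu>\<^sup>2) * u y) - u y * ((1 - \<mu>\<^sup>2) * G + (1 / r) *\<^sub>R (E'' - E)))"
    by (simp add: algebra_simps)
  also have "(1 - \<mu>\<^sup>2) * G + (1 / r) *\<^sub>R (E'' - E) = (1 / r) *\<^sub>R (E'' - \<mu>\<^sup>2 * E)"
    by (simp add: G_G'_G''_def hyp_green_def r_\<sigma>_q_def E_N_E''_def algebra_simps)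
  also have "E'' - \<mu>\<^sup>2 * E = - ((\<nu>\<^sup>2 - \<mu>\<^sup>2) * exp (- (\<nu> * of_real (hyp_dist x y))))"
    by (simp add: E_N_E''_def exp_diff_def exp_diff''_def algebra_simps)
  finally show ?thesis
    by (simp add: G_G'_G''_def r_\<sigma>_q_def)
qed

section \<open>Local bounds\<close>

text \<open>Boundedness without a named constant, closed under the algebraic operations, so that
  long expressions are handled term by term.\<close>

definition bdd_on :: "'a set \<Rightarrow> ('a \<Rightarrow> 'b::real_normed_vector) \<Rightarrow> bool"
  where "bdd_on S f \<longleftrightarrow> (\<exists>c. \<forall>y\<in>S. norm (f y) \<le> c)"

lemma bdd_onI: "(\<And>y. y \<in> S \<Longrightarrow> norm (f y) \<le> c) \<Longrightarrow> bdd_on S f"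
  unfolding bdd_on_def by blast

lemma bdd_on_pos:
  assumes "bdd_on S f" obtains c where "0 < c" "\<And>y. y \<in> S \<Longrightarrow> norm (f y) \<le> c"
proof -
  from assms obtain c where "\<And>y. y \<in> S \<Longrightarrow> norm (f y) \<le> c" unfolding bdd_on_def by blast
  then show ?thesis using that[of "max 1 c"] by (simp add: le_max_iff_disj)
qed

lemma bdd_on_mono: "bdd_on S g \<Longrightarrow> (\<And>y. y \<in> S \<Longrightarrow> norm (f y) \<le> norm (g y)) \<Longrightarrow> bdd_on S f"
  unfolding bdd_on_def by (meson order_trans)

lemma bdd_on_const: "bdd_on S (\<lambda>_. c)"
  by (rule bdd_onI[of _ _ "norm c"]) simp

lemma bdd_on_add: "bdd_on S f \<Longrightarrow> bdd_on S g \<Longrightarrow> bdd_on S (\<lambda>y. f y + g y)"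
  unfolding bdd_on_def by (meson add_mono norm_triangle_le)

lemma bdd_on_minus: "bdd_on S f \<Longrightarrow> bdd_on S (\<lambda>y. - f y)"
  unfolding bdd_on_def by simp

lemma bdd_on_diff: "bdd_on S f \<Longrightarrow> bdd_on S g \<Longrightarrow> bdd_on S (\<lambda>y. f y - g y)"
  using bdd_on_add[of S f "\<lambda>y. - g y"] bdd_on_minus[of S g] by simp

lemma bdd_on_scaleR:
  assumes "bdd_on S f" "bdd_on S g" shows "bdd_on S (\<lambda>y. f y *\<^sub>R g y)"
proof -
  obtain a where a: "0 < a" "\<And>y. y \<in> S \<Longrightarrow> norm (f y) \<le> a" using bdd_on_pos[OF assms(1)] by blast
  obtain b where b: "0 < b" "\<And>y. y \<in> S \<Longrightarrow> norm (g y) \<le> b" using bdd_on_pos[OF assms(2)] by blast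
  show ?thesis
    using a b by (intro bdd_onI[of _ _ "a * b"]) (auto intro!: mult_mono)
qed

lemma bdd_on_mult:
  fixes f g :: "'a \<Rightarrow> 'b::real_normed_algebra"
  assumes "bdd_on S f" "bdd_on S g" shows "bdd_on S (\<lambda>y. f y * g y)"
proof -
  obtain a where a: "0 < a" "\<And>y. y \<in> S \<Longrightarrow> norm (f y) \<le> a" using bdd_on_pos[OF assms(1)] by blast
  obtain b where b: "0 < b" "\<And>y. y \<in> S \<Longrightarrow> norm (g y) \<le> b" using bdd_on_pos[OF assms(2)] by blast
  show ?thesis
    using a b by (intro bdd_onI[of _ _ "a * b"]) (auto intro!: order_trans[OF norm_mult_ineq] mult_mono)
qed

lemma bdd_on_power: "bdd_on S f \<Longrightarrow> bdd_on S (\<lambda>y. f y ^ n :: 'b::real_normed_algebra_1)"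
  by (induction n) (auto intro: bdd_on_const bdd_on_mult)

lemma bdd_on_sum: "(\<And>i. i \<in> I \<Longrightarrow> bdd_on S (f i)) \<Longrightarrow> bdd_on S (\<lambda>y. \<Sum>i\<in>I. f i y)"
  by (induction I rule: infinite_finite_induct) (auto intro: bdd_on_const bdd_on_add)

lemma bdd_on_continuous:
  fixes f :: "'a::heine_borel \<Rightarrow> 'b::real_normed_vector"
  assumes "bounded S" "continuous_on (closure S) f" shows "bdd_on S f"
proof -
  have "bounded (f ` closure S)"
    using assms by (intro compact_imp_bounded compact_continuous_image) auto
  then show ?thesis
    unfolding bdd_on_def bounded_iff using closure_subset by blast
qed

lemmas bdd_on_intros = bdd_on_const bdd_on_add bdd_on_diff bdd_on_minus bdd_on_scaleR bdd_on_mult bdd_on_power bdd_on_sum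

lemma bdd_on_cong: "bdd_on S g \<Longrightarrow> (\<And>y. y \<in> S \<Longrightarrow> f y = g y) \<Longrightarrow> bdd_on S f"
  unfolding bdd_on_def by simp

lemma sinh_ge_self: "0 \<le> r \<Longrightarrow> r \<le> sinh r" for r :: real
proof -
  assume "0 \<le> r"
  moreover have "\<exists>y. ((\<lambda>r. sinh r - r) has_real_derivative y) (at x) \<and> 0 \<le> y" if "0 \<le> x" for x :: real
    using that cosh_real_ge_1[of x] by (intro exI[of _ "cosh x - 1"]) (auto intro!: derivative_eq_intros)
  ultimately show ?thesis
    using DERIV_nonneg_imp_nondecreasing[of 0 r "\<lambda>r. sinh r - r"] by force
qed

lemma cube_mult_diff: "r \<noteq> 0 \<Longrightarrow> r ^ 3 * (A / r\<^sup>2 - 2 * B / r ^ 3) = A * r - 2 * B" for r :: real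
  by (simp add: field_simps eval_nat_numeral)

lemma sinh_le_mult_cosh:
  fixes r :: real assumes "0 \<le> r" shows "sinh r \<le> r * cosh r"
proof -
  have "\<exists>y. ((\<lambda>r. r * cosh r - sinh r) has_real_derivative y) (at x) \<and> 0 \<le> y" if "0 \<le> x" for x :: real
    using that by (intro exI[of _ "x * sinh x"]) (auto intro!: derivative_eq_intros)
  then show ?thesis
    using DERIV_nonneg_imp_nondecreasing[of 0 r "\<lambda>r. r * cosh r - sinh r"] assms by force
qed

lemma stretch_ge_1: "0 \<le> r \<Longrightarrow> 1 \<le> stretch 1 r"
  using sinh_ge_self[of r] by (cases "r = 0") (simp_all add: stretch_def)

lemma stretch_le_cosh: "0 \<le> r \<Longrightarrow> stretch 1 r \<le> cosh r"
  using sinh_le_mult_cosh[of r] by (cases "r = 0") (simp_all add: stretch_def field_simps)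

lemma arsinh_le_self: "0 \<le> r \<Longrightarrow> arsinh r \<le> r" for r :: real
  using sinh_ge_self[of "arsinh r"] by (simp add: arsinh_nonneg)

text \<open>The matrix \<open>hyp_coeff\<close> is at least the identity, since the stretching is at
  least 1. So the Euclidean length of the gradient of q is at most the root of the quadratic form
  computed in \<open>sum_hyp_dq_hyp_B\<close>.\<close>

lemma abs_hyp_dq_le:
  assumes y: "y \<noteq> 0"
  shows "\<bar>hyp_dq x i y\<bar> \<le> stretch 1 (norm y) * sinh_dist x y"
proof -
  have t: "0 \<le> radial_coeff (norm y)"
    using stretch_ge_1[of "norm y"] by (simp add: radial_coeff_def)
  have "(hyp_dq x i y)\<^sup>2 \<le> (\<Sum>i\<in>UNIV. (hyp_dq x i y)\<^sup>2)"
    by (rule member_le_sum) auto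
  also have "\<dots> \<le> (\<Sum>i\<in>UNIV. (hyp_dq x i y)\<^sup>2) + radial_coeff (norm y) * (\<Sum>i\<in>UNIV. y$i * hyp_dq x i y)\<^sup>2"
    using t by simp
  also have "\<dots> = (\<Sum>i\<in>UNIV. hyp_dq x i y * hyp_B x i y)"
    unfolding hyp_B_eq_hyp_dq[OF y] by (simp add: sum.distrib distrib_left power2_eq_square sum_distrib_left sum_distrib_right mult_ac)
  also have "\<dots> = (stretch 1 (norm y) * sinh_dist x y)\<^sup>2"
    by (simp add: sum_hyp_dq_hyp_B[OF y] power_mult_distrib)
  finally show ?thesis
    using stretch_pos[of "norm y"] by (simp add: abs_le_square_iff[symmetric] abs_mult)
qed

text \<open>The bound that is uniform in \<mu> and \<nu> and survives in the final estimate;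
  \<open>near_green\<close> removes the singularity but depends on both.\<close>

lemma norm_hyp_green_le:
  assumes "0 \<le> Re \<mu>" "0 \<le> Re \<nu>"
  shows "norm (hyp_green \<mu> \<nu> x y) \<le> 2 * (1 / sinh_dist x y)"
  unfolding hyp_green_def using norm_exp_diff_le_2[OF assms hyp_dist_nonneg]
  by (auto simp: intro!: divide_right_mono)

context
  fixes x :: "real^3" and R :: real and S :: "(real^3) set"
  assumes S: "S = {y. y \<noteq> 0 \<and> y \<noteq> x \<and> norm y \<le> R}"
begin

text \<open>
  The derivatives of \<open>green_field\<close> are only bounded by a multiple of
  \<open>1 + 1 / |y|\<^sup>2 + 1 / (sinh d)\<^sup>2\<close>: the coordinates are not shown to be smooth at \<open>0\<close>, and \<open>G\<close> is not
  smooth at the pole. This is locally integrable in dimension three.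
\<close>

lemma near_bounded: "bounded S"
  unfolding bounded_iff S by blast

lemma near_continuous: "continuous_on UNIV f \<Longrightarrow> bdd_on S f" for f :: "_ \<Rightarrow> 'b::real_normed_vector"
  by (intro bdd_on_continuous near_bounded) (auto intro: continuous_on_subset)

lemma near_norm: "bdd_on S norm" and near_cosh: "bdd_on S (\<lambda>y. cosh (norm y))"
  and near_nth: "bdd_on S (\<lambda>y. y$i)" and near_inner: "bdd_on S (\<lambda>y. V \<bullet> y)"
  by (intro near_continuous continuous_intros)+

lemma near_stretch: "bdd_on S (\<lambda>y. stretch 1 (norm y))"
  using stretch_pos stretch_le_cosh by (intro bdd_on_mono[OF near_cosh]) (simp add: abs_of_pos)

lemma near_nonzero: "y \<in> S \<Longrightarrow> norm y \<noteq> 0" "y \<in> S \<Longrightarrow> y \<noteq> 0" "y \<in> S \<Longrightarrow> 0 < sinh_dist x y"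
  using sinh_dist_pos by (auto simp: S)

lemma near_dir: "bdd_on S (\<lambda>y. y$i / norm y)" and near_inner_dir: "bdd_on S (\<lambda>y. V \<bullet> y / norm y)"
proof -
  show "bdd_on S (\<lambda>y. y$i / norm y)"
    by (rule bdd_onI[of _ _ 1]) (use component_le_norm_cart near_nonzero in \<open>auto simp: divide_le_eq\<close>)
  show "bdd_on S (\<lambda>y. V \<bullet> y / norm y)"
    by (rule bdd_onI[of _ _ "norm V"]) (use Cauchy_Schwarz_ineq2 near_nonzero in \<open>auto simp: divide_le_eq\<close>)
qed

text \<open>Here and below, powers of \<open>norm y\<close> clear the denominators of the
  definitions and leave combinations of quantities already known to be bounded. No expansion at the
  origin is required.\<close>

lemma near_stretch': "bdd_on S (\<lambda>y. norm y * stretch' (norm y))"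
  by (rule bdd_on_cong[of _ "\<lambda>y. cosh (norm y) - stretch 1 (norm y)"],
      intro near_cosh near_stretch bdd_on_intros, use near_nonzero in \<open>simp add: stretch'_def\<close>)

lemma near_radial: "bdd_on S (\<lambda>y. (norm y)\<^sup>2 * radial_coeff (norm y))"
  by (rule bdd_on_cong[of _ "\<lambda>y. (stretch 1 (norm y))\<^sup>2 - 1"],
      intro near_stretch bdd_on_intros, use near_nonzero in \<open>simp add: radial_coeff_def\<close>)

lemma near_radial': "bdd_on S (\<lambda>y. norm y ^ 3 * radial_coeff' (norm y))"
proof (rule bdd_on_cong)
  show "bdd_on S (\<lambda>y. 2 * stretch 1 (norm y) * (norm y * stretch' (norm y)) - 2 * ((stretch 1 (norm y))\<^sup>2 - 1))"
    by (intro near_stretch near_stretch' bdd_on_intros)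
  fix y assume "y \<in> S"
  note nz = near_nonzero(1)[OF this]
  show "norm y ^ 3 * radial_coeff' (norm y) = 2 * stretch 1 (norm y) * (norm y * stretch' (norm y)) - 2 * ((stretch 1 (norm y))\<^sup>2 - 1)"
    unfolding radial_coeff'_def cube_mult_diff[OF nz] by (simp add: mult_ac)
qed

lemma near_radial2: "bdd_on S (\<lambda>y. (norm y)\<^sup>2 * radial_coeff2 (norm y))"
  by (rule bdd_on_cong[of _ "\<lambda>y. stretch 1 (norm y) - (stretch 1 (norm y))\<^sup>2 * cosh (norm y)"],
      intro near_stretch near_cosh bdd_on_intros, use near_nonzero in \<open>simp add: radial_coeff2_def\<close>)

lemma near_radial2': "bdd_on S (\<lambda>y. norm y ^ 3 * radial_coeff2' (norm y))"
proof (rule bdd_on_cong)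
  show "bdd_on S (\<lambda>y. norm y * stretch' (norm y) - 2 * stretch 1 (norm y) * (norm y * stretch' (norm y)) * cosh (norm y)
      - stretch 1 (norm y) ^ 3 * (norm y)\<^sup>2 - 2 * (stretch 1 (norm y) - (stretch 1 (norm y))\<^sup>2 * cosh (norm y)))"
    by (intro near_stretch near_cosh near_stretch' near_norm bdd_on_intros)
  fix y assume "y \<in> S"
  note nz = near_nonzero(1)[OF this]
  show "norm y ^ 3 * radial_coeff2' (norm y) = norm y * stretch' (norm y) - 2 * stretch 1 (norm y) * (norm y * stretch' (norm y)) * cosh (norm y)
      - stretch 1 (norm y) ^ 3 * (norm y)\<^sup>2 - 2 * (stretch 1 (norm y) - (stretch 1 (norm y))\<^sup>2 * cosh (norm y))"
    unfolding radial_coeff2'_def cube_mult_diff[OF nz] by (simp add: algebra_simps power2_eq_square)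
qed

lemma near_coeff: "bdd_on S (hyp_coeff i j)"
  by (rule bdd_on_cong[of _ "\<lambda>y. (if i = j then 1 else 0) + ((norm y)\<^sup>2 * radial_coeff (norm y)) * (y$i / norm y) * (y$j / norm y)"],
      intro near_radial near_dir bdd_on_intros, use near_nonzero in \<open>simp add: hyp_coeff_def power2_eq_square\<close>)

lemma near_dcoeff: "bdd_on S (\<lambda>y. norm y * hyp_dcoeff i j y)"
  by (rule bdd_on_cong[of _ "\<lambda>y. (norm y ^ 3 * radial_coeff' (norm y)) * (y$i / norm y) * (y$i / norm y) * (y$j / norm y)
      + ((norm y)\<^sup>2 * radial_coeff (norm y)) * (y$j / norm y + (if i = j then 1 else 0) * (y$i / norm y))"],
      intro near_radial near_radial' near_dir bdd_on_intros, use near_nonzero in \<open>simp add: hyp_dcoeff_def distrib_left distrib_right power2_eq_square power3_eq_cube\<close>)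

lemma near_dB: "bdd_on S (\<lambda>y. norm y * hyp_dB x i y)"
proof (rule bdd_on_cong)
  show "bdd_on S (\<lambda>y. 3 * cosh (norm x) * (stretch 1 (norm y))\<^sup>2 * (norm y * stretch' (norm y)) * (y$i / norm y) * y$i
    + (norm y ^ 3 * radial_coeff2' (norm y)) * (y$i / norm y) * (hyp_embed x \<bullet> y / norm y) * (y$i / norm y)
    + ((norm y)\<^sup>2 * radial_coeff2 (norm y)) * hyp_embed x $ i * (y$i / norm y)
    + norm y * cosh (norm x) * stretch 1 (norm y) ^ 3
    + ((norm y)\<^sup>2 * radial_coeff2 (norm y)) * (hyp_embed x \<bullet> y / norm y)
    - (norm y * stretch' (norm y)) * (y$i / norm y) * hyp_embed x $ i)"
    by (intro near_stretch near_stretch' near_radial2 near_radial2' near_norm near_dir near_inner_dir near_nth bdd_on_intros)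
  fix y assume "y \<in> S"
  from near_nonzero(1)[OF this]
  show "norm y * hyp_dB x i y = 3 * cosh (norm x) * (stretch 1 (norm y))\<^sup>2 * (norm y * stretch' (norm y)) * (y$i / norm y) * y$i
    + (norm y ^ 3 * radial_coeff2' (norm y)) * (y$i / norm y) * (hyp_embed x \<bullet> y / norm y) * (y$i / norm y)
    + ((norm y)\<^sup>2 * radial_coeff2 (norm y)) * hyp_embed x $ i * (y$i / norm y)
    + norm y * cosh (norm x) * stretch 1 (norm y) ^ 3
    + ((norm y)\<^sup>2 * radial_coeff2 (norm y)) * (hyp_embed x \<bullet> y / norm y)
    - (norm y * stretch' (norm y)) * (y$i / norm y) * hyp_embed x $ i"
    unfolding hyp_dB_def Let_def by (simp add: distrib_left distrib_right right_diff_distrib power2_eq_square power3_eq_cube)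
qed

lemma near_cosh_dist: "bdd_on S (cosh_dist x)"
  by (rule bdd_on_cong[of _ "\<lambda>y. cosh (norm x) * cosh (norm y) - stretch 1 (norm y) * (hyp_embed x \<bullet> y)"])
    (auto intro!: bdd_on_intros near_cosh near_stretch near_inner simp: cosh_dist_def hyp_embed_def[of y for y])

lemma near_dq: "bdd_on S (\<lambda>y. hyp_dq x i y / sinh_dist x y)"
  by (rule bdd_on_mono[OF near_stretch])
    (use abs_hyp_dq_le near_nonzero stretch_pos in \<open>auto simp: divide_le_eq abs_of_pos\<close>)

text \<open>Each term of A \<nabla>q contains a component of the gradient of q, so it inherits the
  first-order zero at the pole.\<close>

lemma near_B: "bdd_on S (\<lambda>y. hyp_B x i y / sinh_dist x y)"
  by (rule bdd_on_cong[of _ "\<lambda>y. hyp_dq x i y / sinh_dist x y + ((norm y)\<^sup>2 * radial_coeff (norm y)) * (y$i / norm y) *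
      (\<Sum>j\<in>UNIV. (y$j / norm y) * (hyp_dq x j y / sinh_dist x y))"],
      intro near_dq near_radial near_dir bdd_on_intros, use near_nonzero in \<open>simp add: hyp_B_eq_hyp_dq add_divide_distrib power2_eq_square sum_divide_distrib[symmetric]\<close>)

context
  fixes \<mu> \<nu> :: complex
  assumes \<mu>: "0 \<le> Re \<mu>" and \<nu>: "0 \<le> Re \<nu>"
begin

lemma near_green: "bdd_on S (hyp_green \<mu> \<nu> x)"
proof (rule bdd_onI)
  fix y assume "y \<in> S"
  from near_nonzero(3)[OF this] have r: "0 < sinh_dist x y" .
  have "norm (exp_diff \<mu> \<nu> (hyp_dist x y)) \<le> (norm \<mu> + norm \<nu>) * hyp_dist x y"
    by (rule norm_exp_diff_le[OF \<mu> \<nu> hyp_dist_nonneg])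
  also have "\<dots> \<le> (norm \<mu> + norm \<nu>) * sinh_dist x y"
    by (intro mult_left_mono arsinh_le_self) auto
  finally show "norm (hyp_green \<mu> \<nu> x y) \<le> norm \<mu> + norm \<nu>"
    using r by (simp add: hyp_green_def divide_le_eq)
qed

lemma near_green_num: "bdd_on S (\<lambda>y. (1 / (sinh_dist x y)\<^sup>2) *\<^sub>R exp_diff_num \<mu> \<nu> (hyp_dist x y))"
proof (rule bdd_onI)
  fix y assume "y \<in> S"
  from near_nonzero(3)[OF this] have r: "0 < sinh_dist x y" .
  then show "norm ((1 / (sinh_dist x y)\<^sup>2) *\<^sub>R exp_diff_num \<mu> \<nu> (hyp_dist x y)) \<le> ((norm \<mu>)\<^sup>2 + (norm \<nu>)\<^sup>2 + 2) / 2"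
    using norm_exp_diff_num_le[OF \<mu> \<nu> hyp_dist_nonneg[of x y]] by (simp add: divide_le_eq mult_ac)
qed

lemma near_green': "bdd_on S (\<lambda>y. sinh_dist x y *\<^sub>R hyp_green' \<mu> \<nu> x y)"
  by (rule bdd_on_cong[OF near_green_num]) (use near_nonzero in \<open>auto simp: hyp_green'_def power2_eq_square power3_eq_cube\<close>)

lemma near_green'': "bdd_on S (\<lambda>y. sinh_dist x y ^ 3 *\<^sub>R hyp_green'' \<mu> \<nu> x y)"
proof (rule bdd_on_cong)
  have "bdd_on S (\<lambda>y. exp_diff'' \<mu> \<nu> (hyp_dist x y) - exp_diff \<mu> \<nu> (hyp_dist x y))"
    by (rule bdd_onI) (rule norm_exp_diff''_le[OF \<mu> \<nu> hyp_dist_nonneg])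
  then show "bdd_on S (\<lambda>y. (exp_diff'' \<mu> \<nu> (hyp_dist x y) - exp_diff \<mu> \<nu> (hyp_dist x y))
      - (3 * cosh_dist x y) *\<^sub>R ((1 / (sinh_dist x y)\<^sup>2) *\<^sub>R exp_diff_num \<mu> \<nu> (hyp_dist x y)))"
    by (rule bdd_on_diff[OF _ bdd_on_scaleR[OF bdd_on_mult[OF bdd_on_const near_cosh_dist] near_green_num]])
  fix y assume "y \<in> S"
  from near_nonzero(3)[OF this]
  show "sinh_dist x y ^ 3 *\<^sub>R hyp_green'' \<mu> \<nu> x y = (exp_diff'' \<mu> \<nu> (hyp_dist x y) - exp_diff \<mu> \<nu> (hyp_dist x y))
      - (3 * cosh_dist x y) *\<^sub>R ((1 / (sinh_dist x y)\<^sup>2) *\<^sub>R exp_diff_num \<mu> \<nu> (hyp_dist x y))"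
    by (simp add: hyp_green''_def scaleR_diff_right eval_nat_numeral)
qed

context
  fixes u :: "real^3 \<Rightarrow> complex"
  assumes u: "smooth u"
begin

lemma near_u: "bdd_on S u" "bdd_on S (partial j u)" "bdd_on S (partial i (partial j u))"
  by (intro near_continuous smooth_continuous smooth_partial u)+

lemma near_flux: "bdd_on S (hyp_flux u i)"
  unfolding hyp_flux_def[abs_def] by (intro near_coeff near_u bdd_on_intros)

lemma near_dflux: "bdd_on S (\<lambda>y. norm y *\<^sub>R hyp_dflux u i y)"
proof -
  have "bdd_on S (\<lambda>y. \<Sum>j\<in>UNIV. (norm y * hyp_coeff i j y) *\<^sub>R partial i (partial j u) y + (norm y * hyp_dcoeff i j y) *\<^sub>R partial j u y)"
    by (intro near_coeff near_dcoeff near_u near_norm bdd_on_intros)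
  then show ?thesis by (simp add: hyp_dflux_def scaleR_sum_right scaleR_add_right)
qed

lemma near_field: "bdd_on S (green_field \<mu> \<nu> x u i)"
  by (rule bdd_on_cong[of _ "\<lambda>y. hyp_green \<mu> \<nu> x y * hyp_flux u i y
      - u y * ((hyp_B x i y / sinh_dist x y) *\<^sub>R (sinh_dist x y *\<^sub>R hyp_green' \<mu> \<nu> x y))"],
      intro near_green near_flux near_B near_green' near_u bdd_on_intros, use near_nonzero in \<open>force simp: green_field_def\<close>)

lemma near_dfield:
  obtains c where "0 < c" "\<And>y. y \<in> S \<Longrightarrow> norm (green_dfield \<mu> \<nu> x u i y) \<le> c * (1 + 1 / (norm y)\<^sup>2 + 1 / (sinh_dist x y)\<^sup>2)"
proof -
  define g' where "g' y = sinh_dist x y *\<^sub>R hyp_green' \<mu> \<nu> x y" for y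
  define g'' where "g'' y = sinh_dist x y ^ 3 *\<^sub>R hyp_green'' \<mu> \<nu> x y" for y
  define b where "b y = hyp_B x i y / sinh_dist x y" for y
  define d where "d y = hyp_dq x i y / sinh_dist x y" for y
  \<comment> \<open>The terms are sorted by their singular factor: none for \<open>X1\<close>, 1 /
    |y| for \<open>X2\<close>, 1 / sinh d for \<open>X3\<close>, and the product of both for
    \<open>X4\<close>.\<close>
  define X1 where "X1 y = (d y *\<^sub>R g' y) * hyp_flux u i y - partial i u y * (b y *\<^sub>R g' y)" for y
  define X2 where "X2 y = hyp_green \<mu> \<nu> x y * (norm y *\<^sub>R hyp_dflux u i y)" for y
  define X3 where "X3 y = u y * (b y *\<^sub>R (d y *\<^sub>R g'' y))" for y
  define X4 where "X4 y = u y * ((norm y * hyp_dB x i y) *\<^sub>R g' y)" for y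
  have "bdd_on S X1" "bdd_on S X2" "bdd_on S X3" "bdd_on S X4"
    unfolding X1_def X2_def X3_def X4_def g'_def g''_def b_def d_def
    by (intro near_green near_flux near_dflux near_B near_dq near_dB near_green' near_green'' near_u bdd_on_intros)+
  then obtain c1 c2 c3 c4 where c: "0 < c1" "0 < c2" "0 < c3" "0 < c4"
    "\<And>y. y \<in> S \<Longrightarrow> norm (X1 y) \<le> c1" "\<And>y. y \<in> S \<Longrightarrow> norm (X2 y) \<le> c2"
    "\<And>y. y \<in> S \<Longrightarrow> norm (X3 y) \<le> c3" "\<And>y. y \<in> S \<Longrightarrow> norm (X4 y) \<le> c4"
    by (metis bdd_on_pos)
  define c where "c = c1 + c2 + c3 + c4"
  show ?thesis
  proof (rule that[of c])
    show "0 < c" using c by (simp add: c_def)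
    fix y assume y: "y \<in> S"
    define r \<rho> where "r = sinh_dist x y" "\<rho> = norm y"
    have r: "0 < r" "0 < \<rho>" using near_nonzero[OF y] by (simp_all add: r_\<rho>_def)
    have "green_dfield \<mu> \<nu> x u i y = X1 y + (1 / \<rho>) *\<^sub>R X2 y - (1 / r) *\<^sub>R X3 y - (1 / (\<rho> * r)) *\<^sub>R X4 y"
    proof -
      have "(1 / \<rho>) *\<^sub>R X2 y = hyp_green \<mu> \<nu> x y * hyp_dflux u i y"
        using r by (simp add: X2_def r_\<rho>_def)
      moreover have "X1 y = (hyp_dq x i y *\<^sub>R hyp_green' \<mu> \<nu> x y) * hyp_flux u i y - partial i u y * (hyp_B x i y *\<^sub>R hyp_green' \<mu> \<nu> x y)"
        using r by (simp add: X1_def d_def g'_def b_def r_\<rho>_def)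
      moreover have "(1 / r) *\<^sub>R X3 y = u y * (hyp_B x i y *\<^sub>R (hyp_dq x i y *\<^sub>R hyp_green'' \<mu> \<nu> x y))"
        using r by (simp add: X3_def d_def g''_def b_def r_\<rho>_def power3_eq_cube)
      moreover have "(1 / (\<rho> * r)) *\<^sub>R X4 y = u y * (hyp_dB x i y *\<^sub>R hyp_green' \<mu> \<nu> x y)"
        using r by (simp add: X4_def g'_def r_\<rho>_def)
      ultimately show ?thesis by (simp add: green_dfield_def distrib_left)
    qed
    also have "norm \<dots> \<le> norm (X1 y) + (1 / \<rho>) * norm (X2 y) + (1 / r) * norm (X3 y) + (1 / (\<rho> * r)) * norm (X4 y)"
      using r by (intro order_trans[OF norm_triangle_ineq4] add_mono order_trans[OF norm_triangle_ineq]) auto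
    also have "\<dots> \<le> c1 + (1 / \<rho>) * c2 + (1 / r) * c3 + (1 / (\<rho> * r)) * c4"
      using r c y by (intro add_mono mult_left_mono) auto
    also have "\<dots> \<le> (1 + 1 / \<rho>\<^sup>2 + 1 / r\<^sup>2) * c1 + (1 + 1 / \<rho>\<^sup>2 + 1 / r\<^sup>2) * c2 + (1 + 1 / \<rho>\<^sup>2 + 1 / r\<^sup>2) * c3 + (1 + 1 / \<rho>\<^sup>2 + 1 / r\<^sup>2) * c4"
    proof -
      \<comment> \<open>The product of the two singular factors is split into their squares, which
        can be integrated separately, also when the pole is the origin.\<close>
      have a: "t \<le> 1 + t\<^sup>2" "t * s \<le> t\<^sup>2 + s\<^sup>2" if "0 < t" "0 < s" for t s :: real
      proof -
        have "2 * (t * s) \<le> t\<^sup>2 + s\<^sup>2" using sum_squares_bound[of t s] by (simp add: mult.assoc)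
        then show "t * s \<le> t\<^sup>2 + s\<^sup>2" using mult_pos_pos[OF that] by linarith
        show "t \<le> 1 + t\<^sup>2" using that sum_squares_bound[of t 1] by simp
      qed
      have "1 / \<rho> \<le> 1 + 1 / \<rho>\<^sup>2" "1 / r \<le> 1 + 1 / r\<^sup>2" "1 / (\<rho> * r) \<le> 1 / \<rho>\<^sup>2 + 1 / r\<^sup>2"
        using a[of "1 / \<rho>" "1 / r"] a[of "1 / r" "1 / \<rho>"] r by (simp_all add: power_divide)
      moreover have "0 \<le> 1 / \<rho>\<^sup>2" "0 \<le> 1 / r\<^sup>2" by simp_all
      ultimately have "1 / \<rho> \<le> 1 + 1 / \<rho>\<^sup>2 + 1 / r\<^sup>2" "1 / r \<le> 1 + 1 / \<rho>\<^sup>2 + 1 / r\<^sup>2"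
        "1 / (\<rho> * r) \<le> 1 + 1 / \<rho>\<^sup>2 + 1 / r\<^sup>2" "1 \<le> 1 + 1 / \<rho>\<^sup>2 + 1 / r\<^sup>2"
        by linarith+
      then show ?thesis
        using c mult_right_mono[of 1 "1 + 1 / \<rho>\<^sup>2 + 1 / r\<^sup>2" c1] by (intro add_mono mult_right_mono) auto
    qed
    finally show "norm (green_dfield \<mu> \<nu> x u i y) \<le> c * (1 + 1 / (norm y)\<^sup>2 + 1 / (sinh_dist x y)\<^sup>2)"
      by (simp add: c_def r_\<rho>_def algebra_simps add_divide_distrib)
  qed
qed

end

end

end

section \<open>Integration by parts\<close>

lemma partial_eq_0:
  fixes f :: "real^'n \<Rightarrow> 'b::real_normed_vector"
  assumes "open U" "y \<in> U" "\<And>z. z \<in> U \<Longrightarrow> f z = 0"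
  shows "partial i f y = 0"
  unfolding partial_def
proof (rule vector_derivative_at)
  have "isCont (\<lambda>t. y + t *\<^sub>R axis i 1) (0::real)" by (intro continuous_intros)
  then have "\<forall>\<^sub>F t in at (0::real). y + t *\<^sub>R axis i 1 \<in> U"
    using assms(1,2) by (auto simp: continuous_at tendsto_def)
  then have "\<forall>\<^sub>F t in at (0::real). 0 = f (y + t *\<^sub>R axis i 1)"
    by eventually_elim (use assms(3) in auto)
  moreover have "((\<lambda>t. 0 :: 'b) has_vector_derivative 0) (at (0::real))" by simp
  ultimately show "((\<lambda>t. f (y + t *\<^sub>R axis i 1)) has_vector_derivative 0) (at 0)"
    unfolding has_vector_derivative_def
    by (elim has_derivative_transform_eventually) (use assms(2,3) in auto)
qed

lemma test_function_smooth: "u \<in> test_functions \<Longrightarrow> smooth u"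
  by (simp add: test_functions_def)

lemma test_function_support:
  assumes "u \<in> test_functions"
  shows "\<exists>R>0. \<forall>y. R < norm y \<longrightarrow> u y = 0 \<and> (\<forall>j. partial j u y = 0) \<and> (\<forall>i j. partial i (partial j u) y = 0)"
proof -
  have "bounded {x. u x \<noteq> 0}"
    using assms bounded_subset[OF compact_imp_bounded closure_subset] by (auto simp: test_functions_def)
  then obtain R where R: "0 < R" "\<And>y. u y \<noteq> 0 \<Longrightarrow> norm y \<le> R"
    by (auto simp: bounded_pos)
  have op: "open {y. R < norm y}" by (intro open_Collect_less continuous_intros)
  have u: "u y = 0" if "R < norm y" for y using R(2)[of y] that by force
  have u1: "partial j u y = 0" if "R < norm y" for j y
    using partial_eq_0[OF op, of y u j] that u by auto
  have u2: "partial i (partial j u) y = 0" if "R < norm y" for i j y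
    using partial_eq_0[OF op, of y "partial j u" i] that u1 by auto
  show ?thesis using R(1) u u1 u2 by blast
qed

section \<open>Measurability of the coefficients, the kernel and the Green field\<close>

lemma measurable_vec_nth [measurable]: "(\<lambda>y::real^'n. y $ i) \<in> borel_measurable borel"
  by (intro borel_measurable_continuous_onI continuous_intros)

lemma measurable_stretch' [measurable]: "stretch' \<in> borel_measurable borel"
  unfolding stretch'_def by measurable

lemma measurable_radial_coeffs [measurable]:
  "radial_coeff \<in> borel_measurable borel" "radial_coeff' \<in> borel_measurable borel"
  "radial_coeff2 \<in> borel_measurable borel" "radial_coeff2' \<in> borel_measurable borel"
  unfolding radial_coeff_def radial_coeff'_def radial_coeff2_def radial_coeff2'_def by measurable

lemma measurable_hyp_coeffs [measurable]:
  "hyp_coeff i j \<in> borel_measurable borel" "hyp_dcoeff i j \<in> borel_measurable borel"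
  "hyp_dq x i \<in> borel_measurable borel" "hyp_B x i \<in> borel_measurable borel" "hyp_dB x i \<in> borel_measurable borel"
  unfolding hyp_coeff_def hyp_dcoeff_def hyp_dq_def hyp_B_def hyp_dB_def Let_def by measurable

lemma measurable_cosh_dist_right [measurable]: "cosh_dist x \<in> borel_measurable borel"
  unfolding cosh_dist_def by measurable

lemma measurable_exp_diff [measurable]:
  "exp_diff \<mu> \<nu> \<in> borel_measurable borel" "exp_diff'' \<mu> \<nu> \<in> borel_measurable borel"
  "exp_diff_num \<mu> \<nu> \<in> borel_measurable borel"
  unfolding exp_diff_def[abs_def] exp_diff''_def[abs_def] exp_diff_num_def[abs_def] exp_diff'_def[abs_def]
  by (intro borel_measurable_continuous_onI continuous_intros)+

lemma measurable_hyp_green [measurable]: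
  "hyp_green \<mu> \<nu> x \<in> borel_measurable borel" "hyp_green' \<mu> \<nu> x \<in> borel_measurable borel"
  "hyp_green'' \<mu> \<nu> x \<in> borel_measurable borel"
  unfolding hyp_green_def hyp_green'_def hyp_green''_def by measurable

lemma measurable_hyp_flux:
  assumes "smooth u"
  shows "hyp_flux u i \<in> borel_measurable borel" "hyp_dflux u i \<in> borel_measurable borel"
proof -
  note [measurable] = smooth_measurable[OF smooth_partial[OF assms]]
    smooth_measurable[OF smooth_partial[OF smooth_partial[OF assms]]]
  show "hyp_flux u i \<in> borel_measurable borel" "hyp_dflux u i \<in> borel_measurable borel"
    unfolding hyp_flux_def hyp_dflux_def by measurable
qed

text \<open>The divergence formula is available off the origin; changing a measurable function at a
  single point keeps it measurable.\<close>

lemma measurable_hyp_laplacian: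
  assumes "smooth u" shows "hyp_laplacian 1 u \<in> borel_measurable borel"
proof -
  note [measurable] = measurable_hyp_flux[OF assms]
  have eq: "hyp_laplacian 1 u y = (if y = 0 then hyp_laplacian 1 u 0
      else (1 / (stretch 1 (norm y))\<^sup>2) *\<^sub>R (\<Sum>i\<in>UNIV. hyp_dflux u i y))" for y
    using hyp_laplacian_eq[OF assms, of y] stretch_pos[of "norm y"]
    by (auto simp flip: hyp_laplacian_eq[OF assms])
  have "(\<lambda>y. if y = 0 then hyp_laplacian 1 u 0
      else (1 / (stretch 1 (norm y))\<^sup>2) *\<^sub>R (\<Sum>i\<in>UNIV. hyp_dflux u i y)) \<in> borel_measurable borel"
    by measurable
  also have "(\<lambda>y. if y = 0 then hyp_laplacian 1 u 0
      else (1 / (stretch 1 (norm y))\<^sup>2) *\<^sub>R (\<Sum>i\<in>UNIV. hyp_dflux u i y)) = hyp_laplacian 1 u"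
    by (rule ext) (rule eq[symmetric])
  finally show ?thesis .
qed

lemma measurable_green_field:
  assumes "smooth u"
  shows "green_field \<mu> \<nu> x u i \<in> borel_measurable borel" "green_dfield \<mu> \<nu> x u i \<in> borel_measurable borel"
proof -
  note [measurable] = smooth_measurable[OF assms] smooth_measurable[OF smooth_partial[OF assms]] measurable_hyp_flux[OF assms]
  show "green_field \<mu> \<nu> x u i \<in> borel_measurable borel" "green_dfield \<mu> \<nu> x u i \<in> borel_measurable borel"
    unfolding green_field_def green_dfield_def by measurable
qed

section \<open>Local integrability of inverse squared distances\<close>

lemma cosh_dist_le: "cosh_dist x y \<le> cosh (norm x + norm y)"
proof -
  have "- (hyp_embed x \<bullet> hyp_embed y) \<le> sinh (norm x) * sinh (norm y)"
    using Cauchy_Schwarz_ineq2[of "hyp_embed x" "hyp_embed y"] by (simp add: norm_hyp_embed)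
  then show ?thesis by (simp add: cosh_dist_def cosh_add)
qed

lemma sinh_dist_le_cosh: "sinh_dist x y \<le> cosh (norm x + norm y)"
  by (rule order_trans[OF _ cosh_dist_le]) (simp add: cosh_dist_eq real_le_rsqrt)

lemma sinh_dist_0: "sinh_dist 0 y = sinh (norm y)"
proof -
  have h0: "hyp_embed 0 = 0" by (simp add: hyp_embed_def)
  show ?thesis unfolding sinh_dist_def boost_def h0 by (simp add: norm_hyp_embed)
qed

lemma nn_integral_inverse_square_local:
  "(\<integral>\<^sup>+ y. ennreal ((stretch 1 (norm y))\<^sup>2) * (ennreal (1 / (sinh_dist x y)\<^sup>2) * indicator (cball 0 R) y) \<partial>lborel) < \<infinity>"
proof -
  define L where "L = cosh (norm x + R)"
  have "(\<integral>\<^sup>+ y. ennreal ((stretch 1 (norm y))\<^sup>2) * (ennreal (1 / (sinh_dist x y)\<^sup>2) * indicator (cball 0 R) y) \<partial>lborel)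
    \<le> (\<integral>\<^sup>+ y. ennreal ((stretch 1 (norm y))\<^sup>2) * (ennreal (1 / (sinh_dist x y)\<^sup>2) * indicator {y. sinh_dist x y \<le> L} y) \<partial>lborel)"
  proof (intro nn_integral_mono mult_left_mono)
    fix y
    have "sinh_dist x y \<le> L" if "norm y \<le> R"
      using that sinh_dist_le_cosh[of x y] cosh_real_nonneg_le_iff[of "norm x + norm y" "norm x + R"]
        order_trans[OF norm_ge_zero that] unfolding L_def by (smt (verit) norm_ge_zero)
    then show "indicator (cball 0 R) y \<le> (indicator {y. sinh_dist x y \<le> L} y :: ennreal)"
      by (auto simp: indicator_def)
  qed auto
  also have "\<dots> = (\<integral>\<^sup>+ y. ennreal (1 / (sinh_dist x y)\<^sup>2) * indicator {y. sinh_dist x y \<le> L} y \<partial>hyp_volume 1)"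
    unfolding hyp_volume_eq by (rule nn_integral_density[symmetric]) measurable
  also have "\<dots> \<le> ennreal (4 * pi * L)"
    by (rule hyp_kernel_square_integrable) (simp add: L_def)
  finally show ?thesis by (rule le_less_trans) simp
qed

lemma integrable_inverse_squares_local:
  "integrable lborel (\<lambda>y. indicator (cball 0 R) y * (1 + 1 / (norm y)\<^sup>2 + 1 / (sinh_dist x y)\<^sup>2))"
proof -
  note [measurable] = borel_closed[OF closed_cball, of "0 :: real^3" R]
  have 1: "integrable lborel (\<lambda>y. indicator (cball 0 R) y * (1 / (sinh_dist x y)\<^sup>2))" for x
  proof (rule integrableI_bounded)
    have "(\<integral>\<^sup>+ y. ennreal (norm (indicator (cball 0 R) y * (1 / (sinh_dist x y)\<^sup>2))) \<partial>lborel)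
      \<le> (\<integral>\<^sup>+ y. ennreal ((stretch 1 (norm y))\<^sup>2) * (ennreal (1 / (sinh_dist x y)\<^sup>2) * indicator (cball 0 R) y) \<partial>lborel)"
    proof (rule nn_integral_mono)
      fix y :: "real^3"
      have "1 * (1 / (sinh_dist x y)\<^sup>2) \<le> (stretch 1 (norm y))\<^sup>2 * (1 / (sinh_dist x y)\<^sup>2)"
        using stretch_ge_1[of "norm y"] by (intro mult_right_mono) auto
      then show "ennreal (norm (indicator (cball 0 R) y * (1 / (sinh_dist x y)\<^sup>2)))
        \<le> ennreal ((stretch 1 (norm y))\<^sup>2) * (ennreal (1 / (sinh_dist x y)\<^sup>2) * indicator (cball 0 R) y)"
        by (auto simp: indicator_def ennreal_mult[symmetric] intro!: ennreal_leI)
    qed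
    also have "\<dots> < \<infinity>" by (rule nn_integral_inverse_square_local)
    finally show "(\<integral>\<^sup>+ y. ennreal (norm (indicator (cball 0 R) y * (1 / (sinh_dist x y)\<^sup>2))) \<partial>lborel) < \<infinity>" .
  qed measurable
  have 2: "integrable lborel (\<lambda>y::real^3. indicator (cball 0 R) y * (1 / (norm y)\<^sup>2))"
  proof (rule integrableI_bounded)
    have "(\<integral>\<^sup>+ y. ennreal (norm (indicator (cball 0 R) (y::real^3) * (1 / (norm y)\<^sup>2))) \<partial>lborel)
      = (\<integral>\<^sup>+ y. ennreal ((stretch 1 (norm y))\<^sup>2) * (ennreal (1 / (sinh_dist 0 y)\<^sup>2) * indicator (cball 0 R) y) \<partial>lborel)"
    proof (rule nn_integral_cong)
      fix y :: "real^3"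
      \<comment> \<open>For the pole 0, sinh d is \<open>stretch 1 (norm y) * norm y\<close>, so
        this case is an instance of the general one. Both sides are 0 at \<open>y = 0\<close>, by
        division by zero.\<close>
      have "1 / (norm y)\<^sup>2 = (stretch 1 (norm y))\<^sup>2 * (1 / (sinh_dist 0 y)\<^sup>2)"
        by (cases "y = 0") (simp_all add: sinh_dist_0 stretch_1 power_divide)
      then show "ennreal (norm (indicator (cball 0 R) y * (1 / (norm y)\<^sup>2)))
        = ennreal ((stretch 1 (norm y))\<^sup>2) * (ennreal (1 / (sinh_dist 0 y)\<^sup>2) * indicator (cball 0 R) y)"
        by (auto simp: indicator_def ennreal_mult[symmetric])
    qed
    also have "\<dots> < \<infinity>" by (rule nn_integral_inverse_square_local)
    finally show "(\<integral>\<^sup>+ y. ennreal (norm (indicator (cball 0 R) (y::real^3) * (1 / (norm y)\<^sup>2))) \<partial>lborel) < \<infinity>" .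
  qed measurable
  have 3: "integrable lborel (indicator (cball 0 R) :: real^3 \<Rightarrow> real)"
    using emeasure_lborel_cball_finite by (intro integrable_real_indicator) auto
  show ?thesis
    using Bochner_Integration.integrable_add[OF Bochner_Integration.integrable_add[OF 3 2] 1[of x]]
    by (simp add: distrib_left)
qed

lemma AE_lborel_neq: "AE y in lborel. (y::'a::euclidean_space) \<noteq> c"
  by (rule AE_I[where N = "{c}"]) auto

text \<open>A line in direction i through c lies in the hyperplane where another coordinate j equals
  that of c, and this hyperplane is a null set.\<close>

lemma AE_line_avoids:
  fixes c :: "real^3"
  shows "AE y in lborel. \<forall>t::real. y + t *\<^sub>R axis i 1 \<noteq> c"
proof -
  obtain j :: 3 where j: "j \<noteq> i" using exhaust_3[of i] by (metis zero_neq_one)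
  have "{y::real^3. y \<bullet> axis j 1 = c \<bullet> axis j 1} \<in> null_sets lborel"
  proof -
    have "negligible {y::real^3. axis j 1 \<bullet> y = c \<bullet> axis j 1}"
      by (rule negligible_hyperplane) (simp add: axis_eq_0_iff)
    moreover have "closed {y::real^3. axis j 1 \<bullet> y = c \<bullet> axis j 1}" by (rule closed_hyperplane)
    ultimately show ?thesis
      by (simp add: negligible_iff_null_sets null_sets_completion_iff inner_commute)
  qed
  then show ?thesis
    by (rule AE_I') (use j in \<open>auto simp: inner_add_left inner_axis_axis\<close>)
qed

context
  fixes \<mu> \<nu> :: complex and u :: "real^3 \<Rightarrow> complex" and x :: "real^3"
  assumes \<mu>: "0 \<le> Re \<mu>" and \<nu>: "0 \<le> Re \<nu>" and u: "u \<in> test_functions"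
begin

lemma integrable_green_field: "integrable lborel (green_field \<mu> \<nu> x u i)"
proof -
  obtain R where R: "0 < R" "\<And>y. R < norm y \<Longrightarrow> u y = 0" "\<And>y j. R < norm y \<Longrightarrow> partial j u y = 0"
    using test_function_support[OF u] by blast
  obtain c where c: "0 < c" "\<And>y. y \<in> {y. y \<noteq> 0 \<and> y \<noteq> x \<and> norm y \<le> R} \<Longrightarrow> norm (green_field \<mu> \<nu> x u i y) \<le> c"
    using bdd_on_pos[OF near_field[OF refl \<mu> \<nu> test_function_smooth[OF u]]] by blast
  show ?thesis
  proof (rule Bochner_Integration.integrable_bound)
    show "integrable lborel (\<lambda>y::real^3. c * indicator (cball 0 R) y :: real)"
      using emeasure_lborel_cball_finite by (intro integrable_mult_right integrable_real_indicator) auto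
    show "green_field \<mu> \<nu> x u i \<in> borel_measurable lborel"
      using measurable_green_field[OF test_function_smooth[OF u]] by simp
    show "AE y in lborel. norm (green_field \<mu> \<nu> x u i y) \<le> norm (c * indicator (cball 0 R) y :: real)"
      using AE_lborel_neq[of 0] AE_lborel_neq[of x]
    proof eventually_elim
      case (elim y)
      show ?case
      proof (cases "norm y \<le> R")
        case True
        then show ?thesis using c(1) c(2)[of y] elim by simp
      next
        case False
        then show ?thesis using R by (simp add: green_field_def hyp_flux_def)
      qed
    qed
  qed
qed

lemma integrable_green_dfield: "integrable lborel (green_dfield \<mu> \<nu> x u i)"
proof -
  obtain R where R: "0 < R" "\<And>y. R < norm y \<Longrightarrow> u y = 0" "\<And>y j. R < norm y \<Longrightarrow> partial j u y = 0"
    "\<And>y i j. R < norm y \<Longrightarrow> partial i (partial j u) y = 0"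
    using test_function_support[OF u] by blast
  obtain c where c: "0 < c" "\<And>y. y \<in> {y. y \<noteq> 0 \<and> y \<noteq> x \<and> norm y \<le> R} \<Longrightarrow>
      norm (green_dfield \<mu> \<nu> x u i y) \<le> c * (1 + 1 / (norm y)\<^sup>2 + 1 / (sinh_dist x y)\<^sup>2)"
    by (rule near_dfield[OF refl \<mu> \<nu> test_function_smooth[OF u]]) blast
  show ?thesis
  proof (rule Bochner_Integration.integrable_bound)
    show "integrable lborel (\<lambda>y. c * (indicator (cball 0 R) y * (1 + 1 / (norm y)\<^sup>2 + 1 / (sinh_dist x y)\<^sup>2)))"
      by (intro integrable_mult_right integrable_inverse_squares_local)
    show "green_dfield \<mu> \<nu> x u i \<in> borel_measurable lborel"
      using measurable_green_field[OF test_function_smooth[OF u]] by simp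
    show "AE y in lborel. norm (green_dfield \<mu> \<nu> x u i y)
        \<le> norm (c * (indicator (cball 0 R) y * (1 + 1 / (norm y)\<^sup>2 + 1 / (sinh_dist x y)\<^sup>2)))"
      using AE_lborel_neq[of 0] AE_lborel_neq[of x]
    proof eventually_elim
      case (elim y)
      show ?case
      proof (cases "norm y \<le> R")
        case True
        then have "norm (green_dfield \<mu> \<nu> x u i y) \<le> c * (indicator (cball 0 R) y * (1 + 1 / (norm y)\<^sup>2 + 1 / (sinh_dist x y)\<^sup>2))"
          using c(2)[of y] elim by simp
        then show ?thesis by simp
      next
        case False
        then show ?thesis using R by (simp add: green_dfield_def hyp_flux_def hyp_dflux_def)
      qed
    qed
  qed
qed

lemma integral_green_dfield: "integral\<^sup>L lborel (green_dfield \<mu> \<nu> x u i) = 0"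
proof (rule integral_directional_derivative_eq_0[OF integrable_green_field integrable_green_dfield])
  show "AE y in lborel. \<forall>t\<in>{0..1}. ((\<lambda>t. green_field \<mu> \<nu> x u i (y + t *\<^sub>R axis i 1)) has_vector_derivative
      green_dfield \<mu> \<nu> x u i (y + t *\<^sub>R axis i 1)) (at t)"
    using AE_line_avoids[of i 0] AE_line_avoids[of i x]
  proof eventually_elim
    case (elim y)
    show ?case
    proof
      fix t :: real
      have "((\<lambda>s. green_field \<mu> \<nu> x u i ((y + t *\<^sub>R axis i 1) + s *\<^sub>R axis i 1)) has_vector_derivative
          green_dfield \<mu> \<nu> x u i (y + t *\<^sub>R axis i 1)) (at (t - t))"
        using elim by (simp add: line_green_field[OF test_function_smooth[OF u]])
      moreover have "((\<lambda>s. s - t) has_vector_derivative 1) (at t)"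
        by (auto intro!: derivative_eq_intros)
      moreover have "(y + t *\<^sub>R axis i 1) + (s - t) *\<^sub>R axis i 1 = y + s *\<^sub>R axis i 1" for s
        by (simp add: algebra_simps)
      ultimately show "((\<lambda>t. green_field \<mu> \<nu> x u i (y + t *\<^sub>R axis i 1)) has_vector_derivative
          green_dfield \<mu> \<nu> x u i (y + t *\<^sub>R axis i 1)) (at t)"
        using vector_diff_chain_at[of "\<lambda>s. s - t" 1 t
            "\<lambda>s. green_field \<mu> \<nu> x u i ((y + t *\<^sub>R axis i 1) + s *\<^sub>R axis i 1)"
            "green_dfield \<mu> \<nu> x u i (y + t *\<^sub>R axis i 1)"]
        by (simp only: o_def scaleR_one)
    qed
  qed
qed

end

section \<open>The pointwise bound by the kernel\<close>

lemma hyp_volume_measurable [simp]: "borel_measurable (hyp_volume \<kappa>) = borel_measurable borel"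
  unfolding riemannian_volume_def by (intro measurable_cong_sets) simp_all

lemma sets_hyp_volume [simp, measurable_cong]: "sets (hyp_volume \<kappa>) = sets borel"
  by (simp add: riemannian_volume_def)

lemma space_hyp_volume [simp]: "space (hyp_volume \<kappa>) = UNIV"
  by (simp add: riemannian_volume_def)

lemma isCont_hyp_unembed: "isCont hyp_unembed v"
proof (cases "v = 0")
  case False
  have "isCont arsinh r" for r :: real
    by (rule DERIV_isCont[OF arsinh_real_has_field_derivative])
  then have "isCont (\<lambda>v. arsinh (norm v)) v"
    by (rule isCont_o2[where f = norm and g = arsinh, rotated]) (rule continuous_norm[OF continuous_ident])
  then show ?thesis
    unfolding hyp_unembed_def using False by (intro isCont_scaleR isCont_divide) auto
next
  case True
  have "(hyp_unembed \<longlongrightarrow> 0) (at 0)"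
  proof (rule Lim_null_comparison)
    show "\<forall>\<^sub>F v in at 0. norm (hyp_unembed v) \<le> norm v"
      by (simp add: norm_hyp_unembed arsinh_le_self)
    show "((\<lambda>v. norm v) \<longlongrightarrow> 0) (at (0::real^3))"
      using tendsto_norm_zero[OF tendsto_ident_at] .
  qed
  moreover have "hyp_unembed 0 = 0" by (simp add: hyp_unembed_def)
  ultimately show ?thesis using True by (simp add: isCont_def)
qed

text \<open>A boost moves the pole to 0, where \<open>sinh_dist\<close> is the norm, and the claim
  becomes continuity at 0 of the transported function. The triangle inequality for the distance is
  not involved.\<close>

lemma continuous_sinh_dist:
  fixes u :: "real^3 \<Rightarrow> complex"
  assumes u: "continuous_on UNIV u" and \<epsilon>: "0 < \<epsilon>"
  shows "\<exists>\<delta>>0. \<forall>y. sinh_dist x y < \<delta> \<longrightarrow> norm (u y - u x) < \<epsilon>"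
proof -
  define V where "V = hyp_embed x"
  define \<Phi> where "\<Phi> z = u (hyp_unembed (boost (- V) z))" for z
  have b: "isCont (boost (- V)) z" "isCont u z" for z
    using continuous_boost[of "- V"] u by (auto simp: continuous_on_eq_continuous_at)
  have "isCont \<Phi> 0"
    unfolding \<Phi>_def by (intro isCont_o2[OF b(1)] isCont_o2[OF isCont_hyp_unembed] b)
  then obtain \<delta> where \<delta>: "0 < \<delta>" "\<And>z. norm z < \<delta> \<Longrightarrow> norm (\<Phi> z - \<Phi> 0) < \<epsilon>"
    using \<epsilon> unfolding continuous_at_eps_delta by (auto simp: dist_norm)
  have "boost (- V) 0 = V" by (simp add: boost_def)
  then have "\<Phi> 0 = u x" by (simp add: \<Phi>_def V_def hyp_unembed_embed)
  moreover have "\<Phi> (boost V (hyp_embed y)) = u y" for y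
    by (simp add: \<Phi>_def boost_minus_boost hyp_unembed_embed)
  ultimately have "norm (u y - u x) < \<epsilon>" if "sinh_dist x y < \<delta>" for y
    using \<delta>(2)[of "boost V (hyp_embed y)"] that by (simp add: sinh_dist_def V_def)
  then show ?thesis using \<delta>(1) by blast
qed

section \<open>The approximate identity and Green's estimate\<close>

definition exp_kernel :: "real \<Rightarrow> real^3 \<Rightarrow> real^3 \<Rightarrow> real"
  where "exp_kernel m x y = exp (- m * hyp_dist x y) / sinh_dist x y"

lemma exp_kernel_nonneg: "0 \<le> exp_kernel m x y"
  by (simp add: exp_kernel_def)

lemma measurable_exp_kernel [measurable]: "exp_kernel m x \<in> borel_measurable borel"
  unfolding exp_kernel_def by measurable

lemma
  assumes m: "1 < m"
  shows integrable_exp_kernel: "integrable (hyp_volume 1) (exp_kernel m x)"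
    and integral_exp_kernel: "(\<integral>y. exp_kernel m x y \<partial>hyp_volume 1) = 4 * pi / (m\<^sup>2 - 1)"
proof -
  have m2: "1 < m\<^sup>2" using m by (simp add: one_less_power)
  have "(\<integral>\<^sup>+ y. ennreal (exp_kernel m x y) \<partial>hyp_volume 1) = ennreal (4 * pi / (m\<^sup>2 - 1))"
    unfolding exp_kernel_def by (rule nn_integral_hyp_exp_kernel[OF m])
  then have "has_bochner_integral (hyp_volume 1) (exp_kernel m x) (4 * pi / (m\<^sup>2 - 1))"
    using m2 by (intro has_bochner_integral_nn_integral) (auto simp: exp_kernel_nonneg)
  then show "integrable (hyp_volume 1) (exp_kernel m x)"
    "(\<integral>y. exp_kernel m x y \<partial>hyp_volume 1) = 4 * pi / (m\<^sup>2 - 1)"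
    by (auto simp: has_bochner_integral_iff)
qed

lemma integrable_exp_kernel_scaleR:
  fixes u :: "real^3 \<Rightarrow> complex"
  assumes m: "1 < m" and [measurable]: "u \<in> borel_measurable borel" and K: "\<And>y. norm (u y) \<le> K"
  shows "integrable (hyp_volume 1) (\<lambda>y. exp_kernel m x y *\<^sub>R u y)"
proof (rule Bochner_Integration.integrable_bound)
  show "integrable (hyp_volume 1) (\<lambda>y. exp_kernel m x y * K)"
    by (intro integrable_mult_left integrable_exp_kernel m)
  have "norm (exp_kernel m x y *\<^sub>R u y) \<le> norm (exp_kernel m x y * K)" for y
    using K[of y] order_trans[OF norm_ge_zero K[of y]] by (simp add: exp_kernel_nonneg mult_left_mono)
  then show "AE y in hyp_volume 1. norm (exp_kernel m x y *\<^sub>R u y) \<le> norm (exp_kernel m x y * K)" by simp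
qed simp

text \<open>The factor m^2 - 1 normalizes the mass to 4 pi. Near the pole continuity of
  \<open>u\<close> suffices; far from it the kernel is an exponentially small multiple of the fixed
  integrable kernel with m = 3, and the exponential beats m^2.\<close>

lemma exp_kernel_approximate_identity:
  fixes u :: "real^3 \<Rightarrow> complex"
  assumes u: "continuous_on UNIV u" and K: "\<And>y. norm (u y) \<le> K"
  shows "((\<lambda>m. (m\<^sup>2 - 1) *\<^sub>R (\<integral>y. exp_kernel m x y *\<^sub>R u y \<partial>hyp_volume 1)) \<longlongrightarrow> (4 * pi) *\<^sub>R u x) at_top"
proof (rule tendstoI)
  fix e :: real assume e: "0 < e"
  have [measurable]: "u \<in> borel_measurable borel"
    using u by (rule borel_measurable_continuous_onI)
  have K0: "0 \<le> K" using order_trans[OF norm_ge_zero K] .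
  \<comment> \<open>The near part carries at most the full mass 4 pi, so it contributes at most 4 pi
    \<epsilon> = e / 2.\<close>
  define \<epsilon> where "\<epsilon> = e / (8 * pi)"
  have "0 < \<epsilon>" using e by (simp add: \<epsilon>_def)
  from continuous_sinh_dist[OF u this, of x] obtain \<delta>
    where \<delta>: "0 < \<delta>" "\<And>y. sinh_dist x y < \<delta> \<Longrightarrow> norm (u y - u x) < \<epsilon>" by blast
  define d where "d = arsinh \<delta>"
  have d: "0 < d" using \<delta> by (simp add: d_def)
  \<comment> \<open>The factor pi K is 2 K times the mass 4 pi / (3^2 - 1) of the kernel with m =
    3.\<close>
  have bound: "norm ((m\<^sup>2 - 1) *\<^sub>R (\<integral>y. exp_kernel m x y *\<^sub>R u y \<partial>hyp_volume 1) - (4 * pi) *\<^sub>R u x)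
      \<le> e / 2 + pi * K * ((m\<^sup>2 - 1) * exp (- (m - 3) * d))" if m: "3 < m" for m
  proof -
    have m1: "1 < m" and m2: "1 < m\<^sup>2" using m by (auto simp: one_less_power)
    have int: "integrable (hyp_volume 1) (\<lambda>y. exp_kernel m x y *\<^sub>R u y)" "integrable (hyp_volume 1) (\<lambda>y. exp_kernel m x y *\<^sub>R u x)"
      by (rule integrable_exp_kernel_scaleR[OF m1 _ K], simp)
        (rule integrable_exp_kernel_scaleR[OF m1 _ order_refl], simp)
    have "(\<integral>y. exp_kernel m x y *\<^sub>R u x \<partial>hyp_volume 1) = (4 * pi / (m\<^sup>2 - 1)) *\<^sub>R u x"
      by (subst integral_scaleR_left) (simp_all add: integrable_exp_kernel[OF m1] integral_exp_kernel[OF m1])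
    then have "(m\<^sup>2 - 1) *\<^sub>R (\<integral>y. exp_kernel m x y *\<^sub>R u y \<partial>hyp_volume 1) - (4 * pi) *\<^sub>R u x
        = (m\<^sup>2 - 1) *\<^sub>R ((\<integral>y. exp_kernel m x y *\<^sub>R u y \<partial>hyp_volume 1) - (\<integral>y. exp_kernel m x y *\<^sub>R u x \<partial>hyp_volume 1))"
      using m2 by (simp add: scaleR_diff_right)
    also have "\<dots> = (m\<^sup>2 - 1) *\<^sub>R (\<integral>y. exp_kernel m x y *\<^sub>R (u y - u x) \<partial>hyp_volume 1)"
      using int by (simp add: scaleR_diff_right)
    finally have "norm ((m\<^sup>2 - 1) *\<^sub>R (\<integral>y. exp_kernel m x y *\<^sub>R u y \<partial>hyp_volume 1) - (4 * pi) *\<^sub>R u x)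
        = (m\<^sup>2 - 1) * norm (\<integral>y. exp_kernel m x y *\<^sub>R (u y - u x) \<partial>hyp_volume 1)"
      using m2 by simp
    also have "\<dots> \<le> (m\<^sup>2 - 1) * (\<integral>y. \<epsilon> * exp_kernel m x y + 2 * K * exp (- (m - 3) * d) * exp_kernel 3 x y \<partial>hyp_volume 1)"
    proof (rule mult_left_mono[OF Bochner_Integration.integral_norm_bound_integral])
      show "integrable (hyp_volume 1) (\<lambda>y. exp_kernel m x y *\<^sub>R (u y - u x))"
        using Bochner_Integration.integrable_diff[OF int] by (simp add: scaleR_diff_right)
      show "integrable (hyp_volume 1) (\<lambda>y. \<epsilon> * exp_kernel m x y + 2 * K * exp (- (m - 3) * d) * exp_kernel 3 x y)"
        using m1 by (intro Bochner_Integration.integrable_add integrable_mult_right integrable_exp_kernel) auto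
      fix y
      show "norm (exp_kernel m x y *\<^sub>R (u y - u x)) \<le> \<epsilon> * exp_kernel m x y + 2 * K * exp (- (m - 3) * d) * exp_kernel 3 x y"
      proof (cases "sinh_dist x y < \<delta>")
        case True
        then have "norm (exp_kernel m x y *\<^sub>R (u y - u x)) \<le> exp_kernel m x y * \<epsilon>"
          using \<delta>(2)[OF True] by (simp add: exp_kernel_nonneg mult_left_mono)
        moreover have "0 \<le> 2 * K * exp (- (m - 3) * d) * exp_kernel 3 x y"
          using K0 by (simp add: exp_kernel_nonneg)
        ultimately show ?thesis by (simp only: mult.commute[of \<epsilon>])
      next
        case False
        \<comment> \<open>Away from the pole, the kernel is exponentially small compared to the one with \<open>m = 3\<close>.\<close>
        then have "d \<le> hyp_dist x y"
          unfolding d_def using arsinh_less_iff_real[of "sinh_dist x y" \<delta>] by linarith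
        then have "(m - 3) * d \<le> (m - 3) * hyp_dist x y" using m by (intro mult_left_mono) auto
        then have "exp (- m * hyp_dist x y) \<le> exp (- (m - 3) * d) * exp (- 3 * hyp_dist x y)"
          unfolding exp_add[symmetric] by (simp add: algebra_simps)
        then have 1: "exp_kernel m x y \<le> exp (- (m - 3) * d) * exp_kernel 3 x y"
          unfolding exp_kernel_def times_divide_eq_right by (intro divide_right_mono) auto
        have "norm (u y - u x) \<le> 2 * K"
          using norm_triangle_ineq4[of "u y" "u x"] K[of x] K[of y] by linarith
        with 1 have "exp_kernel m x y * norm (u y - u x) \<le> exp (- (m - 3) * d) * exp_kernel 3 x y * (2 * K)"
          by (intro mult_mono) (auto simp: exp_kernel_nonneg)
        moreover have "0 \<le> \<epsilon> * exp_kernel m x y" using \<open>0 < \<epsilon>\<close> by (simp add: exp_kernel_nonneg)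
        ultimately show ?thesis by (simp add: exp_kernel_nonneg mult_ac)
      qed
    qed (use m2 in auto)
    also have "(\<integral>y. \<epsilon> * exp_kernel m x y + 2 * K * exp (- (m - 3) * d) * exp_kernel 3 x y \<partial>hyp_volume 1)
      = \<epsilon> * (4 * pi / (m\<^sup>2 - 1)) + 2 * K * exp (- (m - 3) * d) * (4 * pi / (3\<^sup>2 - 1))"
      by (subst Bochner_Integration.integral_add) (simp_all add: integrable_exp_kernel m1 integral_exp_kernel)
    also have "(m\<^sup>2 - 1) * \<dots> = e / 2 + pi * K * ((m\<^sup>2 - 1) * exp (- (m - 3) * d))"
      using m2 by (simp add: \<epsilon>_def field_simps)
    finally show ?thesis .
  qed
  have "((\<lambda>m. pi * K * ((m\<^sup>2 - 1) * exp (- (m - 3) * d))) \<longlongrightarrow> 0) at_top"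
  proof -
    have f: "filterlim (\<lambda>m. m * d) at_top at_top"
      using d by (intro filterlim_at_top_mult_tendsto_pos[OF tendsto_const]) (auto simp: filterlim_ident)
    have p: "((\<lambda>m. (m * d) ^ k / exp (m * d)) \<longlongrightarrow> 0) at_top" for k
      by (rule filterlim_compose[OF tendsto_power_div_exp_0 f])
    have "((\<lambda>m. pi * K * (exp (3 * d) / d\<^sup>2 * ((m * d) ^ 2 / exp (m * d)) - exp (3 * d) * ((m * d) ^ 0 / exp (m * d))))
        \<longlongrightarrow> pi * K * (exp (3 * d) / d\<^sup>2 * 0 - exp (3 * d) * 0)) at_top"
      by (intro tendsto_intros p)
    moreover have "exp (3 * d) / d\<^sup>2 * ((m * d) ^ 2 / exp (m * d)) - exp (3 * d) * ((m * d) ^ 0 / exp (m * d))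
        = (m\<^sup>2 - 1) * exp (- (m - 3) * d)" for m
    proof -
      have "exp (- (m - 3) * d) = exp (3 * d) / exp (m * d)" by (simp add: exp_diff[symmetric] algebra_simps)
      then show ?thesis using d by (simp add: power_mult_distrib field_simps)
    qed
    ultimately show ?thesis by simp
  qed
  from tendstoD[OF this, of "e / 2"] e
  have "\<forall>\<^sub>F m in at_top. dist (pi * K * ((m\<^sup>2 - 1) * exp (- (m - 3) * d))) 0 < e / 2" by simp
  then show "\<forall>\<^sub>F m in at_top. dist ((m\<^sup>2 - 1) *\<^sub>R (\<integral>y. exp_kernel m x y *\<^sub>R u y \<partial>hyp_volume 1)) ((4 * pi) *\<^sub>R u x) < e"
    using eventually_gt_at_top[of 3]
  proof eventually_elim
    case (elim m)
    then show ?case using bound[of m] by (simp add: dist_norm)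
  qed
qed

lemma test_function_bounded:
  assumes u: "u \<in> test_functions"
  shows "\<exists>K. \<forall>y. norm (u y) \<le> K"
proof -
  obtain R where R: "\<And>y. R < norm y \<Longrightarrow> u y = 0"
    using test_function_support[OF u] by blast
  have "bounded (u ` cball 0 R)"
    by (intro compact_imp_bounded compact_continuous_image smooth_continuous test_function_smooth[OF u]) auto
  then obtain K where K: "\<And>y. norm y \<le> R \<Longrightarrow> norm (u y) \<le> K" unfolding bounded_iff by fastforce
  have "norm (u y) \<le> max K 0" for y
    using K[of y] R[of y] by (cases "norm y \<le> R") (auto simp: le_max_iff_disj)
  then show ?thesis by blast
qed

context
  fixes \<mu> :: complex and u :: "real^3 \<Rightarrow> complex" and x :: "real^3"
  assumes \<mu>: "0 \<le> Re \<mu>" and u: "u \<in> test_functions"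
begin

text \<open>The divergence of the Green field integrates to 0. So (m^2 - \<mu>^2) times the integral
  of \<open>u\<close> against exp (- m d) / sinh d is minus the integral of the regularized kernel
  against (Laplacian + 1 - \<mu>^2) u, and that kernel is at most 2 / sinh d.\<close>

lemma green_estimate:
  assumes m: "1 < m"
  shows "ennreal (norm (of_real (m\<^sup>2) - \<mu>\<^sup>2) * norm (\<integral>y. exp_kernel m x y *\<^sub>R u y \<partial>hyp_volume 1))
    \<le> (\<integral>\<^sup>+ y. ennreal (2 * (1 / sinh_dist x y * norm (hyp_laplacian 1 u y + (1 - \<mu>\<^sup>2) * u y))) \<partial>hyp_volume 1)"
proof -
  define \<sigma> where "\<sigma> y = (stretch 1 (norm y))\<^sup>2" for y :: "real^3"
  define f where "f y = hyp_laplacian 1 u y + (1 - \<mu>\<^sup>2) * u y" for y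
  define c where "c = of_real (m\<^sup>2) - \<mu>\<^sup>2"
  define F where "F y = (\<Sum>i\<in>UNIV. green_dfield \<mu> (of_real m) x u i y)" for y
  have \<nu>: "0 \<le> Re (of_real m)" using m by simp
  have [measurable]: "u \<in> borel_measurable borel" "f \<in> borel_measurable borel" "\<sigma> \<in> borel_measurable borel"
    unfolding f_def \<sigma>_def using smooth_measurable[OF test_function_smooth[OF u]] measurable_hyp_laplacian[OF test_function_smooth[OF u]] by measurable
  have F: "integrable lborel F" "integral\<^sup>L lborel F = 0"
    unfolding F_def using integrable_green_dfield[OF \<mu> \<nu> u] integral_green_dfield[OF \<mu> \<nu> u]
    by (auto simp: Bochner_Integration.integral_sum)
  obtain K where K: "\<And>y. norm (u y) \<le> K" using test_function_bounded[OF u] by blast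
  have h: "integrable lborel (\<lambda>y. \<sigma> y *\<^sub>R (exp_kernel m x y *\<^sub>R u y))"
    "(\<integral>y. exp_kernel m x y *\<^sub>R u y \<partial>hyp_volume 1) = (\<integral>y. \<sigma> y *\<^sub>R (exp_kernel m x y *\<^sub>R u y) \<partial>lborel)"
    using integrable_exp_kernel_scaleR[OF m _ K, where x = x] unfolding hyp_volume_eq
    by (simp_all add: integrable_density integral_density \<sigma>_def)
  \<comment> \<open>Almost everywhere \<open>g\<close> is the density times the regularized kernel
    times \<open>f\<close>. Written as a difference of integrable functions, its integrability comes
    for free.\<close>
  define g where "g y = F y - c * (\<sigma> y *\<^sub>R (exp_kernel m x y *\<^sub>R u y))" for y
  have g: "integrable lborel g" "integral\<^sup>L lborel g = - c * (\<integral>y. exp_kernel m x y *\<^sub>R u y \<partial>hyp_volume 1)"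
  proof -
    note hc = integrable_mult_right[OF h(1), of c]
    show "integrable lborel g"
      unfolding g_def by (rule Bochner_Integration.integrable_diff[OF F(1) hc])
    have "integral\<^sup>L lborel g = integral\<^sup>L lborel F - (\<integral>y. c * (\<sigma> y *\<^sub>R (exp_kernel m x y *\<^sub>R u y)) \<partial>lborel)"
      unfolding g_def by (rule Bochner_Integration.integral_diff[OF F(1) hc])
    then show "integral\<^sup>L lborel g = - c * (\<integral>y. exp_kernel m x y *\<^sub>R u y \<partial>hyp_volume 1)"
      unfolding F(2) h(2) by (simp only: integral_mult_right_zero diff_0 mult_minus_left)
  qed
  have "ennreal (norm c * norm (\<integral>y. exp_kernel m x y *\<^sub>R u y \<partial>hyp_volume 1)) = ennreal (norm (integral\<^sup>L lborel g))"
    unfolding g(2) norm_mult norm_minus_cancel ..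
  also have "\<dots> \<le> (\<integral>\<^sup>+ y. ennreal (norm (g y)) \<partial>lborel)"
    by (rule integral_norm_bound_ennreal[OF g(1)])
  also have "\<dots> \<le> (\<integral>\<^sup>+ y. ennreal (\<sigma> y) * ennreal (2 * (1 / sinh_dist x y * norm (f y))) \<partial>lborel)"
  proof (rule nn_integral_mono_AE)
    show "AE y in lborel. ennreal (norm (g y)) \<le> ennreal (\<sigma> y) * ennreal (2 * (1 / sinh_dist x y * norm (f y)))"
      using AE_lborel_neq[of 0] AE_lborel_neq[of x]
    proof eventually_elim
      case (elim y)
      have "exp (- (complex_of_real m * of_real (hyp_dist x y))) = of_real (exp (- m * hyp_dist x y))"
        by (simp add: exp_of_real[symmetric])
      then have "g y = \<sigma> y *\<^sub>R (hyp_green \<mu> (of_real m) x y * f y)"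
        using sum_green_dfield[OF test_function_smooth[OF u], where y = y and x = x and \<mu> = \<mu> and \<nu> = "of_real m"] elim
        by (simp add: g_def F_def c_def f_def \<sigma>_def exp_kernel_def scaleR_conv_of_real algebra_simps diff_divide_distrib)
      then have "norm (g y) = \<sigma> y * (norm (hyp_green \<mu> (of_real m) x y) * norm (f y))"
        by (simp add: norm_mult \<sigma>_def)
      also have "\<dots> \<le> \<sigma> y * (2 * (1 / sinh_dist x y) * norm (f y))"
        by (intro mult_left_mono mult_right_mono norm_hyp_green_le \<mu> \<nu>) (auto simp: \<sigma>_def)
      finally show ?case
        by (simp add: ennreal_mult'[symmetric] \<sigma>_def ennreal_leI mult.assoc)
    qed
  qed
  also have "\<dots> = (\<integral>\<^sup>+ y. ennreal (2 * (1 / sinh_dist x y * norm (f y))) \<partial>hyp_volume 1)"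
    unfolding hyp_volume_eq \<sigma>_def by (rule nn_integral_density[symmetric]) measurable
  finally show ?thesis by (simp add: c_def f_def)
qed

text \<open>As m tends to infinity the left side of \<open>green_estimate\<close> tends to 4 pi |u
  x|, while its right side does not depend on m. An infinite right side leaves nothing to
  prove.\<close>

lemma pointwise_kernel_bound:
  "ennreal (2 * pi * norm (u x))
    \<le> (\<integral>\<^sup>+ y. ennreal (1 / sinh_dist x y * norm (hyp_laplacian 1 u y + (1 - \<mu>\<^sup>2) * u y)) \<partial>hyp_volume 1)"
proof -
  define A where "A = (\<integral>\<^sup>+ y. ennreal (1 / sinh_dist x y * norm (hyp_laplacian 1 u y + (1 - \<mu>\<^sup>2) * u y)) \<partial>hyp_volume 1)"
  have meas: "(\<lambda>y. ennreal (1 / sinh_dist x y * norm (hyp_laplacian 1 u y + (1 - \<mu>\<^sup>2) * u y))) \<in> borel_measurable (hyp_volume 1)"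
    using smooth_measurable[OF test_function_smooth[OF u]] measurable_hyp_laplacian[OF test_function_smooth[OF u]] by simp
  show ?thesis
  proof (cases A)
    case (real a)
    define I where "I m = (\<integral>y. exp_kernel m x y *\<^sub>R u y \<partial>hyp_volume 1)" for m
    have est: "norm (of_real (m\<^sup>2) - \<mu>\<^sup>2) * norm (I m) \<le> 2 * a" if "1 < m" for m
    proof -
      have "ennreal (norm (of_real (m\<^sup>2) - \<mu>\<^sup>2) * norm (I m)) \<le> 2 * A"
      proof -
        have "ennreal (norm (of_real (m\<^sup>2) - \<mu>\<^sup>2) * norm (I m)) \<le> (\<integral>\<^sup>+ y. ennreal (2 * (1 / sinh_dist x y * norm (hyp_laplacian 1 u y + (1 - \<mu>\<^sup>2) * u y))) \<partial>hyp_volume 1)"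
          unfolding I_def by (rule green_estimate[OF that])
        also have "\<dots> = (\<integral>\<^sup>+ y. 2 * ennreal (1 / sinh_dist x y * norm (hyp_laplacian 1 u y + (1 - \<mu>\<^sup>2) * u y)) \<partial>hyp_volume 1)"
          by (intro nn_integral_cong) (subst ennreal_mult', auto)
        also have "\<dots> = 2 * A"
          unfolding A_def by (rule nn_integral_cmult[OF meas])
        finally show ?thesis .
      qed
      also have "\<dots> = ennreal (2 * a)" using real by (simp add: ennreal_mult')
      finally show ?thesis using real by (subst (asm) ennreal_le_iff) auto
    qed
    \<comment> \<open>By the reverse triangle inequality |m^2 - \<mu>^2| is at least m^2 - c, and
      (m^2 - c) / (m^2 - 1) tends to 1.\<close>
    define c where "c = (norm \<mu>)\<^sup>2"
    obtain K where K: "\<And>y. norm (u y) \<le> K" using test_function_bounded[OF u] by blast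
    have lim1: "((\<lambda>m. (m\<^sup>2 - 1) *\<^sub>R I m) \<longlongrightarrow> (4 * pi) *\<^sub>R u x) at_top"
      unfolding I_def by (rule exp_kernel_approximate_identity[OF smooth_continuous[OF test_function_smooth[OF u]] K])
    have fl: "filterlim (\<lambda>m::real. m\<^sup>2 - 1) at_top at_top"
      by (intro filterlim_tendsto_add_at_top[of "\<lambda>_. - 1" "- 1" _ "\<lambda>m. m\<^sup>2", simplified] tendsto_const filterlim_pow_at_top filterlim_ident) auto
    have lim2: "((\<lambda>m::real. 1 + (1 - c) / (m\<^sup>2 - 1)) \<longlongrightarrow> 1 + 0) at_top"
      by (intro tendsto_intros real_tendsto_divide_at_top[OF tendsto_const fl])
    have "((\<lambda>m. (1 + (1 - c) / (m\<^sup>2 - 1)) * norm ((m\<^sup>2 - 1) *\<^sub>R I m)) \<longlongrightarrow> (1 + 0) * norm ((4 * pi) *\<^sub>R u x)) at_top"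
      by (intro tendsto_mult lim2 tendsto_norm lim1)
    moreover have "\<forall>\<^sub>F m in at_top. (1 + (1 - c) / (m\<^sup>2 - 1)) * norm ((m\<^sup>2 - 1) *\<^sub>R I m) \<le> 2 * a"
      using eventually_gt_at_top[of 1]
    proof eventually_elim
      case (elim m)
      then have m2: "1 < m\<^sup>2" by (simp add: one_less_power)
      have "(1 + (1 - c) / (m\<^sup>2 - 1)) * norm ((m\<^sup>2 - 1) *\<^sub>R I m) = (m\<^sup>2 - c) * norm (I m)"
      proof -
        have "1 + (1 - c) / (m\<^sup>2 - 1) = (m\<^sup>2 - c) / (m\<^sup>2 - 1)" using m2 by (simp add: field_simps)
        then show ?thesis using m2 by simp
      qed
      also have "\<dots> \<le> norm (of_real (m\<^sup>2) - \<mu>\<^sup>2) * norm (I m)"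
        using norm_triangle_ineq2[of "of_real (m\<^sup>2)" "\<mu>\<^sup>2"]
        by (intro mult_right_mono) (auto simp: c_def norm_power)
      also have "\<dots> \<le> 2 * a" by (rule est[OF elim])
      finally show ?case .
    qed
    ultimately have "(1 + 0) * norm ((4 * pi) *\<^sub>R u x) \<le> 2 * a"
      by (intro tendsto_upperbound) auto
    then have "2 * pi * norm (u x) \<le> a" by simp
    then show ?thesis unfolding A_def[symmetric] using real by (simp add: ennreal_leI)
  qed (simp add: A_def)
qed

end

section \<open>The estimate in curvature minus one\<close>

lemma Lp_norm_eq:
  assumes "(\<integral>\<^sup>+ x. ennreal (norm (f x) powr p) \<partial>M) = ennreal i" "0 \<le> i"
  shows "Lp_norm p M f = ennreal (i powr (1 / p))"
  using assms by (simp add: Lp_norm_def Let_def)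

lemma Lp_norm_eq_top:
  assumes "(\<integral>\<^sup>+ x. ennreal (norm (f x) powr p) \<partial>M) = \<infinity>"
  shows "Lp_norm p M f = \<infinity>"
  using assms by (simp add: Lp_norm_def Let_def)

lemma sigma_finite_hyp_volume: "sigma_finite_measure (hyp_volume 1)"
  unfolding hyp_volume_eq
  by (subst sigma_finite_measure.sigma_finite_iff_density_finite[OF sigma_finite_lborel]) auto

text \<open>The duality argument divides by the norm of \<open>u\<close>, which therefore has to be
  known finite beforehand.\<close>

lemma nn_integral_test_function_powr_finite:
  assumes u: "u \<in> test_functions" and p: "0 < p"
  shows "(\<integral>\<^sup>+ x. ennreal (norm (u x) powr p) \<partial>hyp_volume 1) < \<infinity>"
proof -
  obtain R where R: "0 < R" "\<And>y. R < norm y \<Longrightarrow> u y = 0"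
    using test_function_support[OF u] by blast
  obtain K where K: "\<And>y. norm (u y) \<le> K" using test_function_bounded[OF u] by auto
  have [measurable]: "u \<in> borel_measurable borel" by (rule smooth_measurable[OF test_function_smooth[OF u]])
  have "(\<integral>\<^sup>+ x. ennreal (norm (u x) powr p) \<partial>hyp_volume 1)
      = (\<integral>\<^sup>+ x. ennreal ((stretch 1 (norm x))\<^sup>2) * ennreal (norm (u x) powr p) \<partial>lborel)"
    unfolding hyp_volume_eq by (rule nn_integral_density) measurable
  also have "\<dots> \<le> (\<integral>\<^sup>+ x. ennreal ((cosh R)\<^sup>2 * K powr p) * indicator (cball 0 R) (x::real^3) \<partial>lborel)"
  proof (rule nn_integral_mono)
    fix x :: "real^3"
    show "ennreal ((stretch 1 (norm x))\<^sup>2) * ennreal (norm (u x) powr p)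
      \<le> ennreal ((cosh R)\<^sup>2 * K powr p) * indicator (cball 0 R) x"
    proof (cases "norm x \<le> R")
      case True
      have "stretch 1 (norm x) \<le> cosh R"
        using stretch_le_cosh[of "norm x"] cosh_real_nonneg_le_iff[of "norm x" R] True R by simp
      then have "(stretch 1 (norm x))\<^sup>2 * norm (u x) powr p \<le> (cosh R)\<^sup>2 * K powr p"
        using p K[of x] stretch_pos[of "norm x"] by (intro mult_mono power_mono powr_mono2) auto
      then show ?thesis using True by (simp add: ennreal_mult[symmetric] ennreal_leI)
    next
      case False
      then show ?thesis using R by simp
    qed
  qed
  also have "\<dots> < \<infinity>"
    using emeasure_lborel_cball_finite[of "0 :: real^3" R] by (simp add: nn_integral_cmult_indicator ennreal_mult_less_top)
  finally show ?thesis .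
qed

text \<open>Duality with t = s / (s - 1): the s-th power of the norm of \<open>u\<close> is the
  pairing of |u|^(s - 1) with |u|. The pointwise bound replaces |u| by the kernel applied to |f|,
  and the bilinear bound applies to the normalized functions.\<close>

lemma resolvent_estimate_curvature_1:
  assumes r: "1 < r" "r < s" "3 * (1 / r - 1 / s) = 2" "r < 3 / 2"
  shows "\<exists>C>0. \<forall>u\<in>test_functions. \<forall>\<zeta>. Lp_norm s (hyp_volume 1) u
    \<le> ennreal C * Lp_norm r (hyp_volume 1) (\<lambda>x. hyp_laplacian 1 u x + (1 + \<zeta>) * u x)"
proof -
  define t where "t = s / (s - 1)"
  have "1 / s = 1 / r - 2 / 3" using r(3) by simp
  also have "\<dots> < 1 / 3"
    using r(1) by (simp add: field_simps)
  finally have s: "3 < s" using r by (simp add: field_simps)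
  have t: "1 < t" "1 / t = 1 - 1 / s" "t / (t - 1) = s" "(s - 1) * t = s"
    using s by (simp_all add: t_def field_simps)
  have rt: "1 / r + 1 / t = 5 / 3" using r(3) t(2) by simp
  \<comment> \<open>Both exponents used below the level, \<open>r / (r - 1)\<close> and
    \<open>t / (t - 1) = s\<close>, have to exceed 3. The first condition is
    \<open>r < 3 / 2\<close>; the second came from \<open>1 < r\<close>.\<close>
  have e: "3 < r / (r - 1)" using r by (simp add: field_simps)
  \<comment> \<open>The sum dominates the constants of the large part and of the small part for each
    of the two exponents.\<close>
  define c where "c = 2 * pi + 4 * pi / (r / (r - 1) - 3) + 4 * pi / (s - 3)"
  have pos: "0 < 4 * pi / (r / (r - 1) - 3)" "0 < 4 * pi / (s - 3)" "0 < 2 * pi"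
    using e s by simp_all
  have c: "0 \<le> c" "2 * pi \<le> c" "4 * pi / (r / (r - 1) - 3) \<le> c" "4 * pi / (s - 3) \<le> c"
    using pos unfolding c_def by linarith+
  \<comment> \<open>The numerator is the constant of the bilinear bound, the denominator the factor
    in front of |u x| in the pointwise bound.\<close>
  define C where "C = (2 * (2 * c + 1)) / (2 * pi)"
  have C: "0 < C" using c by (simp add: C_def)
  define K where "K x y = 1 / sinh_dist x y" for x y
  have K_meas: "(\<lambda>z. K (fst z) (snd z)) \<in> borel_measurable (hyp_volume 1 \<Otimes>\<^sub>M hyp_volume 1)"
  proof -
    note measurable_sinh_dist [measurable]
    have "(\<lambda>z. K (fst z) (snd z)) \<in> borel_measurable (borel \<Otimes>\<^sub>M borel)"
      unfolding K_def by measurable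
    moreover have "borel_measurable (hyp_volume 1 \<Otimes>\<^sub>M hyp_volume 1) = borel_measurable (borel \<Otimes>\<^sub>M borel)"
      by (intro measurable_cong_sets sets_pair_measure_cong) simp_all
    ultimately show ?thesis by simp
  qed
  have K1: "(\<integral>\<^sup>+ y. ennreal (K x y) * indicator {y. l < K x y} y \<partial>hyp_volume 1) \<le> ennreal (c / l\<^sup>2)" if "0 < l" for x l
    unfolding K_def using c by (intro order_trans[OF hyp_kernel_large_part[OF that]] ennreal_leI divide_right_mono) auto
  have K2: "(\<integral>\<^sup>+ y. ennreal (K x y powr e) * indicator {y. K x y \<le> l} y \<partial>hyp_volume 1) \<le> ennreal (c * l powr (e - 3))"
    if "0 < l" "e \<in> {r / (r - 1), t / (t - 1)}" for x l e
  proof -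
    have "3 < e" "4 * pi / (e - 3) \<le> c" using that t s e c by auto
    then show ?thesis
      unfolding K_def by (intro order_trans[OF hyp_kernel_small_part[OF that(1)]] ennreal_leI mult_right_mono) auto
  qed
  have "Lp_norm s (hyp_volume 1) u \<le> ennreal C * Lp_norm r (hyp_volume 1) (\<lambda>x. hyp_laplacian 1 u x + (1 + \<zeta>) * u x)"
    if u: "u \<in> test_functions" for u \<zeta>
  proof -
    \<comment> \<open>The principal root has nonnegative real part, so every complex \<zeta> is
      covered.\<close>
    define \<mu> where "\<mu> = csqrt (- \<zeta>)"
    have \<mu>: "0 \<le> Re \<mu>" "1 - \<mu>\<^sup>2 = 1 + \<zeta>"
      using csqrt_principal[of "- \<zeta>"] by (auto simp: \<mu>_def)
    define f where "f x = hyp_laplacian 1 u x + (1 + \<zeta>) * u x" for x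
    have [measurable]: "u \<in> borel_measurable borel" "f \<in> borel_measurable borel"
      unfolding f_def using smooth_measurable[OF test_function_smooth[OF u]] measurable_hyp_laplacian[OF test_function_smooth[OF u]] by measurable
    have kernel: "ennreal (2 * pi * norm (u x)) \<le> (\<integral>\<^sup>+ y. ennreal (K x y * norm (f y)) \<partial>hyp_volume 1)" for x
      using pointwise_kernel_bound[OF \<mu>(1) u, of x] unfolding \<mu>(2) K_def f_def .
    obtain iu where iu: "(\<integral>\<^sup>+ x. ennreal (norm (u x) powr s) \<partial>hyp_volume 1) = ennreal iu" "0 \<le> iu"
      using nn_integral_test_function_powr_finite[OF u, of s] s by (auto simp: less_top_ennreal)
    show ?thesis
    proof (cases "\<integral>\<^sup>+ x. ennreal (norm (f x) powr r) \<partial>hyp_volume 1")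
      case top
      then have "Lp_norm r (hyp_volume 1) f = \<infinity>" by (intro Lp_norm_eq_top) simp
      then show ?thesis using C by (simp add: f_def[abs_def, symmetric] ennreal_mult_top)
    next
      case (real j)
      note Lf = Lp_norm_eq[OF real(2,1)] and Lu = Lp_norm_eq[OF iu]
      define F U where "F = j powr (1 / r)" "U = iu powr (1 / s)"
      have "U \<le> C * F"
      proof (cases "iu = 0")
        case True
        then show ?thesis using C real by (simp add: F_U_def)
      next
        case False
        then have iu_pos: "0 < iu" using iu by simp
        \<comment> \<open>Needed to normalize \<open>f\<close>: if \<open>f\<close> vanished almost
          everywhere, the pointwise bound would force \<open>u = 0\<close>.\<close>
        have "j \<noteq> 0"
        proof
          assume "j = 0"
          then have "AE x in hyp_volume 1. ennreal (norm (f x) powr r) = 0"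
            using real nn_integral_0_iff_AE[of "\<lambda>x. ennreal (norm (f x) powr r)" "hyp_volume 1"] by simp
          then have "AE y in hyp_volume 1. ennreal (K x y * norm (f y)) = 0" for x
            by eventually_elim auto
          then have "(\<integral>\<^sup>+ y. ennreal (K x y * norm (f y)) \<partial>hyp_volume 1) = (\<integral>\<^sup>+ y. 0 \<partial>hyp_volume 1)" for x
            by (rule nn_integral_cong_AE)
          then have "ennreal (2 * pi * norm (u x)) \<le> 0" for x
            using kernel[of x] by simp
          then have "u x = 0" for x
            by (simp add: mult_le_0_iff)
          then show False using iu False by simp
        qed
        then have j_pos: "0 < j" using real by simp
        have FU: "0 < F" "0 < U" "F powr r = j" "U powr s = iu"
          using j_pos iu_pos r s by (simp_all add: F_U_def powr_powr)
        \<comment> \<open>\<open>f1\<close> and \<open>h1\<close> have unit norm in L^r and L^t; for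
          the latter, \<open>(s - 1) * t = s\<close> is used.\<close>
        define f1 where "f1 y = norm (f y) / F" for y
        define h1 where "h1 x = norm (u x) powr (s - 1) / U powr (s - 1)" for x
        have [measurable]: "f1 \<in> borel_measurable borel" "h1 \<in> borel_measurable borel"
          unfolding f1_def h1_def by measurable
        have nn: "0 \<le> f1 y" "0 \<le> h1 y" "0 \<le> K x y" for x y
          using FU by (simp_all add: f1_def h1_def K_def)
        have int_f1: "(\<integral>\<^sup>+ y. ennreal (f1 y powr r) \<partial>hyp_volume 1) \<le> 1"
        proof -
          have "ennreal (f1 y powr r) = ennreal (1 / j) * ennreal (norm (f y) powr r)" for y
            using FU j_pos by (simp add: f1_def powr_divide ennreal_mult[symmetric])
          then have "(\<integral>\<^sup>+ y. ennreal (f1 y powr r) \<partial>hyp_volume 1)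
              = ennreal (1 / j) * (\<integral>\<^sup>+ y. ennreal (norm (f y) powr r) \<partial>hyp_volume 1)"
            by (simp only:) (rule nn_integral_cmult, simp)
          then show ?thesis
            using j_pos unfolding real by (simp add: ennreal_mult[symmetric])
        qed
        have int_h1: "(\<integral>\<^sup>+ y. ennreal (h1 y powr t) \<partial>hyp_volume 1) \<le> 1"
        proof -
          have "ennreal (h1 y powr t) = ennreal (1 / iu) * ennreal (norm (u y) powr s)" for y
            using FU iu_pos by (simp add: h1_def powr_divide powr_powr t(4) ennreal_mult[symmetric])
          then have "(\<integral>\<^sup>+ y. ennreal (h1 y powr t) \<partial>hyp_volume 1)
              = ennreal (1 / iu) * (\<integral>\<^sup>+ y. ennreal (norm (u y) powr s) \<partial>hyp_volume 1)"
            by (simp only:) (rule nn_integral_cmult, simp)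
          then show ?thesis
            using iu_pos unfolding iu by (simp add: ennreal_mult[symmetric])
        qed
        have HLS: "(\<integral>\<^sup>+ x. \<integral>\<^sup>+ y. ennreal (h1 x * K x y * f1 y) \<partial>hyp_volume 1 \<partial>hyp_volume 1) \<le> ennreal (2 * (2 * c + 1))"
          by (rule weak_kernel_bilinear_bound[OF sigma_finite_hyp_volume K_meas _ _ _ _ _ _ r(1) t(1) rt K1 K2 c(1) int_f1 int_h1])
            (use nn in \<open>simp_all add: K_def sinh_dist_sym\<close>)
        have "ennreal (2 * pi * U) = (\<integral>\<^sup>+ x. ennreal (2 * pi / U powr (s - 1)) * ennreal (norm (u x) powr s) \<partial>hyp_volume 1)"
        proof -
          have "2 * pi / U powr (s - 1) * iu = 2 * pi * U"
            using FU by (simp add: powr_diff flip: FU(4))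
          moreover have "(\<integral>\<^sup>+ x. ennreal (2 * pi / U powr (s - 1)) * ennreal (norm (u x) powr s) \<partial>hyp_volume 1)
              = ennreal (2 * pi / U powr (s - 1)) * (\<integral>\<^sup>+ x. ennreal (norm (u x) powr s) \<partial>hyp_volume 1)"
            by (rule nn_integral_cmult) simp
          ultimately show ?thesis
            unfolding iu(1) using iu(2) FU by (simp add: ennreal_mult[symmetric] del: times_divide_eq_left)
        qed
        also have "\<dots> = (\<integral>\<^sup>+ x. ennreal (h1 x) * ennreal (2 * pi * norm (u x)) \<partial>hyp_volume 1)"
        proof (rule nn_integral_cong)
          fix x
          have "norm (u x) powr s = norm (u x) powr (s - 1) * norm (u x)"
            using s powr_mult_base[of "norm (u x)" "s - 1"] by (simp add: mult.commute)
          then show "ennreal (2 * pi / U powr (s - 1)) * ennreal (norm (u x) powr s) = ennreal (h1 x) * ennreal (2 * pi * norm (u x))"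
            using FU by (simp add: h1_def ennreal_mult[symmetric])
        qed
        also have "\<dots> \<le> (\<integral>\<^sup>+ x. ennreal (h1 x) * (\<integral>\<^sup>+ y. ennreal (K x y * norm (f y)) \<partial>hyp_volume 1) \<partial>hyp_volume 1)"
          by (intro nn_integral_mono mult_left_mono kernel) simp
        also have "\<dots> = (\<integral>\<^sup>+ x. ennreal F * (\<integral>\<^sup>+ y. ennreal (h1 x * K x y * f1 y) \<partial>hyp_volume 1) \<partial>hyp_volume 1)"
        proof (rule nn_integral_cong)
          fix x
          have Kx [measurable]: "K x \<in> borel_measurable borel" unfolding K_def by measurable
          have "ennreal (h1 x) * (\<integral>\<^sup>+ y. ennreal (K x y * norm (f y)) \<partial>hyp_volume 1)
              = (\<integral>\<^sup>+ y. ennreal (h1 x) * ennreal (K x y * norm (f y)) \<partial>hyp_volume 1)"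
            by (rule nn_integral_cmult[symmetric]) simp
          also have "\<dots> = (\<integral>\<^sup>+ y. ennreal F * ennreal (h1 x * K x y * f1 y) \<partial>hyp_volume 1)"
            using FU nn by (intro nn_integral_cong) (simp add: f1_def ennreal_mult[symmetric])
          also have "\<dots> = ennreal F * (\<integral>\<^sup>+ y. ennreal (h1 x * K x y * f1 y) \<partial>hyp_volume 1)"
            by (rule nn_integral_cmult) simp
          finally show "ennreal (h1 x) * (\<integral>\<^sup>+ y. ennreal (K x y * norm (f y)) \<partial>hyp_volume 1)
              = ennreal F * (\<integral>\<^sup>+ y. ennreal (h1 x * K x y * f1 y) \<partial>hyp_volume 1)" .
        qed
        also have "\<dots> = ennreal F * (\<integral>\<^sup>+ x. \<integral>\<^sup>+ y. ennreal (h1 x * K x y * f1 y) \<partial>hyp_volume 1 \<partial>hyp_volume 1)"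
        proof (rule nn_integral_cmult)
          interpret sigma_finite_measure "hyp_volume 1" by (rule sigma_finite_hyp_volume)
          note K_meas [measurable]
          show "(\<lambda>x. \<integral>\<^sup>+ y. ennreal (h1 x * K x y * f1 y) \<partial>hyp_volume 1) \<in> borel_measurable (hyp_volume 1)"
            by (rule borel_measurable_nn_integral) (unfold split_beta', measurable)
        qed
        also have "\<dots> \<le> ennreal F * ennreal (2 * (2 * c + 1))"
          by (intro mult_left_mono HLS) simp
        also have "\<dots> = ennreal (F * (2 * (2 * c + 1)))"
          using FU c by (simp add: ennreal_mult)
        finally have "2 * pi * U \<le> F * (2 * (2 * c + 1))"
          using FU c by (subst (asm) ennreal_le_iff) auto
        then show ?thesis by (simp add: C_def field_simps)
      qed
      then have "ennreal U \<le> ennreal C * ennreal F"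
        using C by (simp add: ennreal_mult'[symmetric] ennreal_leI)
      then show ?thesis
        using Lf Lu by (simp add: F_U_def f_def[abs_def])
    qed
  qed
  then show ?thesis using C by blast
qed

section \<open>Scaling the curvature\<close>

lemma partial_scale:
  assumes "((\<lambda>t. f (b *\<^sub>R y + t *\<^sub>R axis i 1)) has_vector_derivative D) (at 0)"
  shows "((\<lambda>t. f (b *\<^sub>R (y + t *\<^sub>R axis i 1))) has_vector_derivative b *\<^sub>R D) (at 0)"
proof -
  have "((\<lambda>t. b * t) has_vector_derivative b) (at 0)"
    by (auto intro!: derivative_eq_intros)
  from vector_diff_chain_at[OF this, of "\<lambda>t. f (b *\<^sub>R y + t *\<^sub>R axis i 1)" D] assms
  show ?thesis by (simp add: o_def scaleR_add_right)
qed

text \<open>\<open>smooth\<close> speaks about every list of directions, so the rescaled function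
  needs a formula for each of them.\<close>

lemma iterated_partial_scale:
  fixes u :: "real^'n \<Rightarrow> complex"
  assumes u: "smooth u"
  shows "foldr partial is (\<lambda>y. u (b *\<^sub>R y)) = (\<lambda>y. b ^ length is *\<^sub>R foldr partial is u (b *\<^sub>R y))"
proof (induction "is")
  case (Cons i "is")
  have "foldr partial is u differentiable (at y)" for y using u by (simp add: smooth_def)
  then have "((\<lambda>t. foldr partial is u (b *\<^sub>R y + t *\<^sub>R axis i 1)) has_vector_derivative partial i (foldr partial is u) (b *\<^sub>R y)) (at 0)" for y
    by (rule line_differentiable)
  from has_vector_derivative_scaleR[OF DERIV_const[of "b ^ length is"] partial_scale[OF this]]
  have "((\<lambda>t. b ^ length is *\<^sub>R foldr partial is u (b *\<^sub>R (y + t *\<^sub>R axis i 1))) has_vector_derivative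
      b ^ length (i # is) *\<^sub>R partial i (foldr partial is u) (b *\<^sub>R y)) (at 0)" for y
    by (simp add: mult.commute)
  from vector_derivative_at[OF this]
  have "partial i (\<lambda>y. b ^ length is *\<^sub>R foldr partial is u (b *\<^sub>R y)) y
      = b ^ length (i # is) *\<^sub>R partial i (foldr partial is u) (b *\<^sub>R y)" for y
    unfolding partial_def[of i "\<lambda>y. b ^ length is *\<^sub>R foldr partial is u (b *\<^sub>R y)"] .
  then show ?case by (simp add: Cons.IH fun_eq_iff)
qed simp

lemma test_functions_scale:
  assumes u: "u \<in> test_functions" and b: "b \<noteq> 0"
  shows "(\<lambda>y. u (b *\<^sub>R y)) \<in> test_functions"
proof -
  have su: "smooth u" by (rule test_function_smooth[OF u])
  have "smooth (\<lambda>y. u (b *\<^sub>R y))"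
    unfolding smooth_def iterated_partial_scale[OF su]
  proof (intro allI)
    fix "is" y
    have "foldr partial is u differentiable (at (b *\<^sub>R y))" using su by (simp add: smooth_def)
    then have "(foldr partial is u \<circ> (\<lambda>y. b *\<^sub>R y)) differentiable (at y)"
      by (intro differentiable_chain_at) (auto intro!: derivative_intros)
    then show "(\<lambda>y. b ^ length is *\<^sub>R foldr partial is u (b *\<^sub>R y)) differentiable (at y)"
      by (intro differentiable_scaleR) (auto simp: o_def)
  qed
  moreover have "{y. u (b *\<^sub>R y) \<noteq> 0} = (*\<^sub>R) (1 / b) ` {y. u y \<noteq> 0}"
    using b by (auto simp: image_iff intro!: exI[of _ "b *\<^sub>R y" for y])
  ultimately show ?thesis
    using u by (simp add: test_functions_def bounded_scaling)
qed

lemma stretch_scale: "stretch \<kappa> r = stretch 1 (sqrt \<kappa> * r)" if "0 < \<kappa>"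
  using that by (simp add: stretch_def)

text \<open>The matrices agree after the dilation, whereas the pulled-back metric carries an extra
  factor \<kappa>. This discrepancy produces the powers of \<kappa> below.\<close>

lemma hyp_metric_scale:
  assumes "0 < \<kappa>" shows "hyp_metric \<kappa> y = hyp_metric 1 (sqrt \<kappa> *\<^sub>R y)"
proof -
  have "(sqrt \<kappa> *\<^sub>R y) /\<^sub>R norm (sqrt \<kappa> *\<^sub>R y) = y /\<^sub>R norm y"
    using assms by simp
  then show ?thesis
    using assms by (simp add: hyp_metric_def stretch_scale[of \<kappa>] del: scaleR_scaleR)
qed

text \<open>Each of the two differentiations contributes a factor \<open>sqrt \<kappa>\<close>, and
  the coefficients are unchanged up to the dilation.\<close>

lemma hyp_laplacian_scale:
  assumes \<kappa>: "0 < \<kappa>" and w: "smooth w" and y: "y \<noteq> 0"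
  shows "hyp_laplacian \<kappa> (\<lambda>y. w (sqrt \<kappa> *\<^sub>R y)) y = \<kappa> *\<^sub>R hyp_laplacian 1 w (sqrt \<kappa> *\<^sub>R y)"
proof -
  define a where "a = sqrt \<kappa>"
  have a: "0 < a" "a * a = \<kappa>" using \<kappa> by (simp_all add: a_def)
  have p: "partial j (\<lambda>y. w (a *\<^sub>R y)) y = a *\<^sub>R partial j w (a *\<^sub>R y)" for j y
    unfolding partial_def[of j "\<lambda>y. w (a *\<^sub>R y)"]
    by (rule vector_derivative_at partial_scale line_differentiable smooth_differentiable w)+
  have flux: "(\<Sum>j\<in>UNIV. (sqrt (det (hyp_metric \<kappa> y)) * matrix_inv (hyp_metric \<kappa> y) $ i $ j) *\<^sub>R partial j (\<lambda>y. w (a *\<^sub>R y)) y)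
      = a *\<^sub>R hyp_flux w i (a *\<^sub>R y)" for i y
    unfolding hyp_metric_scale[OF \<kappa>] hyp_coeff_eq p a_def[symmetric]
    by (simp add: hyp_flux_def scaleR_sum_right mult.commute)
  have "partial i (\<lambda>y. a *\<^sub>R hyp_flux w i (a *\<^sub>R y)) y = \<kappa> *\<^sub>R hyp_dflux w i (a *\<^sub>R y)" for i
  proof -
    have "a *\<^sub>R y \<noteq> 0" using a y by simp
    note has_vector_derivative_scaleR[OF DERIV_const[of a] partial_scale[OF line_flux[OF w this]]]
    then show ?thesis unfolding partial_def by (intro vector_derivative_at) (simp add: a)
  qed
  then have "hyp_laplacian \<kappa> (\<lambda>y. w (a *\<^sub>R y)) y
      = (1 / (stretch 1 (norm (a *\<^sub>R y)))\<^sup>2) *\<^sub>R (\<kappa> *\<^sub>R (\<Sum>i\<in>UNIV. hyp_dflux w i (a *\<^sub>R y)))"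
    unfolding laplace_beltrami_def flux by (simp add: hyp_metric_scale[OF \<kappa>] sqrt_det_hyp_metric a_def[symmetric] scaleR_sum_right)
  also have "(\<Sum>i\<in>UNIV. hyp_dflux w i (a *\<^sub>R y)) = (stretch 1 (norm (a *\<^sub>R y)))\<^sup>2 *\<^sub>R hyp_laplacian 1 w (a *\<^sub>R y)"
    using a y by (intro hyp_laplacian_eq[symmetric] w) simp
  finally show ?thesis
    using stretch_pos[of "norm (a *\<^sub>R y)"] by (simp add: a_def)
qed

lemma nn_integral_hyp_volume_scale:
  assumes \<kappa>: "0 < \<kappa>" and [measurable]: "\<phi> \<in> borel_measurable borel"
  shows "(\<integral>\<^sup>+ x. \<phi> x \<partial>hyp_volume 1) = ennreal (sqrt \<kappa> ^ 3) * (\<integral>\<^sup>+ y. \<phi> (sqrt \<kappa> *\<^sub>R y) \<partial>hyp_volume \<kappa>)"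
proof -
  define a where "a = sqrt \<kappa>"
  have a: "0 < a" using \<kappa> by (simp add: a_def)
  have "(\<integral>\<^sup>+ x. \<phi> x \<partial>hyp_volume 1) = (\<integral>\<^sup>+ x. ennreal ((stretch 1 (norm x))\<^sup>2) * \<phi> x \<partial>lborel)"
    unfolding hyp_volume_eq by (rule nn_integral_density) measurable
  also have "\<dots> = (\<integral>\<^sup>+ x. ennreal ((stretch 1 (norm x))\<^sup>2) * \<phi> x \<partial>density (distr lborel borel (\<lambda>x. 0 + a *\<^sub>R x)) (\<lambda>_. ennreal (\<bar>a\<bar> ^ DIM(real^3))))"
    using a by (subst lborel_affine[of a "0::real^3"]) auto
  also have "\<dots> = (\<integral>\<^sup>+ y. ennreal (a ^ 3) * (ennreal ((stretch 1 (norm (a *\<^sub>R y)))\<^sup>2) * \<phi> (a *\<^sub>R y)) \<partial>lborel)"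
    using a by (subst nn_integral_density, simp, simp, subst nn_integral_distr) (auto simp: abs_of_pos)
  also have "\<dots> = ennreal (a ^ 3) * (\<integral>\<^sup>+ y. ennreal ((stretch \<kappa> (norm y))\<^sup>2) * \<phi> (a *\<^sub>R y) \<partial>lborel)"
    using a \<kappa> by (subst nn_integral_cmult) (auto simp: stretch_scale[of \<kappa>] a_def[symmetric])
  also have "(\<integral>\<^sup>+ y. ennreal ((stretch \<kappa> (norm y))\<^sup>2) * \<phi> (a *\<^sub>R y) \<partial>lborel) = (\<integral>\<^sup>+ y. \<phi> (a *\<^sub>R y) \<partial>hyp_volume \<kappa>)"
    unfolding hyp_volume_eq by (rule nn_integral_density[symmetric]) measurable
  finally show ?thesis by (simp add: a_def)
qed

text \<open>\<open>g\<close> is prescribed off the origin because the Laplacian is known to scale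
  there; a point is a null set. The factor \<open>b\<close> is \<kappa> for the Laplacian term and 1
  for \<open>u\<close>.\<close>

lemma Lp_norm_hyp_volume_scale:
  assumes \<kappa>: "0 < \<kappa>" and p: "0 < p" and b: "0 < b" and f [measurable]: "f \<in> borel_measurable borel"
    and g: "\<And>y. y \<noteq> 0 \<Longrightarrow> g y = b *\<^sub>R f (sqrt \<kappa> *\<^sub>R y)"
  shows "Lp_norm p (hyp_volume \<kappa>) g = ennreal (b * sqrt \<kappa> powr (- 3 / p)) * Lp_norm p (hyp_volume 1) f"
proof -
  define a where "a = sqrt \<kappa>"
  have a: "0 < a" using \<kappa> by (simp add: a_def)
  define I where "I = (\<integral>\<^sup>+ x. ennreal (norm (f x) powr p) \<partial>hyp_volume 1)"
  define J where "J = (\<integral>\<^sup>+ y. ennreal (norm (g y) powr p) \<partial>hyp_volume \<kappa>)"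
  have "AE y in hyp_volume \<kappa>. y \<noteq> 0"
    using AE_lborel_neq[of 0] unfolding hyp_volume_eq by (subst AE_density) auto
  then have "AE y in hyp_volume \<kappa>. ennreal (norm (g y) powr p) = ennreal (b powr p) * ennreal (norm (f (a *\<^sub>R y)) powr p)"
    by eventually_elim (use b in \<open>simp add: g powr_mult ennreal_mult a_def\<close>)
  then have "J = (\<integral>\<^sup>+ y. ennreal (b powr p) * ennreal (norm (f (a *\<^sub>R y)) powr p) \<partial>hyp_volume \<kappa>)"
    unfolding J_def by (rule nn_integral_cong_AE)
  also have "\<dots> = ennreal (b powr p) * (\<integral>\<^sup>+ y. ennreal (norm (f (a *\<^sub>R y)) powr p) \<partial>hyp_volume \<kappa>)"
    by (rule nn_integral_cmult) simp
  finally have J: "J = ennreal (b powr p) * (\<integral>\<^sup>+ y. ennreal (norm (f (a *\<^sub>R y)) powr p) \<partial>hyp_volume \<kappa>)" .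
  have "I = ennreal (a ^ 3) * (\<integral>\<^sup>+ y. ennreal (norm (f (a *\<^sub>R y)) powr p) \<partial>hyp_volume \<kappa>)"
    unfolding I_def a_def by (rule nn_integral_hyp_volume_scale[OF \<kappa>]) measurable
  then have "ennreal (b powr p / a ^ 3) * I = J"
    using a b unfolding J by (simp add: mult.assoc[symmetric] ennreal_mult[symmetric])
  then have J: "J = ennreal (b powr p / a ^ 3) * I" by simp
  show ?thesis
  proof (cases I)
    case top
    then have "J = \<infinity>" using a b unfolding J by (simp add: ennreal_mult_top)
    then show ?thesis
      using top a b Lp_norm_eq_top[where f = g and p = p and M = "hyp_volume \<kappa>"]
        Lp_norm_eq_top[where f = f and p = p and M = "hyp_volume 1"]
      by (simp add: I_def J_def ennreal_mult_top a_def)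
  next
    case (real i)
    have "J = ennreal (b powr p / a ^ 3 * i)" using a b real unfolding J by (simp add: ennreal_mult[symmetric])
    then have "Lp_norm p (hyp_volume \<kappa>) g = ennreal ((b powr p / a ^ 3 * i) powr (1 / p))"
      using a b real by (intro Lp_norm_eq) (auto simp: J_def)
    moreover have "Lp_norm p (hyp_volume 1) f = ennreal (i powr (1 / p))"
      using real by (intro Lp_norm_eq) (auto simp: I_def)
    moreover have "(b powr p / a ^ 3 * i) powr (1 / p) = b * a powr (- 3 / p) * i powr (1 / p)"
    proof -
      have "(a ^ 3) powr (1 / p) = a powr (3 * (1 / p))"
        using powr_powr[of a 3 "1 / p"] a by simp
      then have "(b powr p / a ^ 3 * i) powr (1 / p) = b powr (p * (1 / p)) / a powr (3 * (1 / p)) * i powr (1 / p)"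
        using a b real by (simp add: powr_mult powr_divide powr_powr del: times_divide_eq_right)
      moreover have "a powr (- 3 / p) = 1 / a powr (3 * (1 / p))"
        using powr_minus_divide[of a "3 / p"] by simp
      ultimately show ?thesis using p b by simp
    qed
    ultimately show ?thesis
      using a b by (simp add: ennreal_mult a_def)
  qed
qed

theorem mainTheorem3:
  fixes r s :: real
  assumes "1 < r" and "r < s" and "3 * (1 / r - 1 / s) = 2" and "r < 3 / 2"
  shows "\<exists>C::real. 0 \<le> C \<and>
    (\<forall>\<kappa>>0. \<forall>u\<in>test_functions. \<forall>\<zeta>::complex.
      Lp_norm s (hyp_volume \<kappa>) u
        \<le> ennreal C * Lp_norm r (hyp_volume \<kappa>)
            (\<lambda>x. hyp_laplacian \<kappa> u x + (complex_of_real \<kappa> + \<zeta>) * u x)) \<and>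
    (\<forall>u\<in>test_functions. \<forall>\<zeta>::complex.
      Lp_norm s (hyp_volume 1) u
        \<le> ennreal C * Lp_norm r (hyp_volume 1)
            (\<lambda>x. hyp_laplacian 1 u x + (1 + \<zeta>) * u x))"
proof -
  obtain C where C: "0 < C" and est: "\<And>u \<zeta>. u \<in> test_functions \<Longrightarrow> Lp_norm s (hyp_volume 1) u
    \<le> ennreal C * Lp_norm r (hyp_volume 1) (\<lambda>x. hyp_laplacian 1 u x + (1 + \<zeta>) * u x)"
    using resolvent_estimate_curvature_1[OF assms] by blast
  have "Lp_norm s (hyp_volume \<kappa>) u \<le> ennreal C * Lp_norm r (hyp_volume \<kappa>)
      (\<lambda>x. hyp_laplacian \<kappa> u x + (complex_of_real \<kappa> + \<zeta>) * u x)"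
    if \<kappa>: "0 < \<kappa>" and u: "u \<in> test_functions" for \<kappa> u \<zeta>
  proof -
    define a where "a = sqrt \<kappa>"
    have a: "0 < a" "\<kappa> = a powr 2" using \<kappa> by (simp_all add: a_def)
    define w where "w y = u ((1 / a) *\<^sub>R y)" for y
    have w: "w \<in> test_functions"
      unfolding w_def using a by (intro test_functions_scale u) auto
    have uw: "u y = w (a *\<^sub>R y)" for y using a by (simp add: w_def)
    note [measurable] = smooth_measurable[OF test_function_smooth[OF w]] measurable_hyp_laplacian[OF test_function_smooth[OF w]]
    \<comment> \<open>The spectral parameter is rescaled too: \<kappa> + \<zeta> = \<kappa> (1 +
      \<zeta> / \<kappa>). This is harmless because the estimate holds for all parameters with one
      constant.\<close>
    define f where "f y = hyp_laplacian 1 w y + (1 + \<zeta> / of_real \<kappa>) * w y" for y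
    have f_meas: "f \<in> borel_measurable borel" unfolding f_def by measurable
    have "hyp_laplacian \<kappa> u y + (complex_of_real \<kappa> + \<zeta>) * u y = \<kappa> *\<^sub>R f (a *\<^sub>R y)" if "y \<noteq> 0" for y
    proof -
      have "hyp_laplacian \<kappa> u y = \<kappa> *\<^sub>R hyp_laplacian 1 w (a *\<^sub>R y)"
        using hyp_laplacian_scale[OF \<kappa> test_function_smooth[OF w] that] unfolding a_def[symmetric] uw[symmetric] .
      then show ?thesis
        using \<kappa> by (simp add: f_def uw scaleR_conv_of_real field_simps)
    qed
    then have Lr: "Lp_norm r (hyp_volume \<kappa>) (\<lambda>x. hyp_laplacian \<kappa> u x + (complex_of_real \<kappa> + \<zeta>) * u x)
        = ennreal (\<kappa> * a powr (- 3 / r)) * Lp_norm r (hyp_volume 1) f"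
      unfolding a_def using assms(1) \<kappa> by (intro Lp_norm_hyp_volume_scale) (auto simp: f_meas)
    have Ls: "Lp_norm s (hyp_volume \<kappa>) u = ennreal (1 * a powr (- 3 / s)) * Lp_norm s (hyp_volume 1) w"
      unfolding a_def using assms(1,2) \<kappa> uw by (intro Lp_norm_hyp_volume_scale) (auto simp: a_def)
    have c: "\<kappa> * a powr (- 3 / r) = 1 * a powr (- 3 / s)"
    proof -
      have "2 + - 3 / r = - 3 / s" using assms(3) by (simp add: algebra_simps)
      moreover have "\<kappa> * a powr (- 3 / r) = a powr (2 + - 3 / r)"
        by (simp only: a(2) powr_add)
      ultimately show ?thesis by (simp only: mult_1)
    qed
    have "Lp_norm s (hyp_volume 1) w \<le> ennreal C * Lp_norm r (hyp_volume 1) f"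
      unfolding f_def[abs_def] by (rule est[OF w])
    then show ?thesis
      unfolding Lr Ls c mult.left_commute[of "ennreal C"] by (rule mult_left_mono) simp
  qed
  with est less_imp_le[OF C] show ?thesis
    by (intro exI[of _ C] conjI allI impI ballI)
qed

end
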